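(* Let $(\Omega,\mathcal{F})$ be a measurable space, $\mathcal{P}$ a nonempty set of probability measures on $(\Omega,\mathcal{F})$ and $c(A)=\sup_{P\in\mathcal{P}}P(A)$. Suppose that $ca_c^\ast=L^\infty_c$, and let $\mathcal{A}\subset L^\infty_c$ be convex and monotone, i.e. $\mathcal{A}+(L^\infty_c)_+=\mathcal{A}$. Then the following are equivalent: (i) $\mathcal{A}$ is $\sigma(L^\infty_c,ca_c)$-closed. (ii) $\mathcal{A}$ is $\mathcal{P}$-sensitive and Fatou closed, where Fatou closed means: for any norm bounded sequence $(X_n)_{n\in\mathbb{N}}\subset\mathcal{A}$ and $X\in L^\infty_c$ such that $X_n\to X$ $\mathcal{P}$-q.s., we have $X\in\mathcal{A}$.
   Context: $\mathcal{M}_1$ is the set of all probability measures on $(\Omega,\mathcal{F})$. A statement holds $\mathcal{P}$-quasi surely ($\mathcal{P}$-q.s.) if it holds $P$-almost surely for every $P\in\mathcal{P}$. $ca$ is the space of all $\sigma$-additive $\mu:\mathcal{F}\to\mathbb{R}$ (finite signed measures) with the total variation norm, and $ca_c=\{\mu\in ca\mid c(A)=0\Rightarrow\mu(A)=0 \text{ for all } A\in\mathcal{F}\}$, with the same norm. $L^\infty_c$ is the space of bounded $\mathcal{F}$-measurable functions $\Omega\to\mathbb{R}$ modulo $\mathcal{P}$-q.s. equality, with norm $\|X\|_{c,\infty}=\inf\{m\mid \forall P\in\mathcal{P}: P(|X|\le m)=1\}$ and order $X\le Y$ iff $X\le Y$ $\mathcal{P}$-q.s.; $(L^\infty_c)_+=\{X\in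 L^\infty_c\mid X\ge 0\}$. The topology $\sigma(L^\infty_c,ca_c)$ is the weak topology on $L^\infty_c$ induced by the functionals $X\mapsto\int X\,d\mu$, $\mu\in ca_c$. $ca_c^\ast$ is the norm dual of $ca_c$. Every $X\in L^\infty_c$ defines an element of $ca_c^\ast$ by $\mu\mapsto\int X\,d\mu$; $ca_c^\ast=L^\infty_c$ means that every element of $ca_c^\ast$ is of this form. For $\mathcal{Q}\subset\mathcal{M}_1$, $\mathcal{Q}\ll\mathcal{P}$ means: for all $A\in\mathcal{F}$, $c(A)=0$ implies $Q(A)=0$ for all $Q\in\mathcal{Q}$. For $Q\in\mathcal{M}_1$ with $\{Q\}\ll\mathcal{P}$, $j_Q:L^\infty_c\to L^\infty_Q:=L^\infty(\Omega,\mathcal{F},Q)$ maps $X$ to the $Q$-a.s. equivalence class of any representative of $X$. A set $\mathcal{A}\subset L^\infty_c$ is $\mathcal{P}$-sensitive if there is $\mathcal{Q}\subset\mathcal{M}_1$ with $\mathcal{Q}\ll\mathcal{P}$ such that $\mathcal{A}=\bigcap_{Q\in\mathcal{Q}}j_Q^{-1}(j_Q(\mathcal{A}))$, i.e. $j_Q(X)\in j_Q(\mathcal{A})$ for all $Q\in\mathcal{Q}$ implies $X\in\mathcal{A}$. *)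

theory Defs
  imports "HOL-Probability.Probability"
begin

text \<open>
  Only the space and the measurable sets of the measure \<open>M\<close> are used: it stands for the
  measurable space. \<open>PP\<close> is the set of probability measures.
\<close>

definition prob_measures :: "'a measure \<Rightarrow> 'a measure set" where
  "prob_measures M = {Q. prob_space Q \<and> sets Q = sets M}"

definition qs :: "'a measure set \<Rightarrow> ('a \<Rightarrow> bool) \<Rightarrow> bool" where
  "qs PP S \<longleftrightarrow> (\<forall>P\<in>PP. AE \<omega> in P. S \<omega>)"

definition capacity :: "'a measure set \<Rightarrow> 'a set \<Rightarrow> real" where
  "capacity PP A = (SUP P\<in>PP. measure P A)"

definition dominated :: "'a measure \<Rightarrow> 'a measure set \<Rightarrow> 'a measure set \<Rightarrow> bool" where
  "dominated M QQ PP \<longleftrightarrow>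
     (\<forall>A\<in>sets M. capacity PP A = 0 \<longrightarrow> (\<forall>Q\<in>QQ. measure Q A = 0))"


subsection \<open>Finite signed measures\<close>

text \<open>
  A signed measure is a set function that takes the value 0 outside the sigma-algebra, so that
  equality of set functions is equality of signed measures. That \<open>\<mu> {} = 0\<close> follows from
  convergence of the series for the constant sequence of empty sets.
\<close>

definition ca :: "'a measure \<Rightarrow> ('a set \<Rightarrow> real) set" where
  "ca M = {\<mu>. (\<forall>A. A \<notin> sets M \<longrightarrow> \<mu> A = 0) \<and>
     (\<forall>A :: nat \<Rightarrow> 'a set. range A \<subseteq> sets M \<longrightarrow> disjoint_family A \<longrightarrow>
        (\<lambda>n. \<mu> (A n)) sums \<mu> (\<Union>n. A n))}"

text \<open>
  The supremum is over finite measurable partitions; it is finite for every \<open>\<mu> \<in> ca M\<close>.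
\<close>

definition variation :: "'a measure \<Rightarrow> ('a set \<Rightarrow> real) \<Rightarrow> 'a set \<Rightarrow> real" where
  "variation M \<mu> A =
     (SUP D\<in>{D. finite D \<and> D \<subseteq> sets M \<and> partition_on A D}. \<Sum>B\<in>D. \<bar>\<mu> B\<bar>)"

definition tv_norm :: "'a measure \<Rightarrow> ('a set \<Rightarrow> real) \<Rightarrow> real" where
  "tv_norm M \<mu> = variation M \<mu> (space M)"

text \<open>
  The Jordan decomposition \<open>\<mu> = \<mu>\<^sup>+ - \<mu>\<^sup>-\<close> with \<open>\<mu>\<^sup>+ = (\<bar>\<mu>\<bar> + \<mu>) / 2\<close> and
  \<open>\<mu>\<^sup>- = (\<bar>\<mu>\<bar> - \<mu>) / 2\<close>, and the integral it defines.
\<close>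

definition jordan_pos :: "'a measure \<Rightarrow> ('a set \<Rightarrow> real) \<Rightarrow> 'a measure" where
  "jordan_pos M \<mu> =
     measure_of (space M) (sets M) (\<lambda>A. ennreal ((variation M \<mu> A + \<mu> A) / 2))"

definition jordan_neg :: "'a measure \<Rightarrow> ('a set \<Rightarrow> real) \<Rightarrow> 'a measure" where
  "jordan_neg M \<mu> =
     measure_of (space M) (sets M) (\<lambda>A. ennreal ((variation M \<mu> A - \<mu> A) / 2))"

definition signed_integral :: "'a measure \<Rightarrow> ('a set \<Rightarrow> real) \<Rightarrow> ('a \<Rightarrow> real) \<Rightarrow> real" where
  "signed_integral M \<mu> f =
     (\<integral>\<omega>. f \<omega> \<partial>jordan_pos M \<mu>) - (\<integral>\<omega>. f \<omega> \<partial>jordan_neg M \<mu>)"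

definition ca_c :: "'a measure \<Rightarrow> 'a measure set \<Rightarrow> ('a set \<Rightarrow> real) set" where
  "ca_c M PP = {\<mu> \<in> ca M. \<forall>A\<in>sets M. capacity PP A = 0 \<longrightarrow> \<mu> A = 0}"

definition ca_c_dual :: "'a measure \<Rightarrow> 'a measure set \<Rightarrow> (('a set \<Rightarrow> real) \<Rightarrow> real) set" where
  "ca_c_dual M PP = {\<phi>.
     (\<forall>\<mu>\<in>ca_c M PP. \<forall>\<nu>\<in>ca_c M PP. \<forall>a b :: real.
        \<phi> (\<lambda>A. a * \<mu> A + b * \<nu> A) = a * \<phi> \<mu> + b * \<phi> \<nu>) \<and>
     (\<exists>K. \<forall>\<mu>\<in>ca_c M PP. \<bar>\<phi> \<mu>\<bar> \<le> K * tv_norm M \<mu>)}"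


subsection \<open>Bounded measurable functions modulo quasi-sure equality\<close>

definition bdd_meas :: "'a measure \<Rightarrow> ('a \<Rightarrow> real) set" where
  "bdd_meas M = {f \<in> borel_measurable M. \<exists>K. \<forall>\<omega>\<in>space M. \<bar>f \<omega>\<bar> \<le> K}"

definition qs_rel :: "'a measure \<Rightarrow> 'a measure set \<Rightarrow> (('a \<Rightarrow> real) \<times> ('a \<Rightarrow> real)) set" where
  "qs_rel M PP = {(f, g). f \<in> bdd_meas M \<and> g \<in> bdd_meas M \<and> qs PP (\<lambda>\<omega>. f \<omega> = g \<omega>)}"

definition Linf :: "'a measure \<Rightarrow> 'a measure set \<Rightarrow> ('a \<Rightarrow> real) set set" where
  "Linf M PP = bdd_meas M // qs_rel M PP"

definition qs_class :: "'a measure \<Rightarrow> 'a measure set \<Rightarrow> ('a \<Rightarrow> real) \<Rightarrow> ('a \<Rightarrow> real) set" where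
  "qs_class M PP f = qs_rel M PP `` {f}"

text \<open>
  A chosen representative. On \<open>Linf M PP\<close> nothing below depends on the choice: two representatives
  agree off a \<open>PP\<close>-null set, which is null for every \<open>\<mu> \<in> ca_c M PP\<close> and every \<open>Q\<close> dominated by \<open>PP\<close>.
\<close>

definition rep :: "('a \<Rightarrow> real) set \<Rightarrow> 'a \<Rightarrow> real" where
  "rep X = (SOME f. f \<in> X)"

definition Linf_add ::
    "'a measure \<Rightarrow> 'a measure set \<Rightarrow> ('a \<Rightarrow> real) set \<Rightarrow> ('a \<Rightarrow> real) set \<Rightarrow> ('a \<Rightarrow> real) set" where
  "Linf_add M PP X Y = qs_class M PP (\<lambda>\<omega>. rep X \<omega> + rep Y \<omega>)"

definition Linf_scale ::
    "'a measure \<Rightarrow> 'a measure set \<Rightarrow> real \<Rightarrow> ('a \<Rightarrow> real) set \<Rightarrow> ('a \<Rightarrow> real) set" where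
  "Linf_scale M PP t X = qs_class M PP (\<lambda>\<omega>. t * rep X \<omega>)"

definition Linf_zero :: "'a measure \<Rightarrow> 'a measure set \<Rightarrow> ('a \<Rightarrow> real) set" where
  "Linf_zero M PP = qs_class M PP (\<lambda>\<omega>. 0)"

definition Linf_le :: "'a measure set \<Rightarrow> ('a \<Rightarrow> real) set \<Rightarrow> ('a \<Rightarrow> real) set \<Rightarrow> bool" where
  "Linf_le PP X Y \<longleftrightarrow> qs PP (\<lambda>\<omega>. rep X \<omega> \<le> rep Y \<omega>)"

definition Linf_pos :: "'a measure \<Rightarrow> 'a measure set \<Rightarrow> ('a \<Rightarrow> real) set set" where
  "Linf_pos M PP = {X \<in> Linf M PP. Linf_le PP (Linf_zero M PP) X}"

definition Linf_norm :: "'a measure set \<Rightarrow> ('a \<Rightarrow> real) set \<Rightarrow> real" where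
  "Linf_norm PP X = Inf {m. \<forall>P\<in>PP. measure P {\<omega> \<in> space P. \<bar>rep X \<omega>\<bar> \<le> m} = 1}"

definition pairing :: "'a measure \<Rightarrow> ('a set \<Rightarrow> real) \<Rightarrow> ('a \<Rightarrow> real) set \<Rightarrow> real" where
  "pairing M \<mu> X = signed_integral M \<mu> (rep X)"

definition weak_topology :: "'a measure \<Rightarrow> 'a measure set \<Rightarrow> ('a \<Rightarrow> real) set topology" where
  "weak_topology M PP = topology_generated_by
     {{X \<in> Linf M PP. pairing M \<mu> X \<in> U} | \<mu> U. \<mu> \<in> ca_c M PP \<and> open U}"

definition dual_ca_c_eq_Linf :: "'a measure \<Rightarrow> 'a measure set \<Rightarrow> bool" where
  "dual_ca_c_eq_Linf M PP \<longleftrightarrow>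
     (\<forall>\<phi>\<in>ca_c_dual M PP. \<exists>X\<in>Linf M PP. \<forall>\<mu>\<in>ca_c M PP. \<phi> \<mu> = pairing M \<mu> X)"


subsection \<open>Properties of subsets\<close>

definition Linf_convex :: "'a measure \<Rightarrow> 'a measure set \<Rightarrow> ('a \<Rightarrow> real) set set \<Rightarrow> bool" where
  "Linf_convex M PP \<A> \<longleftrightarrow> (\<forall>X\<in>\<A>. \<forall>Y\<in>\<A>. \<forall>t. 0 \<le> t \<and> t \<le> 1 \<longrightarrow>
     Linf_add M PP (Linf_scale M PP t X) (Linf_scale M PP (1 - t) Y) \<in> \<A>)"

definition Linf_monotone :: "'a measure \<Rightarrow> 'a measure set \<Rightarrow> ('a \<Rightarrow> real) set set \<Rightarrow> bool" where
  "Linf_monotone M PP \<A> \<longleftrightarrow> {Linf_add M PP X Y | X Y. X \<in> \<A> \<and> Y \<in> Linf_pos M PP} = \<A>"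

text \<open>
  The space of essentially bounded functions modulo \<open>Q\<close>-a.s. equality is taken to be
  \<open>Linf M {Q}\<close>; every essentially bounded function is \<open>Q\<close>-a.s. equal to a bounded one.
\<close>

definition j_map :: "'a measure \<Rightarrow> 'a measure \<Rightarrow> ('a \<Rightarrow> real) set \<Rightarrow> ('a \<Rightarrow> real) set" where
  "j_map M Q X = qs_class M {Q} (rep X)"

definition sensitive :: "'a measure \<Rightarrow> 'a measure set \<Rightarrow> ('a \<Rightarrow> real) set set \<Rightarrow> bool" where
  "sensitive M PP \<A> \<longleftrightarrow> (\<exists>QQ. QQ \<subseteq> prob_measures M \<and> dominated M QQ PP \<and>
     \<A> = Linf M PP \<inter> (\<Inter>Q\<in>QQ. j_map M Q -` (j_map M Q ` \<A>)))"

definition fatou_closed :: "'a measure \<Rightarrow> 'a measure set \<Rightarrow> ('a \<Rightarrow> real) set set \<Rightarrow> bool" where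
  "fatou_closed M PP \<A> \<longleftrightarrow> (\<forall>(X :: nat \<Rightarrow> ('a \<Rightarrow> real) set) Y.
     (\<forall>n. X n \<in> \<A>) \<longrightarrow> (\<exists>K. \<forall>n. Linf_norm PP (X n) \<le> K) \<longrightarrow> Y \<in> Linf M PP \<longrightarrow>
     qs PP (\<lambda>\<omega>. (\<lambda>n. rep (X n) \<omega>) \<longlonglongrightarrow> rep Y \<omega>) \<longrightarrow> Y \<in> \<A>)"

end

theory Submission
  imports Defs
begin

text \<open>
  If \<open>\<A>\<close> is weakly closed and \<open>X \<notin> \<A>\<close>, a neighbourhood of \<open>X\<close> that misses \<open>\<A>\<close> is given by finitely
  many \<open>\<mu>\<^sub>i\<close>; the normalised sum \<open>Q\<close> of the \<open>\<bar>\<mu>\<^sub>i\<bar>\<close> and some \<open>P \<in> \<P>\<close> then separates \<open>j_Q X\<close> from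
  \<open>j_Q \<A>\<close>, so no Hahn-Banach argument is needed. Fatou closedness is dominated convergence.

  Conversely, by the duality hypothesis and Tychonoff the norm balls of \<open>L\<^sup>\<infinity>\<close> are weakly compact. A
  bounded part \<open>\<A>\<^sub>K\<close> of \<open>\<A>\<close> is weakly closed: if \<open>X\<close> is a point of the ball outside \<open>\<A>\<close>, sensitivity
  gives \<open>Q\<close> with \<open>j_Q X \<notin> j_Q \<A>\<^sub>K\<close>; monotonicity and the Fatou property make \<open>j_Q \<A>\<^sub>K\<close> closed in
  \<open>L\<^sup>2(Q)\<close>, and the projection of \<open>X\<close> onto it yields a bounded density that separates. It remains to
  pass from the bounded parts to \<open>\<A>\<close>, which is the Krein-Smulian theorem. Given \<open>X \<notin> \<A>\<close>, a minimax
  argument on the compact set \<open>\<A>\<^sub>n\<close> produces a measure separating \<open>X\<close> from \<open>\<A>\<^sub>n\<close>; convexity shows that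
  a correction of norm \<open>O(1/n)\<close> suffices to go from \<open>n\<close> to \<open>2 n\<close>, so the measures converge in total
  variation to one that separates \<open>X\<close> from \<open>\<A>\<close>.
\<close>

subsection \<open>Minimax on compact sets\<close>

text \<open>Functions enter as the functionals they induce on \<open>ca_c\<close>, set to 0 on all
  other set functions. Weak convergence then becomes convergence in a product space of reals, where
  Tychonoff and covering arguments apply directly. The rate 1/n is a balance of two effects. Let x
  have value above 1 on every functional of the set at distance at most n from that of X, values
  being taken relative to X. A functional at distance s > n is averaged with a fixed member of the
  set until it lies within distance n; its weight is then about n/s, so the bound survives as a
  lower bound of order -s/n on its value at x. Conversely, moving x by r in norm can raise that
  value by nearly r s. Both effects are proportional to s, so one r of order 1/n serves all s at
  once, although the distances are unbounded. The constant in r depends on a norm bound for all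
  iterates, which has to be fixed before the first radius is chosen; this is why X is first shown to
  have positive distance from the set.\<close>

lemma minimax_two:
  fixes f g :: "'c::topological_space \<Rightarrow> real"
  assumes "compact C" and "continuous_on C f" and "continuous_on C g"
    and affine: "\<And>p q t. p \<in> C \<Longrightarrow> q \<in> C \<Longrightarrow> 0 \<le> t \<Longrightarrow> t \<le> 1 \<Longrightarrow>
      \<exists>z\<in>C. f z = t * f p + (1 - t) * f q \<and> g z = t * g p + (1 - t) * g q"
    and pos: "\<And>p. p \<in> C \<Longrightarrow> 0 < f p \<or> 0 < g p"
  obtains t where "0 \<le> t" "t \<le> 1" "\<And>p. p \<in> C \<Longrightarrow> 0 < t * f p + (1 - t) * g p"
proof (cases "C = {}")
  case True
  then show thesis using that[of 0] by simp
next
  case False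
  \<comment> \<open>The image of \<open>C\<close> in the plane is compact, convex and disjoint from
    the closed quadrant of nonpositive pairs; the normal of a strictly separating line supplies the
    weights.\<close>
  define K where "K = (\<lambda>p. (f p, g p)) ` C"
  have "compact K"
    unfolding K_def using assms(1-3) by (intro compact_continuous_image continuous_on_Pair)
  moreover have "convex K"
    unfolding convex_alt
  proof (intro ballI allI impI)
    fix x y :: "real \<times> real" and u :: real
    assume "x \<in> K" "y \<in> K" and u: "0 \<le> u \<and> u \<le> 1"
    then obtain p q where p: "p \<in> C" "x = (f p, g p)" and q: "q \<in> C" "y = (f q, g q)"
      by (auto simp: K_def)
    obtain z where "z \<in> C" "f z = u * f q + (1 - u) * f p" "g z = u * g q + (1 - u) * g p"
      using affine[OF q(1) p(1)] u by blast
    then have "(1 - u) *\<^sub>R x + u *\<^sub>R y = (f z, g z)"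
      using p(2) q(2) by simp
    then show "(1 - u) *\<^sub>R x + u *\<^sub>R y \<in> K"
      using \<open>z \<in> C\<close> by (auto simp: K_def)
  qed
  moreover have "convex ({..0::real} \<times> {..0::real})" "closed ({..0::real} \<times> {..0::real})"
    by (auto intro: convex_Times closed_Times)
  moreover have "({..0} \<times> {..0}) \<inter> K = {}"
    using pos by (force simp: K_def)
  ultimately obtain a b where a: "\<And>x. x \<in> {..0} \<times> {..0} \<Longrightarrow> inner a x < b"
      and K: "\<And>x. x \<in> K \<Longrightarrow> inner a x > b"
    using separating_hyperplane_closed_compact[of "{..0} \<times> {..0}" K] False
    unfolding K_def by blast
  obtain u v where uv: "a = (u, v)" by (cases a)
  have "0 < b" using a[of "(0,0)"] by (simp add: uv)
  \<comment> \<open>If \<open>u\<close> were negative, \<open>(b / u, 0)\<close> would lie in the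
    quadrant while its inner product with \<open>a\<close> is exactly \<open>b\<close>.\<close>
  have "0 \<le> u"
  proof (rule ccontr)
    assume "\<not> 0 \<le> u"
    then show False using a[of "(b / u, 0)"] \<open>0 < b\<close> by (simp add: uv divide_le_0_iff)
  qed
  have "0 \<le> v"
  proof (rule ccontr)
    assume "\<not> 0 \<le> v"
    then show False using a[of "(0, b / v)"] \<open>0 < b\<close> by (simp add: uv divide_le_0_iff)
  qed
  have *: "0 < u * f p + v * g p" if "p \<in> C" for p
    using K[of "(f p, g p)"] that \<open>0 < b\<close> by (auto simp: uv K_def)
  have "u + v \<noteq> 0"
    using * False \<open>0 \<le> u\<close> \<open>0 \<le> v\<close> by (metis add_nonneg_eq_0_iff all_not_in_conv mult_zero_left add.right_neutral less_irrefl)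
  then have "0 < u + v" using \<open>0 \<le> u\<close> \<open>0 \<le> v\<close> by simp
  show thesis
  proof (rule that[of "u / (u + v)"])
    fix p assume "p \<in> C"
    have "u / (u + v) * f p + (1 - u / (u + v)) * g p = (u * f p + v * g p) / (u + v)"
      using \<open>0 < u + v\<close> by (simp add: diff_divide_eq_iff add_divide_distrib)
    then show "0 < u / (u + v) * f p + (1 - u / (u + v)) * g p"
      using *[OF \<open>p \<in> C\<close>] \<open>0 < u + v\<close> by simp
  qed (use \<open>0 \<le> u\<close> \<open>0 \<le> v\<close> \<open>0 < u + v\<close> in auto)
qed

text \<open>Induction with \<open>C\<close> varying: where \<open>h x\<close> is not positive, the
  remaining functions must do the work, and that part \<open>C'\<close> of \<open>C\<close> is again
  compact and closed under mixtures because \<open>h x\<close> is affine. The resulting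
  \<open>y\<close> and the removed \<open>x\<close> fall under \<open>minimax_two\<close>. Convexity
  of \<open>C\<close> and \<open>D\<close> is expressed by points realising mixtures of values,
  since neither type carries a linear structure.\<close>

lemma minimax_finite:
  fixes h :: "'i \<Rightarrow> 'c::topological_space \<Rightarrow> real"
  assumes "finite F" and "F \<noteq> {}" and "F \<subseteq> D"
    and "compact C" and cont: "\<And>x. x \<in> D \<Longrightarrow> continuous_on C (h x)"
    and affine: "\<And>p q t. p \<in> C \<Longrightarrow> q \<in> C \<Longrightarrow> 0 \<le> t \<Longrightarrow> t \<le> 1 \<Longrightarrow>
      \<exists>z\<in>C. \<forall>x\<in>D. h x z = t * h x p + (1 - t) * h x q"
    and convex: "\<And>x y t. x \<in> D \<Longrightarrow> y \<in> D \<Longrightarrow> 0 \<le> t \<Longrightarrow> t \<le> 1 \<Longrightarrow>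
      \<exists>z\<in>D. \<forall>p\<in>C. h z p = t * h x p + (1 - t) * h y p"
    and pos: "\<And>p. p \<in> C \<Longrightarrow> \<exists>x\<in>F. 0 < h x p"
  shows "\<exists>x\<in>D. \<forall>p\<in>C. 0 < h x p"
  using assms
proof (induction F arbitrary: C rule: finite_ne_induct)
  case (singleton x)
  then show ?case by (intro bexI[of _ x]) auto
next
  case (insert x F)
  have x: "x \<in> D" and F: "F \<subseteq> D" using insert.prems by auto
  define C' where "C' = C \<inter> h x -` {..0}"
  have "closedin (top_of_set C) C'"
    unfolding C'_def using insert.prems(3)[OF x] by (intro continuous_closedin_preimage) auto
  then have "compact C'"
    using insert.prems(2) closedin_compact by blast
  have "C' \<subseteq> C" by (auto simp: C'_def)
  have "\<exists>y\<in>D. \<forall>p\<in>C'. 0 < h y p"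
  proof (rule insert.IH[OF F \<open>compact C'\<close>])
    show "continuous_on C' (h x)" if "x \<in> D" for x
      using insert.prems(3)[OF that] \<open>C' \<subseteq> C\<close> by (rule continuous_on_subset)
    show "\<exists>z\<in>C'. \<forall>y\<in>D. h y z = t * h y p + (1 - t) * h y q"
      if "p \<in> C'" "q \<in> C'" "0 \<le> t" "t \<le> 1" for p q t
    proof -
      obtain z where z: "z \<in> C" "\<And>y. y \<in> D \<Longrightarrow> h y z = t * h y p + (1 - t) * h y q"
        using insert.prems(4)[of p q t] \<open>p \<in> C'\<close> \<open>q \<in> C'\<close> \<open>0 \<le> t\<close> \<open>t \<le> 1\<close> \<open>C' \<subseteq> C\<close> by (meson subsetD)
      have "t * h x p \<le> 0" "(1 - t) * h x q \<le> 0"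
        using that by (auto simp: C'_def mult_nonneg_nonpos)
      then have "z \<in> C'" using z x by (simp add: C'_def)
      then show ?thesis using z by blast
    qed
    show "\<exists>z\<in>D. \<forall>p\<in>C'. h z p = t * h y p + (1 - t) * h y' p"
      if "y \<in> D" "y' \<in> D" "0 \<le> t" "t \<le> 1" for y y' t
      using insert.prems(5)[OF that] \<open>C' \<subseteq> C\<close> by blast
    show "\<exists>y\<in>F. 0 < h y p" if "p \<in> C'" for p
      using insert.prems(6)[of p] that by (auto simp: C'_def)
  qed
  then obtain y where y: "y \<in> D" "\<And>p. p \<in> C' \<Longrightarrow> 0 < h y p" by blast
  obtain t where t: "0 \<le> t" "t \<le> 1" "\<And>p. p \<in> C \<Longrightarrow> 0 < t * h x p + (1 - t) * h y p"
  proof (rule minimax_two[of C "h x" "h y"])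
    show "compact C" "continuous_on C (h x)" "continuous_on C (h y)"
      using insert.prems x y by auto
    show "0 < h x p \<or> 0 < h y p" if "p \<in> C" for p
      using y(2)[of p] that by (force simp: C'_def)
    show "\<exists>z\<in>C. h x z = t * h x p + (1 - t) * h x q \<and> h y z = t * h y p + (1 - t) * h y q"
      if "p \<in> C" "q \<in> C" "0 \<le> t" "t \<le> 1" for p q t
      using insert.prems(4)[OF that] x y by blast
  qed auto
  obtain z where "z \<in> D" "\<forall>p\<in>C. h z p = t * h x p + (1 - t) * h y p"
    using insert.prems(5)[OF x y(1) t(1,2)] by blast
  then show ?case using t(3) by (intro bexI[of _ z]) auto
qed

text \<open>Continuity makes the sets where \<open>h x\<close> is positive open, and finitely many
  of them cover \<open>C\<close>. An extra element of \<open>D\<close> is inserted because the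
  subcover may be empty.\<close>

lemma minimax_compact:
  fixes h :: "'i \<Rightarrow> 'c::topological_space \<Rightarrow> real"
  assumes "D \<noteq> {}"
    and "compact C" and cont: "\<And>x. x \<in> D \<Longrightarrow> continuous_on UNIV (h x)"
    and affine: "\<And>p q t. p \<in> C \<Longrightarrow> q \<in> C \<Longrightarrow> 0 \<le> t \<Longrightarrow> t \<le> 1 \<Longrightarrow>
      \<exists>z\<in>C. \<forall>x\<in>D. h x z = t * h x p + (1 - t) * h x q"
    and convex: "\<And>x y t. x \<in> D \<Longrightarrow> y \<in> D \<Longrightarrow> 0 \<le> t \<Longrightarrow> t \<le> 1 \<Longrightarrow>
      \<exists>z\<in>D. \<forall>p\<in>C. h z p = t * h x p + (1 - t) * h y p"
    and pos: "\<And>p. p \<in> C \<Longrightarrow> \<exists>x\<in>D. 0 < h x p"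
  shows "\<exists>x\<in>D. \<forall>p\<in>C. 0 < h x p"
proof -
  have "open (h x -` {0<..})" if "x \<in> D" for x
    using cont[OF that] by (simp add: open_vimage)
  moreover have "C \<subseteq> (\<Union>x\<in>D. h x -` {0<..})"
    using pos by fastforce
  ultimately obtain F where F: "F \<subseteq> D" "finite F" "C \<subseteq> (\<Union>x\<in>F. h x -` {0<..})"
    using compactE_image[OF \<open>compact C\<close>, of D "\<lambda>x. h x -` {0<..}"] by blast
  obtain x0 where "x0 \<in> D" using \<open>D \<noteq> {}\<close> by blast
  show ?thesis
  proof (rule minimax_finite[of "insert x0 F"])
    show "\<exists>x\<in>insert x0 F. 0 < h x p" if "p \<in> C" for p
      using F(3) that by auto
  qed (use F \<open>x0 \<in> D\<close> \<open>compact C\<close> affine convex in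
      \<open>auto intro: continuous_on_subset[OF cont]\<close>)
qed


subsection \<open>The Krein-Smulian theorem\<close>

text \<open>In the application \<open>E\<close> is \<open>ca_c\<close> with the total variation
  norm, \<open>S\<close> consists of the functionals of the convex set, and \<open>\<phi>0\<close>
  is that of the point to be separated. Compactness refers to pointwise convergence, so
  \<open>compact\<close> says that \<open>S\<close> meets every dual ball around
  \<open>\<phi>0\<close> in a weak-star compact set. \<open>N\<close> is a seminorm, and its
  completeness is stated for sequences whose increments have summable bounds.\<close>

locale dual_convex_set =
  fixes E :: "('i \<Rightarrow> real) set" and N :: "('i \<Rightarrow> real) \<Rightarrow> real"
    and S :: "(('i \<Rightarrow> real) \<Rightarrow> real) set" and \<phi>0 :: "('i \<Rightarrow> real) \<Rightarrow> real"
  assumes lincomb: "\<And>x y a b. x \<in> E \<Longrightarrow> y \<in> E \<Longrightarrow> (\<lambda>i. a * x i + b * y i) \<in> E"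
    and nonempty: "E \<noteq> {}"
    and N_lincomb: "\<And>x y a b. x \<in> E \<Longrightarrow> y \<in> E \<Longrightarrow>
      N (\<lambda>i. a * x i + b * y i) \<le> \<bar>a\<bar> * N x + \<bar>b\<bar> * N y"
    and N_nonneg: "\<And>x. x \<in> E \<Longrightarrow> 0 \<le> N x"
    and complete: "\<And>x r. (\<And>k. x k \<in> E) \<Longrightarrow> (\<And>k. N (\<lambda>i. x (Suc k) i - x k i) \<le> r k) \<Longrightarrow>
      summable r \<Longrightarrow> \<exists>y\<in>E. (\<lambda>k. N (\<lambda>i. x k i - y i)) \<longlonglongrightarrow> 0"
    and linear: "\<And>\<phi> x y a b. \<phi> \<in> insert \<phi>0 S \<Longrightarrow> x \<in> E \<Longrightarrow> y \<in> E \<Longrightarrow>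
      \<phi> (\<lambda>i. a * x i + b * y i) = a * \<phi> x + b * \<phi> y"
    and bounded: "\<And>\<phi>. \<phi> \<in> S \<Longrightarrow> \<exists>K. \<forall>x\<in>E. \<bar>\<phi> x - \<phi>0 x\<bar> \<le> K * N x"
    and convex: "\<And>\<phi> \<psi> t. \<phi> \<in> S \<Longrightarrow> \<psi> \<in> S \<Longrightarrow> 0 \<le> t \<Longrightarrow> t \<le> 1 \<Longrightarrow>
      (\<lambda>x. t * \<phi> x + (1 - t) * \<psi> x) \<in> S"
    and compact: "\<And>K. compact {\<phi>\<in>S. \<forall>x\<in>E. \<bar>\<phi> x - \<phi>0 x\<bar> \<le> K * N x}"
    and notin: "\<And>\<phi>. \<phi> \<in> S \<Longrightarrow> \<exists>x\<in>E. \<phi> x \<noteq> \<phi>0 x"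
begin

definition d :: "(('i \<Rightarrow> real) \<Rightarrow> real) \<Rightarrow> ('i \<Rightarrow> real) \<Rightarrow> real" where
  "d \<phi> x = \<phi> x - \<phi>0 x"

definition B :: "real \<Rightarrow> (('i \<Rightarrow> real) \<Rightarrow> real) set" where
  "B K = {\<phi>\<in>S. \<forall>x\<in>E. \<bar>d \<phi> x\<bar> \<le> K * N x}"

lemma compact_B: "compact (B K)"
  using compact[of K] by (simp add: B_def d_def)

lemma d_lincomb:
  assumes "\<phi> \<in> S" "x \<in> E" "y \<in> E"
  shows "d \<phi> (\<lambda>i. a * x i + b * y i) = a * d \<phi> x + b * d \<phi> y"
  using linear[of \<phi> x y a b] linear[of \<phi>0 x y a b] assms by (simp add: d_def algebra_simps)

lemma scale_mem: "x \<in> E \<Longrightarrow> (\<lambda>i. a * x i) \<in> E"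
  using lincomb[of x x a 0] by simp

lemma N_scale: "x \<in> E \<Longrightarrow> N (\<lambda>i. a * x i) \<le> \<bar>a\<bar> * N x"
  using N_lincomb[of x x a 0] by simp

lemma d_scale: "\<phi> \<in> S \<Longrightarrow> x \<in> E \<Longrightarrow> d \<phi> (\<lambda>i. a * x i) = a * d \<phi> x"
  using d_lincomb[of \<phi> x x a 0] by simp

lemma zero_mem: "(\<lambda>i. 0) \<in> E"
  using nonempty scale_mem[of _ 0] by auto

lemma N_zero: "N (\<lambda>i. 0) = 0"
  using N_scale[OF zero_mem, of 0] N_nonneg[OF zero_mem] by simp

lemma add_mem: "x \<in> E \<Longrightarrow> y \<in> E \<Longrightarrow> (\<lambda>i. x i + y i) \<in> E"
  using lincomb[of x y 1 1] by simp

lemma diff_mem: "x \<in> E \<Longrightarrow> y \<in> E \<Longrightarrow> (\<lambda>i. x i - y i) \<in> E"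
  using lincomb[of x y 1 "-1"] by simp

lemma d_add: "\<phi> \<in> S \<Longrightarrow> x \<in> E \<Longrightarrow> y \<in> E \<Longrightarrow> d \<phi> (\<lambda>i. x i + y i) = d \<phi> x + d \<phi> y"
  using d_lincomb[of \<phi> x y 1 1] by simp

lemma d_diff: "\<phi> \<in> S \<Longrightarrow> x \<in> E \<Longrightarrow> y \<in> E \<Longrightarrow> d \<phi> (\<lambda>i. x i - y i) = d \<phi> x - d \<phi> y"
  using d_lincomb[of \<phi> x y 1 "-1"] by simp

lemma N_add: "x \<in> E \<Longrightarrow> y \<in> E \<Longrightarrow> N (\<lambda>i. x i + y i) \<le> N x + N y"
  using N_lincomb[of x y 1 1] by simp

text \<open>Compactness and minimax exchange the quantifiers: witnesses that depend on
  \<open>\<phi>\<close> are replaced by one that serves the whole ball.\<close>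

lemma uniform_witness:
  assumes "D \<subseteq> E" and "D \<noteq> {}"
    and D: "\<And>x y t. x \<in> D \<Longrightarrow> y \<in> D \<Longrightarrow> 0 \<le> t \<Longrightarrow> t \<le> 1 \<Longrightarrow> (\<lambda>i. t * x i + (1 - t) * y i) \<in> D"
    and ex: "\<And>\<phi>. \<phi> \<in> B K \<Longrightarrow> \<exists>x\<in>D. 1 < d \<phi> x"
  shows "\<exists>x\<in>D. \<forall>\<phi>\<in>B K. 1 < d \<phi> x"
proof -
  have "\<exists>x\<in>D. \<forall>\<phi>\<in>B K. 0 < d \<phi> x - 1"
  proof (rule minimax_compact[OF \<open>D \<noteq> {}\<close> compact_B])
    show "continuous_on UNIV (\<lambda>\<phi>. d \<phi> x - 1)" for x
      unfolding d_def by (intro continuous_intros continuous_on_product_coordinates)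
    show "\<exists>x\<in>D. 0 < d \<phi> x - 1" if "\<phi> \<in> B K" for \<phi>
      using ex[OF that] by auto
    show "\<exists>\<theta>\<in>B K. \<forall>x\<in>D. d \<theta> x - 1 = t * (d \<phi> x - 1) + (1 - t) * (d \<psi> x - 1)"
      if "\<phi> \<in> B K" "\<psi> \<in> B K" "0 \<le> t" "t \<le> 1" for \<phi> \<psi> t
    proof (rule bexI[of _ "\<lambda>x. t * \<phi> x + (1 - t) * \<psi> x"])
      have eq: "d (\<lambda>x. t * \<phi> x + (1 - t) * \<psi> x) x = t * d \<phi> x + (1 - t) * d \<psi> x" for x
        by (simp add: d_def algebra_simps)
      have "\<bar>t * d \<phi> x + (1 - t) * d \<psi> x\<bar> \<le> K * N x" if "x \<in> E" for x
      proof -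
        have "\<bar>t * d \<phi> x + (1 - t) * d \<psi> x\<bar> \<le> t * \<bar>d \<phi> x\<bar> + (1 - t) * \<bar>d \<psi> x\<bar>"
          using \<open>0 \<le> t\<close> \<open>t \<le> 1\<close> by (intro order_trans[OF abs_triangle_ineq]) (simp add: abs_mult)
        also have "\<dots> \<le> t * (K * N x) + (1 - t) * (K * N x)"
          using \<open>\<phi> \<in> B K\<close> \<open>\<psi> \<in> B K\<close> \<open>0 \<le> t\<close> \<open>t \<le> 1\<close> that
          by (intro add_mono mult_left_mono) (auto simp: B_def)
        finally show ?thesis by (simp add: algebra_simps)
      qed
      then show "(\<lambda>x. t * \<phi> x + (1 - t) * \<psi> x) \<in> B K"
        using that convex unfolding B_def mem_Collect_eq eq by blast
      show "\<forall>x\<in>D. d (\<lambda>x. t * \<phi> x + (1 - t) * \<psi> x) x - 1 = t * (d \<phi> x - 1) + (1 - t) * (d \<psi> x - 1)"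
        unfolding eq by (simp add: algebra_simps)
    qed
    show "\<exists>z\<in>D. \<forall>\<phi>\<in>B K. d \<phi> z - 1 = t * (d \<phi> x - 1) + (1 - t) * (d \<phi> y - 1)"
      if "x \<in> D" "y \<in> D" "0 \<le> t" "t \<le> 1" for x y t
    proof (rule bexI[OF _ D[OF that]], intro ballI)
      fix \<phi> assume "\<phi> \<in> B K"
      then have "\<phi> \<in> S" by (simp add: B_def)
      then show "d \<phi> (\<lambda>i. t * x i + (1 - t) * y i) - 1 = t * (d \<phi> x - 1) + (1 - t) * (d \<phi> y - 1)"
        using that \<open>D \<subseteq> E\<close> by (subst d_lincomb) (auto simp: algebra_simps)
    qed
  qed
  then show ?thesis by simp
qed

text \<open>Witnesses confined to a norm ball around \<open>x\<close> form a convex set, so the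
  common witness obeys the same distance bound; this controls the size of each correction.\<close>

lemma uniform_witness_ball:
  assumes x: "x \<in> E" and "0 \<le> r"
    and ex: "\<And>\<phi>. \<phi> \<in> B K \<Longrightarrow> \<exists>y\<in>E. N (\<lambda>i. y i - x i) \<le> r \<and> 1 < d \<phi> y"
  shows "\<exists>y\<in>E. N (\<lambda>i. y i - x i) \<le> r \<and> (\<forall>\<phi>\<in>B K. 1 < d \<phi> y)"
proof -
  define D where "D = {y\<in>E. N (\<lambda>i. y i - x i) \<le> r}"
  have "\<exists>y\<in>D. \<forall>\<phi>\<in>B K. 1 < d \<phi> y"
  proof (rule uniform_witness)
    show "D \<subseteq> E" by (auto simp: D_def)
    have "x \<in> D" using x \<open>0 \<le> r\<close> by (simp add: D_def N_zero)
    then show "D \<noteq> {}" by blast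
    show "\<exists>x\<in>D. 1 < d \<phi> x" if "\<phi> \<in> B K" for \<phi>
      using ex[OF that] by (auto simp: D_def)
    show "(\<lambda>i. t * y i + (1 - t) * z i) \<in> D"
      if "y \<in> D" "z \<in> D" "0 \<le> t" "t \<le> 1" for y z t
    proof -
      have yz: "y \<in> E" "z \<in> E" "N (\<lambda>i. y i - x i) \<le> r" "N (\<lambda>i. z i - x i) \<le> r"
        using that by (auto simp: D_def)
      have "(\<lambda>i. (t * y i + (1 - t) * z i) - x i) = (\<lambda>i. t * (y i - x i) + (1 - t) * (z i - x i))"
        by (simp add: algebra_simps)
      then have "N (\<lambda>i. (t * y i + (1 - t) * z i) - x i) \<le>
          \<bar>t\<bar> * N (\<lambda>i. y i - x i) + \<bar>1 - t\<bar> * N (\<lambda>i. z i - x i)"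
        using N_lincomb[OF diff_mem[OF yz(1) x] diff_mem[OF yz(2) x], of t "1 - t"] by simp
      also have "\<dots> \<le> t * r + (1 - t) * r"
        using yz that by (intro add_mono mult_mono N_nonneg diff_mem x) auto
      finally have "N (\<lambda>i. (t * y i + (1 - t) * z i) - x i) \<le> r" by (simp add: algebra_simps)
      then show ?thesis unfolding D_def using lincomb[OF yz(1,2)] by blast
    qed
  qed
  then show ?thesis by (auto simp: D_def)
qed

lemma large_value:
  assumes "\<phi> \<in> S" and "\<not> (\<forall>x\<in>E. \<bar>d \<phi> x\<bar> \<le> K * N x)" and "0 < r"
  shows "\<exists>y\<in>E. N y \<le> r \<and> K * r < d \<phi> y"
proof -
  obtain x where x: "x \<in> E" "K * N x < \<bar>d \<phi> x\<bar>" using assms by force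
  obtain K' where K': "\<And>x. x \<in> E \<Longrightarrow> \<bar>d \<phi> x\<bar> \<le> K' * N x"
    using bounded[OF \<open>\<phi> \<in> S\<close>] by (auto simp: d_def)
  \<comment> \<open>A seminorm may vanish at a nonzero element; boundedness of
    \<open>d \<phi>\<close> excludes this for \<open>x\<close>.\<close>
  have "N x \<noteq> 0" using K'[OF x(1)] x(2) by auto
  then have pos: "0 < N x" using N_nonneg[OF x(1)] by simp
  define a where "a = (if 0 \<le> d \<phi> x then r / N x else - r / N x)"
  show ?thesis
  proof (intro bexI conjI)
    show "(\<lambda>i. a * x i) \<in> E" by (rule scale_mem[OF x(1)])
    show "N (\<lambda>i. a * x i) \<le> r"
      using N_scale[OF x(1), of a] pos \<open>0 < r\<close> by (auto simp: a_def split: if_splits)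
    have "d \<phi> (\<lambda>i. a * x i) = r / N x * \<bar>d \<phi> x\<bar>"
      using d_scale[OF \<open>\<phi> \<in> S\<close> x(1)] by (simp add: a_def)
    also have "\<dots> > r / N x * (K * N x)"
      using x(2) pos \<open>0 < r\<close> by (intro mult_strict_left_mono) auto
    finally show "K * r < d \<phi> (\<lambda>i. a * x i)"
      using pos by (simp add: mult.commute)
  qed
qed

text \<open>A common witness \<open>x\<close> for \<open>B 1\<close> forces values above 1 at
  \<open>x\<close>, whereas an element of \<open>B \<delta>\<close> has value at most
  \<open>\<delta> * N x\<close> there. For small \<open>\<delta>\<close> the two are
  incompatible.\<close>

lemma B_empty: "\<exists>\<delta>>0. B \<delta> = {}"
proof -
  have "\<exists>x\<in>E. \<forall>\<phi>\<in>B 1. 1 < d \<phi> x"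
  proof (rule uniform_witness)
    show "\<exists>x\<in>E. 1 < d \<phi> x" if "\<phi> \<in> B 1" for \<phi>
    proof -
      have "\<phi> \<in> S" using that by (simp add: B_def)
      then obtain x where x: "x \<in> E" "d \<phi> x \<noteq> 0" using notin by (auto simp: d_def)
      then have "1 < d \<phi> (\<lambda>i. 2 / d \<phi> x * x i)"
        using d_scale[OF \<open>\<phi> \<in> S\<close> x(1), of "2 / d \<phi> x"] by simp
      then show ?thesis using scale_mem[OF x(1)] by blast
    qed
  qed (use nonempty lincomb in auto)
  then obtain x where x: "x \<in> E" "\<And>\<phi>. \<phi> \<in> B 1 \<Longrightarrow> 1 < d \<phi> x" by blast
  \<comment> \<open>The summand 1 keeps the denominator positive and gives
    \<open>\<delta> \<le> 1\<close>, hence \<open>B \<delta> \<subseteq> B 1\<close>.\<close>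
  define \<delta> where "\<delta> = 1 / (N x + 1)"
  have \<delta>: "0 < \<delta>" "\<delta> \<le> 1" "\<delta> * N x \<le> 1" using N_nonneg[OF x(1)] by (auto simp: \<delta>_def field_simps)
  have "\<phi> \<notin> B \<delta>" for \<phi>
  proof
    assume "\<phi> \<in> B \<delta>"
    then have "\<phi> \<in> S" and b: "\<And>y. y \<in> E \<Longrightarrow> \<bar>d \<phi> y\<bar> \<le> \<delta> * N y" by (auto simp: B_def)
    have "\<bar>d \<phi> y\<bar> \<le> 1 * N y" if "y \<in> E" for y
      using b[OF that] mult_right_mono[OF \<delta>(2) N_nonneg[OF that]] by linarith
    then have "\<phi> \<in> B 1" using \<open>\<phi> \<in> S\<close> by (simp add: B_def)
    then show False using x(2) b[OF x(1)] \<delta>(3) by fastforce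
  qed
  then show ?thesis using \<delta>(1) by blast
qed

text \<open>
  A functional far from \<open>\<phi>0\<close> is pulled into \<open>B n\<close> by averaging with the fixed \<open>\<psi>\<close>; this bounds
  \<open>d \<phi> x\<close> from below by a small multiple of the norm of \<open>d \<phi>\<close>, which a small change of \<open>x\<close>
  compensates.
\<close>

lemma correction:
  assumes x: "x \<in> E" "N x \<le> L" "\<And>\<phi>. \<phi> \<in> B n \<Longrightarrow> 1 < d \<phi> x"
    and \<psi>: "\<psi> \<in> B R" and "0 < R" and "2 * R \<le> n" and "0 \<le> L"
    and r: "r = (2 * R * L + 1) / n" and "\<phi> \<in> S"
  shows "\<exists>y\<in>E. N (\<lambda>i. y i - x i) \<le> r \<and> 1 < d \<phi> y"
proof (cases "\<phi> \<in> B n")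
  case True
  have "0 \<le> r" using assms by simp
  then show ?thesis using x True by (intro bexI[of _ x]) (auto simp: N_zero)
next
  case False
  have "0 < n" using \<open>0 < R\<close> \<open>2 * R \<le> n\<close> by simp
  have RL: "0 \<le> R * L" using \<open>0 < R\<close> \<open>0 \<le> L\<close> by simp
  have "0 < r" unfolding r using \<open>0 < n\<close> RL by (intro divide_pos_pos) auto
  have "\<psi> \<in> S" using \<psi> by (simp add: B_def)
  \<comment> \<open>\<open>T\<close> collects the bounds of \<open>d \<phi>\<close>, and its infimum
    \<open>s\<close> is the dual norm, which turns out to be a bound itself.\<close>
  define T where "T = {K. \<forall>x\<in>E. \<bar>d \<phi> x\<bar> \<le> K * N x}"
  define s where "s = Inf T"
  have "n \<notin> T" using False \<open>\<phi> \<in> S\<close> by (simp add: T_def B_def)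
  have up: "K' \<in> T" if "K \<in> T" "K \<le> K'" for K K'
    using that mult_right_mono[OF \<open>K \<le> K'\<close> N_nonneg] unfolding T_def
    by (auto intro: order_trans)
  have lower: "n \<le> K" if "K \<in> T" for K using up[OF that, of n] \<open>n \<notin> T\<close> by linarith
  then have bdd: "bdd_below T" by (auto simp: bdd_below_def)
  obtain K0 where K0: "K0 \<in> T" using bounded[OF \<open>\<phi> \<in> S\<close>] by (auto simp: T_def d_def)
  have "s \<in> T"
    unfolding T_def mem_Collect_eq
  proof
    fix y assume y: "y \<in> E"
    show "\<bar>d \<phi> y\<bar> \<le> s * N y"
    proof (cases "N y = 0")
      case True
      then show ?thesis using K0 y by (force simp: T_def)
    next
      case False
      then have "0 < N y" using N_nonneg[OF y] by simp
      have "\<bar>d \<phi> y\<bar> / N y \<le> s"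
        unfolding s_def using K0 y \<open>0 < N y\<close>
        by (intro cInf_greatest) (auto simp: T_def field_simps)
      then show ?thesis using \<open>0 < N y\<close> by (simp add: field_simps)
    qed
  qed
  then have "n < s" using lower[of s] \<open>n \<notin> T\<close> by (cases "n = s") auto
  \<comment> \<open>With this weight \<open>t * s + R = n\<close>, so the average with
    \<open>\<psi>\<close>, whose distance from \<open>\<phi>0\<close> is at most \<open>R\<close>,
    lands in \<open>B n\<close>.\<close>
  define t where "t = (n - R) / s"
  have t: "0 < t" "t \<le> 1" "t * s = n - R"
    using \<open>0 < n\<close> \<open>0 < R\<close> \<open>2 * R \<le> n\<close> \<open>n < s\<close> by (auto simp: t_def field_simps)
  define \<theta> where "\<theta> = (\<lambda>x. t * \<phi> x + (1 - t) * \<psi> x)"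
  have d\<theta>: "d \<theta> y = t * d \<phi> y + (1 - t) * d \<psi> y" for y
    by (simp add: d_def \<theta>_def algebra_simps)
  have "\<theta> \<in> B n"
    unfolding B_def mem_Collect_eq
  proof (intro conjI ballI)
    show "\<theta> \<in> S" unfolding \<theta>_def using convex[OF \<open>\<phi> \<in> S\<close> \<open>\<psi> \<in> S\<close>] t by simp
    fix y assume y: "y \<in> E"
    have "\<bar>d \<theta> y\<bar> \<le> t * \<bar>d \<phi> y\<bar> + (1 - t) * \<bar>d \<psi> y\<bar>"
      unfolding d\<theta> using t by (intro order_trans[OF abs_triangle_ineq]) (simp add: abs_mult)
    also have "\<dots> \<le> t * (s * N y) + 1 * (R * N y)"
      using \<open>s \<in> T\<close> \<psi> y t by (intro add_mono mult_mono) (auto simp: T_def B_def)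
    also have "\<dots> = (t * s) * N y + R * N y" by simp
    also have "\<dots> = n * N y" unfolding t(3) by (simp add: algebra_simps)
    finally show "\<bar>d \<theta> y\<bar> \<le> n * N y" .
  qed
  from x(3)[OF this] have "1 < t * d \<phi> x + (1 - t) * d \<psi> x" unfolding d\<theta> .
  moreover have "(1 - t) * d \<psi> x \<le> 1 * \<bar>d \<psi> x\<bar>"
    using t(1,2) by (intro order_trans[OF mult_left_mono[OF abs_ge_self] mult_right_mono]) auto
  moreover have "\<bar>d \<psi> x\<bar> \<le> R * N x" using \<psi> x(1) by (simp add: B_def)
  moreover have "R * N x \<le> R * L" using x(2) \<open>0 < R\<close> by simp
  ultimately have "- (R * L) < t * d \<phi> x" by linarith
  \<comment> \<open>Division by \<open>t\<close> magnifies the loss \<open>R * L\<close> by the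
    factor \<open>s / (n - R)\<close>, which \<open>2 * R \<le> n\<close> bounds by
    \<open>2 * s / n\<close>.\<close>
  have "- (2 * R * L / n) * s \<le> d \<phi> x"
  proof -
    have "s / (n - R) * - (R * L) \<le> s / (n - R) * (t * d \<phi> x)"
      using \<open>- (R * L) < t * d \<phi> x\<close> \<open>n < s\<close> \<open>0 < n\<close> \<open>0 < R\<close> \<open>2 * R \<le> n\<close>
      by (intro mult_left_mono) auto
    also have "\<dots> = d \<phi> x"
      using \<open>n < s\<close> \<open>0 < n\<close> \<open>0 < R\<close> \<open>2 * R \<le> n\<close> by (simp add: t_def)
    finally have "- (R * L * s * (1 / (n - R))) \<le> d \<phi> x" by (simp add: algebra_simps)
    moreover have "1 / (n - R) \<le> 2 / n"
      using \<open>0 < n\<close> \<open>0 < R\<close> \<open>2 * R \<le> n\<close> by (simp add: field_simps)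
    then have "R * L * s * (1 / (n - R)) \<le> R * L * s * (2 / n)"
      using RL \<open>n < s\<close> \<open>0 < n\<close> by (intro mult_left_mono) auto
    ultimately show ?thesis by (simp add: algebra_simps)
  qed
  \<comment> \<open>The summand 1 in \<open>r\<close> contributes \<open>s / n\<close>, which
    exceeds the required value 1; the rest of \<open>r * s\<close> cancels the loss.\<close>
  moreover have "r * s = 2 * R * L / n * s + s / n"
    using \<open>0 < n\<close> by (simp add: r field_simps)
  moreover have "1 < s / n" using \<open>n < s\<close> \<open>0 < n\<close> by simp
  ultimately have "1 < d \<phi> x + r * s" by simp
  \<comment> \<open>The slope that a change of norm \<open>r\<close> must achieve to lift the value
    to 1. Being below the dual norm \<open>s\<close>, it fails as a bound, so
    \<open>large_value\<close> provides the change.\<close>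
  define s' where "s' = (1 - d \<phi> x) / r"
  have "s' < s" using \<open>1 < d \<phi> x + r * s\<close> \<open>0 < r\<close> by (simp add: s'_def field_simps)
  then have "s' \<notin> T" using cInf_lower[OF _ bdd] by (force simp: s_def)
  then obtain y where y: "y \<in> E" "N y \<le> r" "s' * r < d \<phi> y"
    using large_value[OF \<open>\<phi> \<in> S\<close> _ \<open>0 < r\<close>, of s'] by (auto simp: T_def)
  have "s' * r = 1 - d \<phi> x" using \<open>0 < r\<close> by (simp add: s'_def)
  then show ?thesis
    using y x(1) \<open>\<phi> \<in> S\<close> by (intro bexI[of _ "\<lambda>i. x i + y i"]) (auto simp: d_add add_mem)
qed

lemma separation: "\<exists>x\<in>E. \<forall>\<phi>\<in>S. 1 \<le> \<phi> x - \<phi>0 x"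
proof (cases "S = {}")
  case True
  then show ?thesis using nonempty by auto
next
  case False
  then obtain \<psi> where "\<psi> \<in> S" by blast
  then obtain K where K: "\<And>x. x \<in> E \<Longrightarrow> \<bar>d \<psi> x\<bar> \<le> K * N x"
    using bounded[OF \<open>\<psi> \<in> S\<close>] by (auto simp: d_def)
  define R where "R = max K 1"
  have "0 < R" by (simp add: R_def)
  have "\<bar>d \<psi> x\<bar> \<le> R * N x" if "x \<in> E" for x
    using K[OF that] mult_right_mono[of K R "N x"] N_nonneg[OF that] by (simp add: R_def)
  then have \<psi>: "\<psi> \<in> B R" using \<open>\<psi> \<in> S\<close> by (simp add: B_def)
  obtain \<delta> where \<delta>: "0 < \<delta>" "B \<delta> = {}" using B_empty by blast
  \<comment> \<open>Bounds the norms of all iterates: at most \<open>2 / \<delta>\<close> at the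
    start, then corrections of total size at most 2.\<close>
  define L where "L = 2 / \<delta> + 2"
  have "0 \<le> L" using \<delta> by (simp add: L_def)
  \<comment> \<open>Large enough for averaging with \<open>\<psi>\<close> at every stage and for
    \<open>r k \<le> (1 / 2) ^ k\<close>. It depends on \<open>L\<close>, so \<open>L\<close> must
    not depend on it.\<close>
  define n0 where "n0 = 2 * R + 2 * R * L + 1"
  define n where "n k = n0 * 2 ^ k" for k :: nat
  define r where "r k = (2 * R * L + 1) / n k" for k
  have "0 < n0" "2 * R \<le> n0" "2 * R * L + 1 \<le> n0"
    using \<open>0 < R\<close> \<open>0 \<le> L\<close> by (auto simp: n0_def add_nonneg_pos)
  have n: "2 * R \<le> n k" for k
    using \<open>2 * R \<le> n0\<close> \<open>0 < n0\<close> mult_left_mono[of 1 "2 ^ k :: real" n0] one_le_power[of "2::real" k]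
    unfolding n_def by linarith
  have r: "r k = (2 * R * L + 1) / n0 * (1 / 2) ^ k" for k
    by (simp add: r_def n_def power_one_over field_simps)
  have "0 \<le> r k" for k
    using \<open>0 < R\<close> \<open>0 \<le> L\<close> \<open>0 < n0\<close> by (simp add: r)
  have "summable r" unfolding r by (intro summable_mult summable_geometric) simp
  have sum_r: "sum r {..<k} \<le> 2" for k
  proof -
    have "sum r {..<k} \<le> suminf r" using \<open>summable r\<close> \<open>\<And>k. 0 \<le> r k\<close> by (intro sum_le_suminf) auto
    also have "suminf r = (2 * R * L + 1) / n0 * 2"
      unfolding r by (subst suminf_mult) (auto simp: suminf_geometric summable_geometric)
    also have "\<dots> \<le> 1 * 2"
      using \<open>2 * R * L + 1 \<le> n0\<close> \<open>0 < n0\<close> by (intro mult_right_mono) auto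
    finally show ?thesis by simp
  qed
  define P where "P k x \<longleftrightarrow> x \<in> E \<and> N x \<le> 2 / \<delta> + sum r {..<k} \<and> (\<forall>\<phi>\<in>B (n k). 1 < d \<phi> x)" for k x
  define Q where "Q k x y \<longleftrightarrow> N (\<lambda>i. y i - x i) \<le> r k" for k x and y :: "'i \<Rightarrow> real"
  \<comment> \<open>As \<open>B \<delta>\<close> is empty, every element of \<open>S\<close> exceeds
    \<open>\<delta> * (2 / \<delta>) = 2\<close> somewhere on the ball of radius
    \<open>2 / \<delta>\<close>, a radius independent of \<open>n 0\<close>.\<close>
  have start: "\<exists>x. P 0 x"
  proof -
    have "\<exists>y\<in>E. N (\<lambda>i. y i - 0) \<le> 2 / \<delta> \<and> (\<forall>\<phi>\<in>B (n 0). 1 < d \<phi> y)"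
    proof (rule uniform_witness_ball[OF zero_mem])
      fix \<phi> assume "\<phi> \<in> B (n 0)"
      then have "\<phi> \<in> S" by (simp add: B_def)
      then have "\<not> (\<forall>x\<in>E. \<bar>d \<phi> x\<bar> \<le> \<delta> * N x)" using \<delta>(2) by (auto simp: B_def)
      from large_value[OF \<open>\<phi> \<in> S\<close> this, of "2 / \<delta>"]
      show "\<exists>y\<in>E. N (\<lambda>i. y i - 0) \<le> 2 / \<delta> \<and> 1 < d \<phi> y" using \<delta>(1) by fastforce
    qed (use \<delta> in simp)
    then show ?thesis by (auto simp: P_def)
  qed
  have step: "\<exists>y. P (Suc k) y \<and> Q k x y" if "P k x" for k x
  proof -
    have x: "x \<in> E" "N x \<le> 2 / \<delta> + sum r {..<k}" "\<And>\<phi>. \<phi> \<in> B (n k) \<Longrightarrow> 1 < d \<phi> x"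
      using that by (auto simp: P_def)
    have "N x \<le> L" using x(2) sum_r[of k] by (simp add: L_def)
    \<comment> \<open>The correction is available for every element of \<open>S\<close>; the ball
      \<open>B (n (Suc k))\<close> supplies the compactness that makes it uniform.\<close>
    have "\<exists>y\<in>E. N (\<lambda>i. y i - x i) \<le> r k \<and> (\<forall>\<phi>\<in>B (n (Suc k)). 1 < d \<phi> y)"
    proof (rule uniform_witness_ball[OF x(1) \<open>0 \<le> r k\<close>])
      fix \<phi> assume "\<phi> \<in> B (n (Suc k))"
      then have "\<phi> \<in> S" by (simp add: B_def)
      show "\<exists>y\<in>E. N (\<lambda>i. y i - x i) \<le> r k \<and> 1 < d \<phi> y"
        by (rule correction[OF x(1) \<open>N x \<le> L\<close> x(3) \<psi> \<open>0 < R\<close> n \<open>0 \<le> L\<close> r_def \<open>\<phi> \<in> S\<close>])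
    qed
    then obtain y where y: "y \<in> E" "N (\<lambda>i. y i - x i) \<le> r k" "\<forall>\<phi>\<in>B (n (Suc k)). 1 < d \<phi> y"
      by blast
    have "N y \<le> N x + N (\<lambda>i. y i - x i)"
      using N_add[OF x(1) diff_mem[OF y(1) x(1)]] by simp
    then have "N y \<le> 2 / \<delta> + sum r {..<Suc k}" using x(2) y(2) by simp
    then show ?thesis using y by (auto simp: P_def Q_def)
  qed
  obtain x where xP: "\<And>k. P k (x k)" and xQ: "\<And>k. Q k (x k) (x (Suc k))"
    using dependent_nat_choice[of P Q] start step by metis
  have xE: "x k \<in> E" for k using xP[of k] by (simp add: P_def)
  have "\<exists>y\<in>E. (\<lambda>k. N (\<lambda>i. x k i - y i)) \<longlonglongrightarrow> 0"
    by (rule complete[OF xE _ \<open>summable r\<close>]) (use xQ in \<open>simp add: Q_def\<close>)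
  then obtain y where y: "y \<in> E" "(\<lambda>k. N (\<lambda>i. x k i - y i)) \<longlonglongrightarrow> 0" by blast
  have "1 \<le> d \<phi> y" if "\<phi> \<in> S" for \<phi>
  proof -
    obtain K where K: "\<And>x. x \<in> E \<Longrightarrow> \<bar>d \<phi> x\<bar> \<le> K * N x"
      using bounded[OF \<open>\<phi> \<in> S\<close>] by (auto simp: d_def)
    have "(\<lambda>k. d \<phi> (x k) - d \<phi> y) \<longlonglongrightarrow> 0"
    proof (rule Lim_null_comparison)
      show "\<forall>\<^sub>F k in sequentially. norm (d \<phi> (x k) - d \<phi> y) \<le> K * N (\<lambda>i. x k i - y i)"
        using K[OF diff_mem[OF xE y(1)]] by (simp add: d_diff[OF that xE y(1)])
      show "(\<lambda>k. K * N (\<lambda>i. x k i - y i)) \<longlonglongrightarrow> 0"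
        using tendsto_mult_left[OF y(2), of K] by simp
    qed
    then have lim: "(\<lambda>k. d \<phi> (x k)) \<longlonglongrightarrow> d \<phi> y" by (simp add: LIM_zero_iff)
    \<comment> \<open>Each \<open>\<phi>\<close> lies in \<open>B (n k)\<close> for all large
      \<open>k\<close>, so the strict bounds on the iterates pass to the limit as a weak
      one.\<close>
    obtain m :: nat where m: "K / n0 < 2 ^ m" using real_arch_pow[of 2 "K / n0"] by auto
    have "1 \<le> d \<phi> (x k)" if "m \<le> k" for k
    proof -
      have "(2::real) ^ m \<le> 2 ^ k" using that by (intro power_increasing) auto
      then have "K / n0 \<le> 2 ^ k" using m by linarith
      then have "K \<le> n k" using \<open>0 < n0\<close> by (simp add: n_def field_simps)
      then have "\<phi> \<in> B (n k)"
        using order_trans[OF K mult_right_mono[OF \<open>K \<le> n k\<close> N_nonneg]] \<open>\<phi> \<in> S\<close>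
        by (simp add: B_def)
      then show ?thesis using xP[of k] by (force simp: P_def)
    qed
    then show ?thesis using LIMSEQ_le_const[OF lim] by blast
  qed
  then show ?thesis using y(1) by (auto simp: d_def)
qed

end

subsection \<open>Finite signed measures\<close>

lemma caD:
  assumes "\<mu> \<in> ca M"
  shows ca_notin_sets: "A \<notin> sets M \<Longrightarrow> \<mu> A = 0"
    and ca_sums: "range C \<subseteq> sets M \<Longrightarrow> disjoint_family C \<Longrightarrow> (\<lambda>n. \<mu> (C n)) sums \<mu> (\<Union>n. C n)"
  using assms by (auto simp: ca_def)

lemma ca_empty:
  assumes "\<mu> \<in> ca M"
  shows "\<mu> {} = 0"
proof -
  have "(\<lambda>n::nat. \<mu> {}) sums \<mu> {}"
    using ca_sums[OF assms, of "\<lambda>n. {}"] by (simp add: disjoint_family_on_def)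
  then show ?thesis by (metis LIMSEQ_unique sums_summable summable_LIMSEQ_zero tendsto_const)
qed

lemma ca_Un:
  assumes \<mu>: "\<mu> \<in> ca M" and AB: "A \<in> sets M" "B \<in> sets M" "A \<inter> B = {}"
  shows "\<mu> (A \<union> B) = \<mu> A + \<mu> B"
proof -
  have "(\<lambda>n. \<mu> (binaryset A B n)) sums \<mu> (\<Union>n. binaryset A B n)"
    using AB by (intro ca_sums[OF \<mu>]) (auto simp: range_binaryset_eq disjoint_family_on_def binaryset_def)
  moreover have "(\<lambda>n. \<mu> (binaryset A B n)) sums (\<mu> A + \<mu> B)"
    by (rule binaryset_sums) (rule ca_empty[OF \<mu>])
  ultimately show ?thesis by (metis sums_unique2 UN_binaryset_eq)
qed

lemma ca_Diff:
  assumes "\<mu> \<in> ca M" "A \<in> sets M" "B \<in> sets M" "B \<subseteq> A"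
  shows "\<mu> (A - B) = \<mu> A - \<mu> B"
proof -
  have "\<mu> ((A - B) \<union> B) = \<mu> (A - B) + \<mu> B" using assms by (intro ca_Un) auto
  then show ?thesis using assms(4) by (simp add: Un_absorb2)
qed

lemma ca_split:
  assumes "\<mu> \<in> ca M" "A \<in> sets M" "P \<in> sets M"
  shows "\<mu> A = \<mu> (A \<inter> P) + \<mu> (A - P)"
proof -
  have "\<mu> ((A \<inter> P) \<union> (A - P)) = \<mu> (A \<inter> P) + \<mu> (A - P)" using assms by (intro ca_Un) auto
  moreover have "(A \<inter> P) \<union> (A - P) = A" by blast
  ultimately show ?thesis by simp
qed

lemma ca_lincomb:
  assumes "\<mu> \<in> ca M" "\<nu> \<in> ca M"
  shows "(\<lambda>A. a * \<mu> A + b * \<nu> A) \<in> ca M"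
  using assms unfolding ca_def by (auto intro!: sums_add sums_mult)

lemma ca_restrict:
  assumes \<mu>: "\<mu> \<in> ca M" and P: "P \<in> sets M"
  shows "(\<lambda>A. if A \<in> sets M then \<mu> (A \<inter> P) else 0) \<in> ca M"
  unfolding ca_def
proof (intro CollectI conjI allI impI)
  fix C :: "nat \<Rightarrow> 'a set" assume C: "range C \<subseteq> sets M" "disjoint_family C"
  have "(\<lambda>n. \<mu> (C n \<inter> P)) sums \<mu> (\<Union>n. C n \<inter> P)"
    using C P by (intro ca_sums[OF \<mu>]) (auto simp: disjoint_family_on_def)
  moreover have "(\<Union>n. C n) \<in> sets M" "\<And>n. C n \<in> sets M" using C by auto
  ultimately show "(\<lambda>n. if C n \<in> sets M then \<mu> (C n \<inter> P) else 0) sums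
      (if (\<Union>n. C n) \<in> sets M then \<mu> ((\<Union>n. C n) \<inter> P) else 0)" by simp
qed auto

lemma measure_in_ca:
  assumes "finite_measure m" "sets m = sets M"
  shows "measure m \<in> ca M"
proof -
  interpret finite_measure m by fact
  show ?thesis unfolding ca_def using assms(2)
    by (auto simp: measure_notin_sets intro!: finite_measure_UNION)
qed

subsection \<open>Hahn and Jordan decomposition\<close>

text \<open>Greedy choice for the Hahn decomposition: up to the truncation, a subset at least half
  as negative as any other. Truncating at 1 keeps the supremum finite at a point where no lower
  bound for \<open>\<mu>\<close> is established.\<close>

lemma ca_almost_most_negative:
  assumes \<mu>: "\<mu> \<in> ca M"
  shows "\<exists>C\<in>sets M. C \<subseteq> A \<and> \<mu> C \<le> 0 \<and>
    (\<forall>C'\<in>sets M. C' \<subseteq> A \<longrightarrow> min (- \<mu> C') 1 \<le> 2 * min (- \<mu> C) 1)"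
proof -
  define V where "V = (\<lambda>C. min (- \<mu> C) 1) ` {C\<in>sets M. C \<subseteq> A}"
  have bdd: "bdd_above V" by (auto simp: V_def intro!: bdd_aboveI[of _ 1])
  have "0 \<in> V" unfolding V_def by (rule image_eqI[of _ _ "{}"]) (auto simp: ca_empty[OF \<mu>])
  then have "0 \<le> Sup V" using bdd by (rule cSup_upper)
  have upper: "min (- \<mu> C') 1 \<le> Sup V" if "C' \<in> sets M" "C' \<subseteq> A" for C'
    using that bdd by (intro cSup_upper) (auto simp: V_def)
  show ?thesis
  proof (cases "Sup V = 0")
    case True
    then show ?thesis using upper by (intro bexI[of _ "{}"]) (auto simp: ca_empty[OF \<mu>])
  next
    case False
    then have "Sup V / 2 < Sup V" using \<open>0 \<le> Sup V\<close> by simp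
    from less_cSupE[OF this] \<open>0 \<in> V\<close> obtain v where "v \<in> V" "Sup V / 2 < v" by blast
    then obtain C where C: "C \<in> sets M" "C \<subseteq> A" "Sup V / 2 < min (- \<mu> C) 1"
      unfolding V_def by blast
    have "\<mu> C \<le> 0" using C(3) \<open>0 \<le> Sup V\<close> by (simp add: min_def split: if_splits)
    moreover have "min (- \<mu> C') 1 \<le> 2 * min (- \<mu> C) 1" if "C' \<in> sets M" "C' \<subseteq> A" for C'
      using upper[OF that] C(3) by linarith
    ultimately show ?thesis using C(1,2) by blast
  qed
qed

text \<open>Greedy exhaustion: the removed pieces are disjoint with a convergent sum, so their
  masses tend to 0, and by the greedy choice no subset of the remainder has negative mass. Every
  removed mass is at most 0, so the total does not drop.\<close>

lemma ca_positive_subset: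
  assumes \<mu>: "\<mu> \<in> ca M" and A: "A \<in> sets M"
  shows "\<exists>B\<in>sets M. B \<subseteq> A \<and> \<mu> A \<le> \<mu> B \<and> (\<forall>C\<in>sets M. C \<subseteq> B \<longrightarrow> 0 \<le> \<mu> C)"
proof -
  obtain g where g: "\<And>A. g A \<in> sets M" "\<And>A. g A \<subseteq> A" "\<And>A. \<mu> (g A) \<le> 0"
      "\<And>A C'. C' \<in> sets M \<Longrightarrow> C' \<subseteq> A \<Longrightarrow> min (- \<mu> C') 1 \<le> 2 * min (- \<mu> (g A)) 1"
    using ca_almost_most_negative[OF \<mu>] by metis
  define R where "R n = ((\<lambda>A. A - g A) ^^ n) A" for n
  define C where "C n = g (R n)" for n
  have R0: "R 0 = A" and RSuc: "\<And>n. R (Suc n) = R n - C n" by (auto simp: R_def C_def)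
  have "decseq R" by (rule decseq_SucI) (auto simp: RSuc)
  have "R n \<in> sets M" for n by (induction n) (auto simp: R0 RSuc C_def A g)
  have "C m \<inter> C n = {}" if "m < n" for m n
  proof -
    have "C n \<subseteq> R n" by (simp add: C_def g)
    also have "R n \<subseteq> R (Suc m)" using decseqD[OF \<open>decseq R\<close>, of "Suc m" n] that by simp
    finally show ?thesis by (auto simp: RSuc)
  qed
  then have disj: "disjoint_family C"
    unfolding disjoint_family_on_def by (metis Int_commute linorder_neqE_nat)
  have C_sets: "range C \<subseteq> sets M" by (auto simp: C_def g)
  note sums = ca_sums[OF \<mu> C_sets disj]
  define B where "B = A - (\<Union>n. C n)"
  have B_sub: "B \<subseteq> R n" for n
    by (induction n) (auto simp: B_def R0 RSuc)
  have CA: "(\<Union>n. C n) \<subseteq> A"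
  proof -
    have "C n \<subseteq> R 0" for n using g(2)[of "R n"] \<open>decseq R\<close> by (auto simp: C_def decseq_def)
    then show ?thesis by (auto simp: R0)
  qed
  have UC: "(\<Union>n. C n) \<in> sets M" using C_sets by auto
  have "\<mu> (\<Union>n. C n) \<le> 0"
    using sums by (rule sums_le[OF _ _ sums_zero, rotated]) (simp add: C_def g)
  then have "\<mu> A \<le> \<mu> B" using ca_Diff[OF \<mu> A UC CA] by (simp add: B_def)
  moreover have "0 \<le> \<mu> C'" if C': "C' \<in> sets M" "C' \<subseteq> B" for C'
  proof -
    have "min (- \<mu> C') 1 \<le> 2 * - \<mu> (C n)" for n
      using g(4)[OF C'(1), of "R n"] C'(2) B_sub[of n] by (fastforce simp: C_def)
    moreover have "(\<lambda>n. 2 * - \<mu> (C n)) \<longlonglongrightarrow> 2 * - 0"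
      using summable_LIMSEQ_zero[OF sums_summable[OF sums]] by (intro tendsto_intros)
    ultimately have "min (- \<mu> C') 1 \<le> 2 * - 0" by (intro LIMSEQ_le_const) auto
    then show ?thesis by (simp split: if_splits add: min_def)
  qed
  moreover have "B \<in> sets M" "B \<subseteq> A" using A UC by (auto simp: B_def)
  ultimately show ?thesis by blast
qed

lemma ca_positive_UN:
  assumes \<mu>: "\<mu> \<in> ca M" and P: "\<And>n::nat. P n \<in> sets M"
    and pos: "\<And>n C. C \<in> sets M \<Longrightarrow> C \<subseteq> P n \<Longrightarrow> 0 \<le> \<mu> C"
    and C: "C \<in> sets M" "C \<subseteq> (\<Union>n. P n)"
  shows "0 \<le> \<mu> C"
proof -
  have eq: "(\<Union>n. C \<inter> disjointed P n) = C"
    using C(2) by (auto simp: UN_disjointed_eq simp flip: Int_UN_distrib)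
  have d: "disjointed P n \<in> sets M" for n
    using sets.range_disjointed_sets[of P M] P by auto
  have "(\<lambda>n. \<mu> (C \<inter> disjointed P n)) sums \<mu> (\<Union>n. C \<inter> disjointed P n)"
  proof (rule ca_sums[OF \<mu>])
    show "disjoint_family (\<lambda>n. C \<inter> disjointed P n)"
      using disjoint_family_disjointed[of P] unfolding disjoint_family_on_def by blast
  qed (use C d in auto)
  then have sums: "(\<lambda>n. \<mu> (C \<inter> disjointed P n)) sums \<mu> C" by (simp only: eq)
  have "0 \<le> \<mu> (C \<inter> disjointed P n)" for n
    using C d disjointed_subset[of P n] by (intro pos[of _ n]) auto
  from sums_le[OF this sums_zero sums] show ?thesis .
qed

text \<open>A positive set \<open>U\<close> of maximal mass works: a set disjoint from
  \<open>U\<close> with positive mass would contain a positive set of at least that mass, and adding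
  this to \<open>U\<close> would exceed the maximum.\<close>

lemma ca_hahn:
  assumes \<mu>: "\<mu> \<in> ca M"
  obtains P where "P \<in> sets M" "\<And>C. C \<in> sets M \<Longrightarrow> C \<subseteq> P \<Longrightarrow> 0 \<le> \<mu> C"
    "\<And>C. C \<in> sets M \<Longrightarrow> C \<inter> P = {} \<Longrightarrow> \<mu> C \<le> 0"
proof -
  define pos where "pos P \<longleftrightarrow> P \<in> sets M \<and> (\<forall>C\<in>sets M. C \<subseteq> P \<longrightarrow> 0 \<le> \<mu> C)" for P
  have UN: "pos (\<Union>n. P n)" if "\<And>n::nat. pos (P n)" for P
    unfolding pos_def using that ca_positive_UN[OF \<mu>, of P] by (auto simp: pos_def)
  have mono: "\<mu> P \<le> \<mu> P'" if "pos P" "pos P'" "P \<subseteq> P'" for P P'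
  proof -
    have "0 \<le> \<mu> (P' - P)" using that by (auto simp: pos_def)
    then show ?thesis using ca_Diff[OF \<mu>, of P' P] that by (simp add: pos_def)
  qed
  have "pos {}" using ca_empty[OF \<mu>] by (auto simp: pos_def)
  \<comment> \<open>Positive sets of unbounded mass would have a union whose mass exceeds every
    natural number, yet \<open>\<mu>\<close> is real-valued.\<close>
  have bdd: "bdd_above (\<mu> ` {P. pos P})"
  proof (rule ccontr)
    assume "\<not> ?thesis"
    then have "\<exists>P. pos P \<and> real n < \<mu> P" for n
      unfolding bdd_above_def by (force simp: not_le)
    then obtain P where P: "\<And>n. pos (P n)" "\<And>n. real n < \<mu> (P n)" by metis
    have "real n < \<mu> (\<Union>n. P n)" for n
      using P(2)[of n] mono[OF P(1) UN[of P], of n] P(1) by fastforce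
    then show False using reals_Archimedean2[of "\<mu> (\<Union>n. P n)"] by (metis not_less_iff_gr_or_eq)
  qed
  define s where "s = Sup (\<mu> ` {P. pos P})"
  have "\<exists>P. pos P \<and> s - 1 / real (Suc n) < \<mu> P" for n
    using less_cSupE[of "s - 1 / real (Suc n)" "\<mu> ` {P. pos P}"] \<open>pos {}\<close> by (auto simp: s_def)
  then obtain P where P: "\<And>n. pos (P n)" "\<And>n. s - 1 / real (Suc n) < \<mu> (P n)" by metis
  define U where "U = (\<Union>n. P n)"
  have "pos U" using UN P(1) by (simp add: U_def)
  have "s - 1 / real (Suc n) < \<mu> U" for n
    using P(2)[of n] mono[OF P(1) \<open>pos U\<close>, of n] by (force simp: U_def)
  moreover have "(\<lambda>n. s - 1 / real (Suc n)) \<longlonglongrightarrow> s - 0"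
    by (intro tendsto_intros LIMSEQ_Suc[OF lim_inverse_n', of]) 
  ultimately have "s \<le> \<mu> U" using LIMSEQ_le_const2[of _ s "\<mu> U"] by (simp add: less_imp_le)
  show thesis
  proof (rule that[of U])
    show "U \<in> sets M" "\<And>C. C \<in> sets M \<Longrightarrow> C \<subseteq> U \<Longrightarrow> 0 \<le> \<mu> C" using \<open>pos U\<close> by (auto simp: pos_def)
    fix C assume C: "C \<in> sets M" "C \<inter> U = {}"
    obtain B where B: "B \<in> sets M" "B \<subseteq> C" "\<mu> C \<le> \<mu> B" "\<forall>C\<in>sets M. C \<subseteq> B \<longrightarrow> 0 \<le> \<mu> C"
      using ca_positive_subset[OF \<mu> C(1)] by blast
    have "pos (\<Union>n::nat. if n = 0 then U else B)"
      using B \<open>pos U\<close> by (intro UN) (auto simp: pos_def)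
    also have "(\<Union>n::nat. if n = 0 then U else B) = U \<union> B" by (auto split: if_splits)
    finally have "\<mu> (U \<union> B) \<le> s" unfolding s_def using bdd by (intro cSup_upper) auto
    moreover have "\<mu> (U \<union> B) = \<mu> U + \<mu> B"
      using B C \<open>pos U\<close> by (intro ca_Un[OF \<mu>]) (auto simp: pos_def)
    ultimately show "\<mu> C \<le> 0" using \<open>s \<le> \<mu> U\<close> B(3) by linarith
  qed
qed

lemma ca_sum_partition:
  assumes \<mu>: "\<mu> \<in> ca M" and "finite D" "D \<subseteq> sets M" "disjoint D"
  shows "\<mu> (\<Union>D) = (\<Sum>B\<in>D. \<mu> B)"
  using assms(2-4)
proof (induction D rule: finite_induct)
  case (insert B D)
  have "\<mu> (B \<union> \<Union>D) = \<mu> B + \<mu> (\<Union>D)"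
    using insert by (intro ca_Un[OF \<mu>]) (auto simp: disjoint_def pairwise_insert disjnt_def sets.finite_Union)
  then show ?case using insert by (simp add: pairwise_insert)
qed (simp add: ca_empty[OF \<mu>])

text \<open>The two Hahn pieces of \<open>A\<close> attain the supremum. For any other partition the
  auxiliary \<open>\<nu>\<close>, which is the total variation measure, is additive and dominates
  \<open>\<bar>\<mu> B\<bar>\<close> on each block.\<close>

lemma ca_variation_eq:
  assumes \<mu>: "\<mu> \<in> ca M" and P: "P \<in> sets M" "\<And>C. C \<in> sets M \<Longrightarrow> C \<subseteq> P \<Longrightarrow> 0 \<le> \<mu> C"
    "\<And>C. C \<in> sets M \<Longrightarrow> C \<inter> P = {} \<Longrightarrow> \<mu> C \<le> 0" and A: "A \<in> sets M"
  shows "variation M \<mu> A = \<mu> (A \<inter> P) - \<mu> (A - P)"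
  unfolding variation_def
proof (rule cSup_eq_maximum)
  \<comment> \<open>\<open>partition_on\<close> forbids empty blocks, so an empty Hahn piece has to
    be dropped.\<close>
  define D where "D = {A \<inter> P, A - P} - {{}}"
  have "(\<Sum>B\<in>D. \<bar>\<mu> B\<bar>) = (\<Sum>B\<in>{A \<inter> P, A - P}. \<bar>\<mu> B\<bar>)"
    unfolding D_def by (intro sum.mono_neutral_left) (auto simp: ca_empty[OF \<mu>])
  also have "\<dots> = \<bar>\<mu> (A \<inter> P)\<bar> + \<bar>\<mu> (A - P)\<bar>"
  \<comment> \<open>The pieces coincide only when both are empty; the pair then collapses to a
    single element.\<close>
  proof (cases "A \<inter> P = A - P")
    case True
    then have "A = {}" by blast
    then show ?thesis using ca_empty[OF \<mu>] by simp
  qed simp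
  also have "\<dots> = \<mu> (A \<inter> P) - \<mu> (A - P)"
    using P(2)[of "A \<inter> P"] P(3)[of "A - P"] A P(1)
    by (simp add: abs_of_nonpos Diff_Int_distrib2)
  finally have "\<mu> (A \<inter> P) - \<mu> (A - P) = (\<Sum>B\<in>D. \<bar>\<mu> B\<bar>)" by simp
  moreover have "partition_on A D" "finite D" "D \<subseteq> sets M"
    using A P(1) unfolding partition_on_def D_def by (auto simp: disjoint_def)
  ultimately show "\<mu> (A \<inter> P) - \<mu> (A - P) \<in>
      (\<lambda>D. \<Sum>B\<in>D. \<bar>\<mu> B\<bar>) ` {D. finite D \<and> D \<subseteq> sets M \<and> partition_on A D}" by blast
  fix x assume "x \<in> (\<lambda>D. \<Sum>B\<in>D. \<bar>\<mu> B\<bar>) ` {D. finite D \<and> D \<subseteq> sets M \<and> partition_on A D}"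
  then obtain D where D: "finite D" "D \<subseteq> sets M" "partition_on A D" and x: "x = (\<Sum>B\<in>D. \<bar>\<mu> B\<bar>)"
    by auto
  define \<nu> where "\<nu> = (\<lambda>A. 1 * (if A \<in> sets M then \<mu> (A \<inter> P) else 0) +
    (- 1) * (if A \<in> sets M then \<mu> (A \<inter> (space M - P)) else 0))"
  have \<nu>: "\<nu> \<in> ca M" unfolding \<nu>_def using P(1) by (intro ca_lincomb ca_restrict \<mu>) auto
  have \<nu>_eq: "\<nu> B = \<mu> (B \<inter> P) - \<mu> (B - P)" if "B \<in> sets M" for B
  proof -
    have "B \<inter> (space M - P) = B - P" using sets.sets_into_space[OF that] by blast
    then show ?thesis using that by (simp add: \<nu>_def)
  qed
  have "\<bar>\<mu> B\<bar> \<le> \<nu> B" if "B \<in> D" for B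
  proof -
    have B: "B \<in> sets M" using that D by auto
    have "(B - P) \<inter> P = {}" by blast
    then show ?thesis using P(2)[of "B \<inter> P"] P(3)[of "B - P"] B P(1) ca_split[OF \<mu> B P(1)]
      by (auto simp: \<nu>_eq[OF B])
  qed
  then have "x \<le> (\<Sum>B\<in>D. \<nu> B)" unfolding x by (rule sum_mono)
  also have "\<dots> = \<nu> (\<Union>D)"
    using D by (intro ca_sum_partition[OF \<nu>, symmetric]) (auto simp: partition_on_def)
  also have "\<dots> = \<mu> (A \<inter> P) - \<mu> (A - P)"
    using D A by (simp add: \<nu>_eq partition_on_def)
  finally show "x \<le> \<mu> (A \<inter> P) - \<mu> (A - P)" .
qed

text \<open>\<open>f\<close> and \<open>\<nu>\<close> are kept apart because a set off the
  sigma-algebra has no finite measurable partition, so the variation is a supremum over the empty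
  set there, while \<open>\<nu>\<close> must vanish to lie in \<open>ca M\<close>.\<close>

lemma emeasure_measure_of_ca:
  assumes \<nu>: "\<nu> \<in> ca M" and nonneg: "\<And>A. A \<in> sets M \<Longrightarrow> 0 \<le> \<nu> A"
    and eq: "\<And>A. A \<in> sets M \<Longrightarrow> f A = \<nu> A" and A: "A \<in> sets M"
  shows "emeasure (measure_of (space M) (sets M) (\<lambda>A. ennreal (f A))) A = ennreal (\<nu> A)"
proof (subst emeasure_measure_of[where M = "measure_of (space M) (sets M) (\<lambda>A. ennreal (f A))"])
  let ?m = "measure_of (space M) (sets M) (\<lambda>A. ennreal (f A))"
  have sets: "sets ?m = sets M" by simp
  show "sets M \<subseteq> Pow (space M)" by (rule sets.space_closed)
  show "A \<in> sets ?m" using A by simp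
  show "ennreal (f A) = ennreal (\<nu> A)" using eq A by simp
  show "positive (sets ?m) (\<lambda>A. ennreal (f A))"
    by (simp add: positive_def eq ca_empty[OF \<nu>])
  show "countably_additive (sets ?m) (\<lambda>A. ennreal (f A))"
    unfolding sets
  proof (rule countably_additiveI)
    fix C :: "nat \<Rightarrow> 'a set"
    assume C: "range C \<subseteq> sets M" "disjoint_family C" "(\<Union>i. C i) \<in> sets M"
    have C_sets: "C n \<in> sets M" for n using C by auto
    have "(\<Sum>n. ennreal (\<nu> (C n))) = ennreal (\<nu> (\<Union>n. C n))"
      by (rule suminf_ennreal_eq[OF nonneg[OF C_sets] ca_sums[OF \<nu> C(1,2)]])
    then show "(\<Sum>n. ennreal (f (C n))) = ennreal (f (\<Union>n. C n))"
      by (simp only: eq[OF C_sets] eq[OF C(3)])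
  qed
qed simp

lemma measure_of_ca:
  assumes "\<nu> \<in> ca M" "\<And>A. A \<in> sets M \<Longrightarrow> 0 \<le> \<nu> A" "\<And>A. A \<in> sets M \<Longrightarrow> f A = \<nu> A"
    "m = measure_of (space M) (sets M) (\<lambda>A. ennreal (f A))"
  shows "sets m = sets M" "finite_measure m" "A \<in> sets M \<Longrightarrow> measure m A = \<nu> A"
proof -
  show sets: "sets m = sets M" using assms by simp
  have space: "space m = space M" using sets by (rule sets_eq_imp_space_eq)
  have em: "emeasure m A = ennreal (\<nu> A)" if "A \<in> sets M" for A
    unfolding assms(4) by (rule emeasure_measure_of_ca[OF assms(1-3) that])
  show "finite_measure m" by (rule finite_measureI) (simp add: space em)
  show "measure m A = \<nu> A" if "A \<in> sets M" using em[OF that] assms(2)[OF that] by (simp add: measure_def)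
qed

text \<open>Everything is read off one Hahn set \<open>P\<close>. In \<open>jordan_null\<close> all
  measurable subsets are considered because \<open>\<mu> A = 0\<close> alone may be due to
  cancellation. \<open>tv_norm_attained\<close> replaces the supremum in later norm estimates by a
  single test set.\<close>

lemma jordan:
  assumes \<mu>: "\<mu> \<in> ca M"
  shows sets_jordan_pos: "sets (jordan_pos M \<mu>) = sets M"
    and sets_jordan_neg: "sets (jordan_neg M \<mu>) = sets M"
    and finite_jordan_pos: "finite_measure (jordan_pos M \<mu>)"
    and finite_jordan_neg: "finite_measure (jordan_neg M \<mu>)"
    and jordan_diff: "\<And>A. \<mu> A = measure (jordan_pos M \<mu>) A - measure (jordan_neg M \<mu>) A"
    and variation_jordan: "\<And>A. A \<in> sets M \<Longrightarrow>
      variation M \<mu> A = measure (jordan_pos M \<mu>) A + measure (jordan_neg M \<mu>) A"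
    and jordan_null: "\<And>A. A \<in> sets M \<Longrightarrow> (\<And>C. C \<in> sets M \<Longrightarrow> C \<subseteq> A \<Longrightarrow> \<mu> C = 0) \<Longrightarrow>
      measure (jordan_pos M \<mu>) A = 0 \<and> measure (jordan_neg M \<mu>) A = 0"
    and tv_norm_attained: "\<exists>P\<in>sets M. tv_norm M \<mu> = \<mu> P - \<mu> (space M - P)"
proof -
  obtain P where P: "P \<in> sets M" "\<And>C. C \<in> sets M \<Longrightarrow> C \<subseteq> P \<Longrightarrow> 0 \<le> \<mu> C"
    "\<And>C. C \<in> sets M \<Longrightarrow> C \<inter> P = {} \<Longrightarrow> \<mu> C \<le> 0" using ca_hahn[OF \<mu>] by blast
  have var: "variation M \<mu> A = \<mu> (A \<inter> P) - \<mu> (A - P)" if "A \<in> sets M" for A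
    by (rule ca_variation_eq[OF \<mu> P(1) _ _ that]) (use P in auto)
  have N: "A \<inter> (space M - P) = A - P" if "A \<in> sets M" for A
    using sets.sets_into_space[OF that] by blast
  define p where "p = (\<lambda>A. if A \<in> sets M then \<mu> (A \<inter> P) else 0)"
  \<comment> \<open>Negation is written as a linear combination with a zero second term so that
    \<open>ca_lincomb\<close> applies.\<close>
  define n where "n = (\<lambda>A. (- 1) * (if A \<in> sets M then \<mu> (A \<inter> (space M - P)) else 0) +
    0 * (if A \<in> sets M then \<mu> (A \<inter> (space M - P)) else 0))"
  have p_eq: "p A = \<mu> (A \<inter> P)" and n_eq: "n A = - \<mu> (A - P)" if "A \<in> sets M" for A
    using that N[OF that] by (auto simp: p_def n_def)
  have "p \<in> ca M" unfolding p_def by (rule ca_restrict[OF \<mu> P(1)])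
  moreover have "0 \<le> p A" if "A \<in> sets M" for A using P(2)[of "A \<inter> P"] that P(1) by (simp add: p_eq)
  moreover have "(variation M \<mu> A + \<mu> A) / 2 = p A" if "A \<in> sets M" for A
    using var[OF that] ca_split[OF \<mu> that P(1)] by (simp add: p_eq[OF that])
  ultimately have p: "sets (jordan_pos M \<mu>) = sets M" "finite_measure (jordan_pos M \<mu>)"
      "\<And>A. A \<in> sets M \<Longrightarrow> measure (jordan_pos M \<mu>) A = \<mu> (A \<inter> P)"
    using measure_of_ca[of p M _ "jordan_pos M \<mu>"] unfolding jordan_pos_def by (simp_all add: p_eq)
  have "n \<in> ca M" unfolding n_def using P(1) by (intro ca_lincomb ca_restrict[OF \<mu>]) auto
  moreover have "0 \<le> n A" if "A \<in> sets M" for A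
    using P(3)[of "A - P"] that P(1) by (auto simp: n_eq)
  moreover have "(variation M \<mu> A - \<mu> A) / 2 = n A" if "A \<in> sets M" for A
    using var[OF that] ca_split[OF \<mu> that P(1)] by (simp add: n_eq[OF that])
  ultimately have n: "sets (jordan_neg M \<mu>) = sets M" "finite_measure (jordan_neg M \<mu>)"
      "\<And>A. A \<in> sets M \<Longrightarrow> measure (jordan_neg M \<mu>) A = - \<mu> (A - P)"
    using measure_of_ca[of n M _ "jordan_neg M \<mu>"] unfolding jordan_neg_def by (simp_all add: n_eq)
  show "sets (jordan_pos M \<mu>) = sets M" "finite_measure (jordan_pos M \<mu>)"
    "sets (jordan_neg M \<mu>) = sets M" "finite_measure (jordan_neg M \<mu>)" using p n by auto
  show "\<mu> A = measure (jordan_pos M \<mu>) A - measure (jordan_neg M \<mu>) A" for A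
  proof (cases "A \<in> sets M")
    case True
    then show ?thesis using p n ca_split[OF \<mu> True P(1)] by simp
  next
    case False
    then show ?thesis using p n ca_notin_sets[OF \<mu>] by (simp add: measure_notin_sets)
  qed
  show "variation M \<mu> A = measure (jordan_pos M \<mu>) A + measure (jordan_neg M \<mu>) A"
    if "A \<in> sets M" for A using p n var[OF that] that by simp
  show "measure (jordan_pos M \<mu>) A = 0 \<and> measure (jordan_neg M \<mu>) A = 0"
    if "A \<in> sets M" "\<And>C. C \<in> sets M \<Longrightarrow> C \<subseteq> A \<Longrightarrow> \<mu> C = 0" for A
    using that p n P(1) by auto
  have "space M \<inter> P = P" using sets.sets_into_space[OF P(1)] by blast
  then show "\<exists>P\<in>sets M. tv_norm M \<mu> = \<mu> P - \<mu> (space M - P)"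
    using var[of "space M"] P(1) by (auto simp: tv_norm_def)
qed

section \<open>Total variation estimates and completeness\<close>

lemma abs_add_abs_le_tv_norm:
  assumes \<mu>: "\<mu> \<in> ca M" and A: "A \<in> sets M"
  shows "\<bar>\<mu> A\<bar> + \<bar>\<mu> (space M - A)\<bar> \<le> tv_norm M \<mu>"
proof -
  let ?p = "measure (jordan_pos M \<mu>)" and ?n = "measure (jordan_neg M \<mu>)"
  have "?p (space M) = ?p A + ?p (space M - A)" "?n (space M) = ?n A + ?n (space M - A)"
    using ca_split[OF measure_in_ca[OF finite_jordan_pos[OF \<mu>] sets_jordan_pos[OF \<mu>]] sets.top A]
      ca_split[OF measure_in_ca[OF finite_jordan_neg[OF \<mu>] sets_jordan_neg[OF \<mu>]] sets.top A]
      sets.sets_into_space[OF A] by (auto simp: Int_absorb1)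
  then show ?thesis
    using jordan_diff[OF \<mu>, of A] jordan_diff[OF \<mu>, of "space M - A"]
      variation_jordan[OF \<mu> sets.top]
      measure_nonneg[of "jordan_pos M \<mu>"] measure_nonneg[of "jordan_neg M \<mu>"]
    by (smt (verit) tv_norm_def)
qed

lemma abs_le_tv_norm:
  assumes "\<mu> \<in> ca M"
  shows "\<bar>\<mu> A\<bar> \<le> tv_norm M \<mu>"
proof (cases "A \<in> sets M")
  case True
  then show ?thesis using abs_add_abs_le_tv_norm[OF assms True] by linarith
next
  case False
  then show ?thesis
    using abs_add_abs_le_tv_norm[OF assms sets.empty_sets] ca_notin_sets[OF assms False] by linarith
qed

lemma tv_norm_nonneg: "\<mu> \<in> ca M \<Longrightarrow> 0 \<le> tv_norm M \<mu>"
  using abs_le_tv_norm[of \<mu> M "{}"] by linarith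

lemma tv_norm_le:
  assumes "\<mu> \<in> ca M" "\<And>A. A \<in> sets M \<Longrightarrow> \<bar>\<mu> A\<bar> \<le> e"
  shows "tv_norm M \<mu> \<le> 2 * e"
proof -
  obtain P where "P \<in> sets M" "tv_norm M \<mu> = \<mu> P - \<mu> (space M - P)"
    using tv_norm_attained[OF assms(1)] by blast
  then show ?thesis using assms(2)[of P] assms(2)[of "space M - P"] by auto
qed

text \<open>Evaluated at the set where the combination attains its norm, which is a test set for
  \<open>\<mu>\<close> and \<open>\<nu>\<close> as well.\<close>

lemma tv_norm_lincomb:
  assumes \<mu>: "\<mu> \<in> ca M" and \<nu>: "\<nu> \<in> ca M"
  shows "tv_norm M (\<lambda>A. a * \<mu> A + b * \<nu> A) \<le> \<bar>a\<bar> * tv_norm M \<mu> + \<bar>b\<bar> * tv_norm M \<nu>"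
proof -
  obtain P where P: "P \<in> sets M" "tv_norm M (\<lambda>A. a * \<mu> A + b * \<nu> A) =
      (a * \<mu> P + b * \<nu> P) - (a * \<mu> (space M - P) + b * \<nu> (space M - P))"
    using tv_norm_attained[OF ca_lincomb[OF \<mu> \<nu>]] by blast
  have "c * (x - y) \<le> \<bar>c\<bar> * (\<bar>x\<bar> + \<bar>y\<bar>)" for c x y :: real
  proof -
    have "c * (x - y) \<le> \<bar>c\<bar> * \<bar>x - y\<bar>" by (metis abs_ge_self abs_mult)
    also have "\<dots> \<le> \<bar>c\<bar> * (\<bar>x\<bar> + \<bar>y\<bar>)" by (intro mult_left_mono) auto
    finally show ?thesis .
  qed
  note this[of a "\<mu> P" "\<mu> (space M - P)"] this[of b "\<nu> P" "\<nu> (space M - P)"]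
  moreover note mult_left_mono[OF abs_add_abs_le_tv_norm[OF \<mu> P(1)], of "\<bar>a\<bar>"]
    mult_left_mono[OF abs_add_abs_le_tv_norm[OF \<nu> P(1)], of "\<bar>b\<bar>"]
  ultimately show ?thesis unfolding P(2) by (simp add: algebra_simps)
qed

text \<open>Countable additivity is convergence along finite unions; uniformity over all sets allows
  this limit to be exchanged with the one in \<open>k\<close>.\<close>

lemma ca_uniform_limit:
  assumes x: "\<And>k. x k \<in> ca M" and lim: "uniform_limit UNIV x \<mu> sequentially"
  shows "\<mu> \<in> ca M"
  unfolding ca_def
proof (intro CollectI conjI allI impI)
  have ptw: "(\<lambda>k. x k A) \<longlonglongrightarrow> \<mu> A" for A using tendsto_uniform_limitI[OF lim] by simp
  show "\<mu> A = 0" if "A \<notin> sets M" for A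
    using ptw[of A] ca_notin_sets[OF x that] by (simp add: LIMSEQ_const_iff)
  fix C :: "nat \<Rightarrow> 'a set" assume C: "range C \<subseteq> sets M" "disjoint_family C"
  have fin: "(\<Sum>n<N. \<nu> (C n)) = \<nu> (\<Union>n<N. C n)" if "\<nu> \<in> ca M" for \<nu> N
  proof (induction N)
    case (Suc N)
    have "\<nu> (C N \<union> (\<Union>n<N. C n)) = \<nu> (C N) + \<nu> (\<Union>n<N. C n)"
    proof (rule ca_Un[OF that])
      have "C N \<inter> C n = {}" if "n < N" for n
        using C(2) that unfolding disjoint_family_on_def by (metis UNIV_I less_irrefl)
      then show "C N \<inter> (\<Union>n<N. C n) = {}" by auto
    qed (use C(1) in auto)
    then show ?case using Suc by (simp add: lessThan_Suc)
  qed (simp add: ca_empty[OF that])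
  have "(\<lambda>N. \<mu> (\<Union>n<N. C n)) \<longlonglongrightarrow> \<mu> (\<Union>n. C n)"
  proof (rule swap_uniform_limit')
    show "\<forall>\<^sub>F N in sequentially. N \<in> (UNIV :: nat set)" by simp
    show "sequentially \<noteq> bot" by (rule sequentially_bot)
    show "\<forall>\<^sub>F k in sequentially. (\<lambda>N. x k (\<Union>n<N. C n)) \<longlonglongrightarrow> x k (\<Union>n. C n)"
    proof (rule always_eventually, rule allI)
      fix k
      show "(\<lambda>N. x k (\<Union>n<N. C n)) \<longlonglongrightarrow> x k (\<Union>n. C n)"
        using ca_sums[OF x C, of k] unfolding sums_def fin[OF x] .
    qed
    show "(\<lambda>k. x k (\<Union>n. C n)) \<longlonglongrightarrow> \<mu> (\<Union>n. C n)" by (rule ptw)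
    show "uniform_limit UNIV (\<lambda>k N. x k (\<Union>n<N. C n)) (\<lambda>N. \<mu> (\<Union>n<N. C n)) sequentially"
      using lim unfolding uniform_limit_iff by (blast intro: eventually_mono)
  qed
  moreover have "\<mu> (\<Union>n<N. C n) = (\<Sum>n<N. \<mu> (C n))" for N
  proof (rule LIMSEQ_unique[OF ptw])
    show "(\<lambda>k. x k (\<Union>n<N. C n)) \<longlonglongrightarrow> (\<Sum>n<N. \<mu> (C n))"
      unfolding fin[OF x, symmetric] by (intro tendsto_sum ptw)
  qed
  ultimately show "(\<lambda>n. \<mu> (C n)) sums \<mu> (\<Union>n. C n)" by (simp add: sums_def)
qed

text \<open>The increments are bounded by \<open>r k\<close> uniformly in the set, so the
  telescoping series converges by the Weierstrass test. The pointwise limits are recorded because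
  they show that null sets persist, which keeps the limit in \<open>ca_c\<close>.\<close>

lemma ca_complete:
  assumes x: "\<And>k. x k \<in> ca M" and diff: "\<And>k. tv_norm M (\<lambda>A. x (Suc k) A - x k A) \<le> r k"
    and r: "summable r"
  shows "\<exists>\<mu>\<in>ca M. (\<lambda>k. tv_norm M (\<lambda>A. x k A - \<mu> A)) \<longlonglongrightarrow> 0 \<and> (\<forall>A. (\<lambda>k. x k A) \<longlonglongrightarrow> \<mu> A)"
proof -
  have diff_ca: "(\<lambda>A. \<nu> A - \<nu>' A) \<in> ca M" if "\<nu> \<in> ca M" "\<nu>' \<in> ca M" for \<nu> \<nu>'
    using ca_lincomb[OF that, of 1 "-1"] by simp
  have le: "\<bar>x (Suc k) A - x k A\<bar> \<le> r k" for k A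
    using abs_le_tv_norm[OF diff_ca[OF x[of "Suc k"] x[of k]], of A] diff[of k] by simp
  define \<mu> where "\<mu> A = x 0 A + (\<Sum>k. x (Suc k) A - x k A)" for A
  have "uniform_limit UNIV (\<lambda>n A. \<Sum>k<n. x (Suc k) A - x k A) (\<lambda>A. \<Sum>k. x (Suc k) A - x k A) sequentially"
    by (rule Weierstrass_m_test[OF _ r]) (simp add: le)
  from uniform_limit_add[OF uniform_limit_const[of "x 0" UNIV sequentially] this]
  have lim: "uniform_limit UNIV x \<mu> sequentially"
    by (simp add: sum_lessThan_telescope[of "\<lambda>k. x k A" for A] \<mu>_def[abs_def])
  have \<mu>: "\<mu> \<in> ca M" by (rule ca_uniform_limit[OF x lim])
  have "(\<lambda>k. tv_norm M (\<lambda>A. x k A - \<mu> A)) \<longlonglongrightarrow> 0"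
  proof (rule LIMSEQ_I)
    fix e :: real assume "0 < e"
    \<comment> \<open>\<open>tv_norm_le\<close> doubles a uniform bound, so \<open>e / 4\<close>
      leaves \<open>e / 2\<close>, which is strictly below \<open>e\<close>.\<close>
    then have "\<forall>\<^sub>F k in sequentially. \<forall>A\<in>UNIV. dist (x k A) (\<mu> A) < e / 4"
      using uniform_limitD[OF lim, of "e / 4"] by simp
    then obtain K where K: "\<And>k A. K \<le> k \<Longrightarrow> dist (x k A) (\<mu> A) < e / 4"
      unfolding eventually_sequentially by blast
    have "norm (tv_norm M (\<lambda>A. x k A - \<mu> A) - 0) < e" if "K \<le> k" for k
    proof -
      have "tv_norm M (\<lambda>A. x k A - \<mu> A) \<le> 2 * (e / 4)"
        using K[OF that] by (intro tv_norm_le[OF diff_ca[OF x \<mu>]]) (simp add: dist_real_def less_imp_le)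
      then show ?thesis using tv_norm_nonneg[OF diff_ca[OF x \<mu>], of k] \<open>0 < e\<close> by simp
    qed
    then show "\<exists>K. \<forall>k\<ge>K. norm (tv_norm M (\<lambda>A. x k A - \<mu> A) - 0) < e" by blast
  qed
  moreover have "(\<lambda>k. x k A) \<longlonglongrightarrow> \<mu> A" for A using tendsto_uniform_limitI[OF lim] by simp
  ultimately show ?thesis using \<mu> by blast
qed

subsection \<open>Integrals of bounded functions\<close>

lemma bdd_measD:
  assumes "f \<in> bdd_meas M"
  shows bdd_meas_measurable: "f \<in> borel_measurable M"
    and bdd_meas_bound: "\<exists>K\<ge>0. \<forall>\<omega>\<in>space M. \<bar>f \<omega>\<bar> \<le> K"
proof -
  show "f \<in> borel_measurable M" using assms by (simp add: bdd_meas_def)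
  obtain K where "\<forall>\<omega>\<in>space M. \<bar>f \<omega>\<bar> \<le> K" using assms by (auto simp: bdd_meas_def)
  then show "\<exists>K\<ge>0. \<forall>\<omega>\<in>space M. \<bar>f \<omega>\<bar> \<le> K" by (intro exI[of _ "\<bar>K\<bar>"]) fastforce
qed

lemma bdd_measI:
  "f \<in> borel_measurable M \<Longrightarrow> (\<And>\<omega>. \<omega> \<in> space M \<Longrightarrow> \<bar>f \<omega>\<bar> \<le> K) \<Longrightarrow> f \<in> bdd_meas M"
  by (auto simp: bdd_meas_def)

lemma bdd_meas_const [intro, simp]: "(\<lambda>_. c) \<in> bdd_meas M"
  by (rule bdd_measI[of _ _ "\<bar>c\<bar>"]) auto

lemma bdd_meas_add [intro]:
  assumes "f \<in> bdd_meas M" "g \<in> bdd_meas M"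
  shows "(\<lambda>\<omega>. f \<omega> + g \<omega>) \<in> bdd_meas M"
proof -
  obtain K L where "\<forall>\<omega>\<in>space M. \<bar>f \<omega>\<bar> \<le> K" "\<forall>\<omega>\<in>space M. \<bar>g \<omega>\<bar> \<le> L"
    using assms by (auto simp: bdd_meas_def)
  then show ?thesis using assms by (intro bdd_measI[of _ _ "K + L"]) (auto simp: bdd_meas_def intro: order_trans[OF abs_triangle_ineq] add_mono)
qed

lemma bdd_meas_mult [intro]:
  assumes "f \<in> bdd_meas M" "g \<in> bdd_meas M"
  shows "(\<lambda>\<omega>. f \<omega> * g \<omega>) \<in> bdd_meas M"
proof -
  obtain K L where "0 \<le> K" "\<forall>\<omega>\<in>space M. \<bar>f \<omega>\<bar> \<le> K" "\<forall>\<omega>\<in>space M. \<bar>g \<omega>\<bar> \<le> L"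
    using bdd_meas_bound[OF assms(1)] bdd_meas_bound[OF assms(2)] by metis
  then show ?thesis using assms by (intro bdd_measI[of _ _ "K * L"]) (auto simp: bdd_meas_def abs_mult intro: mult_mono)
qed

lemma bdd_meas_diff [intro]:
  assumes "f \<in> bdd_meas M" "g \<in> bdd_meas M"
  shows "(\<lambda>\<omega>. f \<omega> - g \<omega>) \<in> bdd_meas M"
  using bdd_meas_add[OF assms(1) bdd_meas_mult[OF bdd_meas_const[of "-1"] assms(2)]] by simp

lemma bdd_meas_indicator [intro]: "A \<in> sets M \<Longrightarrow> (indicator A :: _ \<Rightarrow> real) \<in> bdd_meas M"
  by (rule bdd_measI[of _ _ 1]) (auto simp: indicator_def)

lemma bdd_meas_max [intro]:
  assumes "f \<in> bdd_meas M"
  shows "(\<lambda>\<omega>. max (f \<omega>) c) \<in> bdd_meas M" "(\<lambda>\<omega>. min (f \<omega>) c) \<in> bdd_meas M"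
proof -
  obtain K where "\<forall>\<omega>\<in>space M. \<bar>f \<omega>\<bar> \<le> K" using assms by (auto simp: bdd_meas_def)
  then have "\<bar>max (f \<omega>) c\<bar> \<le> max K \<bar>c\<bar>" "\<bar>min (f \<omega>) c\<bar> \<le> max K \<bar>c\<bar>" if "\<omega> \<in> space M" for \<omega>
    using that by (fastforce simp: max_def min_def)+
  then show "(\<lambda>\<omega>. max (f \<omega>) c) \<in> bdd_meas M" "(\<lambda>\<omega>. min (f \<omega>) c) \<in> bdd_meas M"
    using bdd_meas_measurable[OF assms] by (auto intro!: bdd_measI[of _ _ "max K \<bar>c\<bar>"])
qed

lemma bdd_meas_uminus [intro]: "f \<in> bdd_meas M \<Longrightarrow> (\<lambda>\<omega>. - f \<omega>) \<in> bdd_meas M"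
  using bdd_meas_diff[OF bdd_meas_const[of 0]] by simp

lemma bdd_meas_cong_sets: "sets m = sets M \<Longrightarrow> bdd_meas m = bdd_meas M"
  using sets_eq_imp_space_eq[of m M] measurable_cong_sets[of m M "borel :: real measure" borel]
  by (simp add: bdd_meas_def)

lemma integrable_bdd_meas:
  fixes f :: "'a \<Rightarrow> real"
  assumes "finite_measure m" "sets m = sets M" "f \<in> bdd_meas M"
  shows "integrable m f"
proof -
  interpret finite_measure m by fact
  have "f \<in> bdd_meas m" using assms bdd_meas_cong_sets by metis
  then obtain K where "f \<in> borel_measurable m" "\<forall>\<omega>\<in>space m. \<bar>f \<omega>\<bar> \<le> K" by (auto simp: bdd_meas_def)
  then show ?thesis by (intro integrable_const_bound[of _ K]) auto
qed

text \<open>The Jordan parts of a sum need not be the sums of the Jordan parts, so linearity of the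
  signed integral is derived from linear relations between measures. One measurable induction
  carries such a relation from sets to bounded functions.\<close>

lemma sum_integral_eq_zero:
  fixes f :: "'a \<Rightarrow> real"
  assumes "finite I" and m: "\<And>i. i \<in> I \<Longrightarrow> finite_measure (m i)" "\<And>i. i \<in> I \<Longrightarrow> sets (m i) = sets M"
    and zero: "\<And>A. A \<in> sets M \<Longrightarrow> (\<Sum>i\<in>I. c i * measure (m i) A) = 0"
    and f: "f \<in> bdd_meas M"
  shows "(\<Sum>i\<in>I. c i * (\<integral>\<omega>. f \<omega> \<partial>m i)) = 0"
proof -
  have space: "space (m i) = space M" if "i \<in> I" for i using m(2)[OF that] by (rule sets_eq_imp_space_eq)
  have meas: "g \<in> borel_measurable (m i)" if "g \<in> borel_measurable M" "i \<in> I" for g :: "'a \<Rightarrow> real" and i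
    using that m(2) measurable_cong_sets by blast
  have int: "integrable (m i) g" if "i \<in> I" "g \<in> borel_measurable M" "\<forall>\<omega>\<in>space M. \<bar>g \<omega>\<bar> \<le> K" for g :: "'a \<Rightarrow> real" and K i
  proof -
    have "g \<in> bdd_meas M" using that by (intro bdd_measI[of _ _ K]) auto
    then show ?thesis by (rule integrable_bdd_meas[OF m(1)[OF \<open>i \<in> I\<close>] m(2)[OF \<open>i \<in> I\<close>]])
  qed
  \<comment> \<open>The bound belongs to the induction claim: it passes from a function to the
    summands and approximants below it and yields integrability and domination.\<close>
  have nonneg: "(\<exists>K. \<forall>\<omega>\<in>space M. u \<omega> \<le> K) \<longrightarrow> (\<Sum>i\<in>I. c i * (\<integral>\<omega>. u \<omega> \<partial>m i)) = 0"
    if "u \<in> borel_measurable M" "\<And>\<omega>. 0 \<le> u \<omega>" for u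
    using that
  proof (induction u rule: borel_measurable_induct_real)
    case (set A)
    have "(\<Sum>i\<in>I. c i * (\<integral>\<omega>. indicator A \<omega> \<partial>m i)) = (\<Sum>i\<in>I. c i * measure (m i) A)"
      using set sets.sets_into_space[OF set]
      by (intro sum.cong) (auto simp: space Int_absorb2)
    then show ?case using zero[OF set] by simp
  next
    case (mult u a)
    show ?case
    proof (intro impI)
      assume "\<exists>K. \<forall>\<omega>\<in>space M. a * u \<omega> \<le> K"
      then obtain K where K: "\<forall>\<omega>\<in>space M. a * u \<omega> \<le> K" by blast
      have "(\<Sum>i\<in>I. c i * (\<integral>\<omega>. a * u \<omega> \<partial>m i)) = a * (\<Sum>i\<in>I. c i * (\<integral>\<omega>. u \<omega> \<partial>m i))"
        by (simp add: sum_distrib_left algebra_simps)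
      moreover have "\<forall>\<omega>\<in>space M. u \<omega> \<le> K / a" if "a \<noteq> 0"
        using K that mult.hyps by (simp add: field_simps)
      \<comment> \<open>For \<open>a = 0\<close> the bound says nothing about \<open>u\<close>, but
        the sum vanishes on its own.\<close>
      ultimately show "(\<Sum>i\<in>I. c i * (\<integral>\<omega>. a * u \<omega> \<partial>m i)) = 0"
        using mult.IH by (cases "a = 0") auto
    qed
  next
    case (add u v)
    show ?case
    proof (intro impI)
      assume "\<exists>K. \<forall>\<omega>\<in>space M. v \<omega> + u \<omega> \<le> K"
      then obtain K where K: "\<And>\<omega>. \<omega> \<in> space M \<Longrightarrow> v \<omega> + u \<omega> \<le> K" by blast
      have u: "\<forall>\<omega>\<in>space M. \<bar>u \<omega>\<bar> \<le> K" and v: "\<forall>\<omega>\<in>space M. \<bar>v \<omega>\<bar> \<le> K"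
        using K add.hyps(2,4) by (smt (verit))+
      have "(\<Sum>i\<in>I. c i * (\<integral>\<omega>. v \<omega> + u \<omega> \<partial>m i)) =
          (\<Sum>i\<in>I. c i * (\<integral>\<omega>. v \<omega> \<partial>m i)) + (\<Sum>i\<in>I. c i * (\<integral>\<omega>. u \<omega> \<partial>m i))"
        using int[OF _ add.hyps(1) u] int[OF _ add.hyps(3) v]
        by (simp add: sum.distrib distrib_left)
      also have "(\<Sum>i\<in>I. c i * (\<integral>\<omega>. v \<omega> \<partial>m i)) = 0"
        using add.IH(2) v by (meson abs_le_D1)
      also have "(\<Sum>i\<in>I. c i * (\<integral>\<omega>. u \<omega> \<partial>m i)) = 0"
        using add.IH(1) u by (meson abs_le_D1)
      finally show "(\<Sum>i\<in>I. c i * (\<integral>\<omega>. v \<omega> + u \<omega> \<partial>m i)) = 0" by simp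
    qed
  next
    case (seq U)
    show ?case
    proof (intro impI)
      assume "\<exists>K. \<forall>\<omega>\<in>space M. u \<omega> \<le> K"
      then obtain K where K: "\<And>\<omega>. \<omega> \<in> space M \<Longrightarrow> u \<omega> \<le> K" by blast
      have le: "U n \<omega> \<le> K" if "\<omega> \<in> space M" for n \<omega>
      proof -
        have "incseq (\<lambda>n. U n \<omega>)" using \<open>incseq U\<close> by (auto simp: incseq_def le_fun_def)
        from incseq_le[OF this seq.hyps(4)[OF that]] show ?thesis using K[OF that] order_trans by blast
      qed
      have "(\<lambda>n. \<integral>\<omega>. U n \<omega> \<partial>m i) \<longlonglongrightarrow> (\<integral>\<omega>. u \<omega> \<partial>m i)" if "i \<in> I" for i
      proof (rule integral_dominated_convergence[where w = "\<lambda>_. K"])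
        show "u \<in> borel_measurable (m i)" by (rule meas[OF \<open>u \<in> borel_measurable M\<close> \<open>i \<in> I\<close>])
        show "U n \<in> borel_measurable (m i)" for n by (rule meas[OF seq.hyps(1) \<open>i \<in> I\<close>])
        show "integrable (m i) (\<lambda>_. K)" using finite_measure.integrable_const[OF m(1)[OF that]] .
        show "AE \<omega> in m i. (\<lambda>n. U n \<omega>) \<longlonglongrightarrow> u \<omega>" using seq.hyps(4) by (intro AE_I2) (simp add: space[OF that])
        show "AE \<omega> in m i. norm (U n \<omega>) \<le> K" for n
          using le seq.hyps(2) by (intro AE_I2) (simp add: space[OF that])
      qed
      then have "(\<lambda>n. \<Sum>i\<in>I. c i * (\<integral>\<omega>. U n \<omega> \<partial>m i)) \<longlonglongrightarrow> (\<Sum>i\<in>I. c i * (\<integral>\<omega>. u \<omega> \<partial>m i))"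
        by (intro tendsto_sum tendsto_mult_left)
      moreover have "(\<Sum>i\<in>I. c i * (\<integral>\<omega>. U n \<omega> \<partial>m i)) = 0" for n
        using seq.IH[of n] le by blast
      ultimately show "(\<Sum>i\<in>I. c i * (\<integral>\<omega>. u \<omega> \<partial>m i)) = 0" by (simp add: LIMSEQ_const_iff)
    qed
  qed
  obtain K where K: "0 \<le> K" "\<forall>\<omega>\<in>space M. \<bar>f \<omega>\<bar> \<le> K" using bdd_meas_bound[OF f] by blast
  have pn: "(\<lambda>\<omega>. max (f \<omega>) 0) \<in> bdd_meas M" "(\<lambda>\<omega>. max (- f \<omega>) 0) \<in> bdd_meas M"
    using f by (auto intro: bdd_meas_max bdd_meas_uminus)
  have eq: "f = (\<lambda>\<omega>. max (f \<omega>) 0 - max (- f \<omega>) 0)" by (auto simp: max_def)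
  have "(\<integral>\<omega>. f \<omega> \<partial>m i) = (\<integral>\<omega>. max (f \<omega>) 0 \<partial>m i) - (\<integral>\<omega>. max (- f \<omega>) 0 \<partial>m i)" if "i \<in> I" for i
    by (subst eq, rule Bochner_Integration.integral_diff) (use integrable_bdd_meas[OF m(1,2)[OF that]] pn in auto)
  then have "(\<Sum>i\<in>I. c i * (\<integral>\<omega>. f \<omega> \<partial>m i)) =
    (\<Sum>i\<in>I. c i * (\<integral>\<omega>. max (f \<omega>) 0 \<partial>m i)) - (\<Sum>i\<in>I. c i * (\<integral>\<omega>. max (- f \<omega>) 0 \<partial>m i))"
    by (simp add: right_diff_distrib sum_subtractf)
  also have "(\<Sum>i\<in>I. c i * (\<integral>\<omega>. max (f \<omega>) 0 \<partial>m i)) = 0"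
    using bdd_meas_measurable[OF pn(1)] K
    by (intro nonneg[THEN mp] exI[of _ K]) fastforce+
  also have "(\<Sum>i\<in>I. c i * (\<integral>\<omega>. max (- f \<omega>) 0 \<partial>m i)) = 0"
    using bdd_meas_measurable[OF pn(2)] K
    by (intro nonneg[THEN mp] exI[of _ K]) fastforce+
  finally show ?thesis by simp
qed

text \<open>Terms are indexed by their position, so a relation can be written out as a literal list
  in which a repeated measure counts repeatedly.\<close>

lemma sum_list_integral_eq_zero:
  fixes f :: "'a \<Rightarrow> real"
  assumes m: "\<And>c m. (c, m) \<in> set L \<Longrightarrow> finite_measure m \<and> sets m = sets M"
    and zero: "\<And>A. A \<in> sets M \<Longrightarrow> (\<Sum>(c, m)\<leftarrow>L. c * measure m A) = 0"
    and f: "f \<in> bdd_meas M"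
  shows "(\<Sum>(c, m)\<leftarrow>L. c * (\<integral>\<omega>. f \<omega> \<partial>m)) = 0"
proof -
  have eq: "(\<Sum>(c, m)\<leftarrow>L. h c m) = (\<Sum>i\<in>{..<length L}. h (fst (L ! i)) (snd (L ! i)))"
    for h :: "real \<Rightarrow> 'a measure \<Rightarrow> real"
    by (simp add: sum_list_sum_nth atLeast0LessThan case_prod_unfold)
  show ?thesis
    unfolding eq
  proof (rule sum_integral_eq_zero[OF _ _ _ _ f])
    show "finite_measure (snd (L ! i))" "sets (snd (L ! i)) = sets M" if "i \<in> {..<length L}" for i
      using m[of "fst (L ! i)" "snd (L ! i)"] that by auto
    show "(\<Sum>i\<in>{..<length L}. fst (L ! i) * measure (snd (L ! i)) A) = 0" if "A \<in> sets M" for A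
      using zero[OF that] unfolding eq .
  qed simp
qed

section \<open>Signed integrals and measures with bounded density\<close>

lemma signed_integral_eq:
  assumes \<mu>: "\<mu> \<in> ca M" and f: "f \<in> bdd_meas M"
    and p: "finite_measure p" "sets p = sets M" and n: "finite_measure n" "sets n = sets M"
    and eq: "\<And>A. A \<in> sets M \<Longrightarrow> \<mu> A = measure p A - measure n A"
  shows "signed_integral M \<mu> f = (\<integral>\<omega>. f \<omega> \<partial>p) - (\<integral>\<omega>. f \<omega> \<partial>n)"
proof -
  let ?L = "[(1, jordan_pos M \<mu>), (-1, jordan_neg M \<mu>), (-1, p), (1, n)]"
  have "(\<Sum>(c, m)\<leftarrow>?L. c * (\<integral>\<omega>. f \<omega> \<partial>m)) = 0"
  proof (rule sum_list_integral_eq_zero[OF _ _ f])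
    show "(\<Sum>(c, m)\<leftarrow>?L. c * measure m A) = 0" if "A \<in> sets M" for A
      using eq[OF that] jordan_diff[OF \<mu>, of A] by simp
  qed (use p n jordan(1-4)[OF \<mu>] in auto)
  then show ?thesis by (simp add: signed_integral_def)
qed

lemma signed_integral_lincomb:
  assumes \<mu>: "\<mu> \<in> ca M" and \<nu>: "\<nu> \<in> ca M" and f: "f \<in> bdd_meas M"
  shows "signed_integral M (\<lambda>A. a * \<mu> A + b * \<nu> A) f = a * signed_integral M \<mu> f + b * signed_integral M \<nu> f"
proof -
  note lc = ca_lincomb[OF \<mu> \<nu>, of a b]
  let ?\<rho> = "\<lambda>A. a * \<mu> A + b * \<nu> A"
  let ?L = "[(1, jordan_pos M ?\<rho>), (-1, jordan_neg M ?\<rho>), (-a, jordan_pos M \<mu>), (a, jordan_neg M \<mu>),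
    (-b, jordan_pos M \<nu>), (b, jordan_neg M \<nu>)]"
  have "(\<Sum>(c, m)\<leftarrow>?L. c * (\<integral>\<omega>. f \<omega> \<partial>m)) = 0"
  proof (rule sum_list_integral_eq_zero[OF _ _ f])
    show "(\<Sum>(c, m)\<leftarrow>?L. c * measure m A) = 0" if "A \<in> sets M" for A
      using jordan_diff[OF lc, of A] jordan_diff[OF \<mu>, of A] jordan_diff[OF \<nu>, of A]
      by (simp add: algebra_simps)
  qed (use jordan(1-4)[OF lc] jordan(1-4)[OF \<mu>] jordan(1-4)[OF \<nu>] in auto)
  then show ?thesis by (simp add: signed_integral_def algebra_simps)
qed

definition density_ca :: "'a measure \<Rightarrow> 'a measure \<Rightarrow> ('a \<Rightarrow> real) \<Rightarrow> 'a set \<Rightarrow> real" where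
  "density_ca M Q f A = (if A \<in> sets M then (\<integral>\<omega>. f \<omega> * indicator A \<omega> \<partial>Q) else 0)"

lemma density_nonneg:
  assumes Q: "finite_measure Q" "sets Q = sets M" and f: "f \<in> bdd_meas M" "\<And>\<omega>. 0 \<le> f \<omega>"
  shows "finite_measure (density Q f)" "sets (density Q f) = sets M"
    "A \<in> sets M \<Longrightarrow> measure (density Q f) A = (\<integral>\<omega>. f \<omega> * indicator A \<omega> \<partial>Q)"
    "g \<in> bdd_meas M \<Longrightarrow> (\<integral>\<omega>. g \<omega> \<partial>density Q f) = (\<integral>\<omega>. f \<omega> * g \<omega> \<partial>Q)"
proof -
  have [measurable]: "f \<in> borel_measurable Q"
    using bdd_meas_measurable[OF f(1)] Q(2) measurable_cong_sets by blast
  have em: "emeasure (density Q f) A = ennreal (\<integral>\<omega>. f \<omega> * indicator A \<omega> \<partial>Q)" if "A \<in> sets M" for A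
  proof -
    have "emeasure (density Q f) A = (\<integral>\<^sup>+\<omega>. ennreal (f \<omega> * indicator A \<omega>) \<partial>Q)"
      using that Q(2) f(2) by (simp add: emeasure_density ennreal_mult' ennreal_indicator)
    also have "\<dots> = ennreal (\<integral>\<omega>. f \<omega> * indicator A \<omega> \<partial>Q)"
      using f that integrable_bdd_meas[OF Q, of "\<lambda>\<omega>. f \<omega> * indicator A \<omega>"]
      by (intro nn_integral_eq_integral) auto
    finally show ?thesis .
  qed
  show "sets (density Q f) = sets M" using Q(2) by simp
  have "space Q = space M" using Q(2) by (rule sets_eq_imp_space_eq)
  then show "finite_measure (density Q f)"
    by (intro finite_measureI) (simp add: em)
  show "measure (density Q f) A = (\<integral>\<omega>. f \<omega> * indicator A \<omega> \<partial>Q)" if "A \<in> sets M"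
    using em[OF that] f(2) by (simp add: measure_def integral_nonneg_AE)
  show "(\<integral>\<omega>. g \<omega> \<partial>density Q f) = (\<integral>\<omega>. f \<omega> * g \<omega> \<partial>Q)" if "g \<in> bdd_meas M"
  proof -
    have "g \<in> borel_measurable Q"
      using bdd_meas_measurable[OF that] Q(2) measurable_cong_sets by blast
    then show ?thesis using f(2) by (subst integral_density) auto
  qed
qed

lemma density_ca:
  assumes Q: "finite_measure Q" "sets Q = sets M" and f: "f \<in> bdd_meas M"
  shows density_ca_in_ca: "density_ca M Q f \<in> ca M"
    and signed_integral_density_ca: "g \<in> bdd_meas M \<Longrightarrow> signed_integral M (density_ca M Q f) g = (\<integral>\<omega>. f \<omega> * g \<omega> \<partial>Q)"
proof -
  define p where "p = (\<lambda>\<omega>. max (f \<omega>) 0)"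
  define n where "n = (\<lambda>\<omega>. max (- f \<omega>) 0)"
  have pn: "p \<in> bdd_meas M" "\<And>\<omega>. 0 \<le> p \<omega>" "n \<in> bdd_meas M" "\<And>\<omega>. 0 \<le> n \<omega>"
    using f by (auto simp: p_def n_def)
  have f_eq: "f = (\<lambda>\<omega>. p \<omega> - n \<omega>)" by (auto simp: p_def n_def max_def)
  have int: "(\<integral>\<omega>. f \<omega> * g \<omega> \<partial>Q) = (\<integral>\<omega>. p \<omega> * g \<omega> \<partial>Q) - (\<integral>\<omega>. n \<omega> * g \<omega> \<partial>Q)" if "g \<in> bdd_meas M" for g
  proof -
    have "(\<integral>\<omega>. f \<omega> * g \<omega> \<partial>Q) = (\<integral>\<omega>. p \<omega> * g \<omega> - n \<omega> * g \<omega> \<partial>Q)" by (simp add: f_eq left_diff_distrib)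
    also have "\<dots> = (\<integral>\<omega>. p \<omega> * g \<omega> \<partial>Q) - (\<integral>\<omega>. n \<omega> * g \<omega> \<partial>Q)"
      using pn that by (intro Bochner_Integration.integral_diff integrable_bdd_meas[OF Q] bdd_meas_mult)
    finally show ?thesis .
  qed
  note P = density_nonneg[OF Q pn(1,2)] and N = density_nonneg[OF Q pn(3,4)]
  have eq: "density_ca M Q f A = measure (density Q p) A - measure (density Q n) A" for A
  proof (cases "A \<in> sets M")
    case True
    then show ?thesis using int[OF bdd_meas_indicator[OF True]] P N by (simp add: density_ca_def)
  next
    case False
    then show ?thesis using P N by (simp add: density_ca_def measure_notin_sets)
  qed
  have "(\<lambda>A. 1 * measure (density Q p) A + (-1) * measure (density Q n) A) \<in> ca M"
    using P N by (intro ca_lincomb measure_in_ca)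
  also have "(\<lambda>A. 1 * measure (density Q p) A + (-1) * measure (density Q n) A) = density_ca M Q f"
    by (simp add: eq fun_eq_iff)
  finally show ca: "density_ca M Q f \<in> ca M" .
  show "signed_integral M (density_ca M Q f) g = (\<integral>\<omega>. f \<omega> * g \<omega> \<partial>Q)" if "g \<in> bdd_meas M"
    using signed_integral_eq[OF ca that P(1,2) N(1,2) eq] P(4)[OF that] N(4)[OF that] int[OF that] by simp
qed

lemma tv_norm_of_nonneg:
  assumes \<mu>: "\<mu> \<in> ca M" and nonneg: "\<And>A. A \<in> sets M \<Longrightarrow> 0 \<le> \<mu> A"
  shows "tv_norm M \<mu> = \<mu> (space M)"
  unfolding tv_norm_def
  by (subst ca_variation_eq[OF \<mu> sets.top]) (use nonneg ca_empty[OF \<mu>] sets.sets_into_space in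
      \<open>auto simp: inf.absorb1 intro: antisym\<close>)

text \<open>The projection \<open>g\<close> of \<open>h\<close> onto \<open>B\<close> in L2 is the
  limit of a minimising sequence. The residual \<open>Z = g - h\<close> separates, because
  minimality gives a nonnegative integral of \<open>Z * (f - g)\<close>, and the gap
  \<open>e\<close> is the squared distance \<open>D g\<close>.\<close>

lemma L2_separation:
  fixes h :: "'a \<Rightarrow> real"
  assumes Q: "prob_space Q" "sets Q = sets M"
    and B: "B \<subseteq> bdd_meas M" "B \<noteq> {}" and bound: "\<And>f \<omega>. f \<in> B \<Longrightarrow> \<omega> \<in> space M \<Longrightarrow> \<bar>f \<omega>\<bar> \<le> K"
    and convex: "\<And>f g t. f \<in> B \<Longrightarrow> g \<in> B \<Longrightarrow> 0 \<le> t \<Longrightarrow> t \<le> 1 \<Longrightarrow> (\<lambda>\<omega>. t * f \<omega> + (1 - t) * g \<omega>) \<in> B"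
    and closed: "\<And>f. (\<And>n. f n \<in> B) \<Longrightarrow> AE \<omega> in Q. convergent (\<lambda>n. f n \<omega>) \<Longrightarrow>
      \<exists>g\<in>B. AE \<omega> in Q. (\<lambda>n. f n \<omega>) \<longlonglongrightarrow> g \<omega>"
    and h: "h \<in> bdd_meas M" and notin: "\<And>g. g \<in> B \<Longrightarrow> \<not> (AE \<omega> in Q. h \<omega> = g \<omega>)"
  shows "\<exists>Z\<in>bdd_meas M. \<exists>e>0. \<forall>f\<in>B. (\<integral>\<omega>. Z \<omega> * h \<omega> \<partial>Q) + e \<le> (\<integral>\<omega>. Z \<omega> * f \<omega> \<partial>Q)"
proof -
  interpret prob_space Q by fact
  have int: "integrable Q f" if "f \<in> bdd_meas M" for f
    using integrable_bdd_meas[OF finite_measure_axioms Q(2) that] .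
  have Bm: "f \<in> bdd_meas M" if "f \<in> B" for f using B that by blast
  have space: "space Q = space M" using Q(2) by (rule sets_eq_imp_space_eq)
  define D where "D f = (\<integral>\<omega>. (f \<omega> - h \<omega>) * (f \<omega> - h \<omega>) \<partial>Q)" for f
  define s where "s = Inf (D ` B)"
  have D_nonneg: "0 \<le> D f" for f by (simp add: D_def)
  then have bdd: "bdd_below (D ` B)" by (auto simp: bdd_below_def)
  have s_le: "s \<le> D f" if "f \<in> B" for f unfolding s_def using bdd that by (auto intro: cInf_lower)
  have "\<exists>g\<in>B. D g < s + 1 / real (Suc n)" for n
    using cInf_lessD[of "D ` B" "s + 1 / real (Suc n)"] B(2) by (auto simp: s_def)
  then obtain u where u: "\<And>n. u n \<in> B" "\<And>n. D (u n) < s + 1 / real (Suc n)" by metis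
  \<comment> \<open>Parallelogram law; the midpoint \<open>m\<close> belongs to \<open>B\<close>, so
    its squared distance is at least \<open>s\<close>.\<close>
  have dist: "(\<integral>\<omega>. (f \<omega> - g \<omega>) * (f \<omega> - g \<omega>) \<partial>Q) \<le> 2 * D f + 2 * D g - 4 * s"
    if f: "f \<in> B" and g: "g \<in> B" for f g
  proof -
    define m where "m = (\<lambda>\<omega>. (1/2) * f \<omega> + (1 - 1/2) * g \<omega>)"
    have m: "m \<in> B" unfolding m_def using convex[OF f g, of "1/2"] by simp
    have "(\<integral>\<omega>. (f \<omega> - g \<omega>) * (f \<omega> - g \<omega>) \<partial>Q) =
      (\<integral>\<omega>. 2 * ((f \<omega> - h \<omega>) * (f \<omega> - h \<omega>)) + 2 * ((g \<omega> - h \<omega>) * (g \<omega> - h \<omega>)) -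
        4 * ((m \<omega> - h \<omega>) * (m \<omega> - h \<omega>)) \<partial>Q)"
      by (intro Bochner_Integration.integral_cong) (auto simp: m_def algebra_simps)
    also have "\<dots> = 2 * D f + 2 * D g - 4 * D m"
      using int[OF bdd_meas_mult[OF bdd_meas_diff[OF Bm[OF f] h] bdd_meas_diff[OF Bm[OF f] h]]]
        int[OF bdd_meas_mult[OF bdd_meas_diff[OF Bm[OF g] h] bdd_meas_diff[OF Bm[OF g] h]]]
        int[OF bdd_meas_mult[OF bdd_meas_diff[OF Bm[OF m] h] bdd_meas_diff[OF Bm[OF m] h]]]
      unfolding D_def by simp
    also have "\<dots> \<le> 2 * D f + 2 * D g - 4 * s" using s_le[OF m] by simp
    finally show ?thesis .
  qed
  \<comment> \<open>\<open>closed\<close> speaks of almost sure convergence, so an almost surely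
    Cauchy subsequence is extracted from an L1-Cauchy sequence.\<close>
  obtain r where r: "strict_mono r" "AE \<omega> in Q. Cauchy (\<lambda>i. u (r i) \<omega>)"
  proof (rule cauchy_L1_AE_cauchy_subseq[of Q u])
    show "integrable Q (u n)" for n by (rule int[OF Bm[OF u(1)]])
    fix e :: real assume "0 < e"
    \<comment> \<open>In \<open>dist\<close> the excesses of \<open>D (u i)\<close> and
      \<open>D (u j)\<close> over \<open>s\<close> carry a factor 2 each, together at most
      \<open>4 / real (Suc N)\<close>.\<close>
    then obtain N where N: "4 / real (Suc N) < e * e"
    proof -
      obtain N where "4 / (e * e) < real N" using reals_Archimedean2 by blast
      then have "4 / (e * e) < real (Suc N)" by simp
      then show thesis using that[of N] \<open>0 < e\<close> by (simp add: field_simps)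
    qed
    have "(LINT x|Q. norm (u i x - u j x)) < e" if "N \<le> i" "N \<le> j" for i j
    proof -
      let ?w = "\<lambda>\<omega>. u i \<omega> - u j \<omega>"
      have w: "?w \<in> bdd_meas M" using Bm[OF u(1)] by auto
      have "1 / real (Suc i) \<le> 1 / real (Suc N)" "1 / real (Suc j) \<le> 1 / real (Suc N)"
        using that by (auto intro!: divide_left_mono)
      then have "(\<integral>\<omega>. ?w \<omega> * ?w \<omega> \<partial>Q) < e * e"
        using dist[OF u(1) u(1), of i j] u(2)[of i] u(2)[of j] N by linarith
      \<comment> \<open>A pointwise inequality between arithmetic and geometric mean takes the place
        of Cauchy-Schwarz in passing from the squared to the L1 bound.\<close>
      have "(LINT x|Q. norm (?w x)) \<le> (\<integral>\<omega>. 1 / (2 * e) * (?w \<omega> * ?w \<omega>) + e / 2 \<partial>Q)"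
      proof (rule integral_mono)
        show "integrable Q (\<lambda>\<omega>. norm (?w \<omega>))" using int[OF w] by simp
        show "integrable Q (\<lambda>\<omega>. 1 / (2 * e) * (?w \<omega> * ?w \<omega>) + e / 2)"
          by (rule int[OF bdd_meas_add[OF bdd_meas_mult[OF bdd_meas_const bdd_meas_mult[OF w w]] bdd_meas_const]])
        fix \<omega>
        have "0 \<le> (\<bar>?w \<omega>\<bar> - e) * (\<bar>?w \<omega>\<bar> - e)" by simp
        then have "2 * e * \<bar>?w \<omega>\<bar> \<le> \<bar>?w \<omega>\<bar> * \<bar>?w \<omega>\<bar> + e * e" by (simp only: algebra_simps)
        then show "norm (?w \<omega>) \<le> 1 / (2 * e) * (?w \<omega> * ?w \<omega>) + e / 2"
          using \<open>0 < e\<close> by (simp add: field_simps)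
      qed
      also have "\<dots> = 1 / (2 * e) * (\<integral>\<omega>. ?w \<omega> * ?w \<omega> \<partial>Q) + e / 2"
        using int[OF bdd_meas_mult[OF w w]] by (simp add: prob_space)
      also have "\<dots> < 1 / (2 * e) * (e * e) + e / 2"
        using \<open>0 < e\<close> \<open>(\<integral>\<omega>. ?w \<omega> * ?w \<omega> \<partial>Q) < e * e\<close> by (intro add_strict_right_mono mult_strict_left_mono) auto
      also have "\<dots> = e" using \<open>0 < e\<close> by simp
      finally show ?thesis .
    qed
    then show "\<exists>N. \<forall>i\<ge>N. \<forall>j\<ge>N. LINT x|Q. norm (u i x - u j x) < e" by blast
  qed
  have "AE \<omega> in Q. convergent (\<lambda>i. u (r i) \<omega>)" using r(2) by (simp add: Cauchy_convergent_iff)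
  then obtain g where g: "g \<in> B" "AE \<omega> in Q. (\<lambda>i. u (r i) \<omega>) \<longlonglongrightarrow> g \<omega>"
    using closed[of "\<lambda>i. u (r i)"] u(1) by blast
  obtain H where H: "0 \<le> H" "\<And>\<omega>. \<omega> \<in> space M \<Longrightarrow> \<bar>h \<omega>\<bar> \<le> H" using bdd_meas_bound[OF h] by blast
  have meas: "(\<lambda>\<omega>. (f \<omega> - h \<omega>) * (f \<omega> - h \<omega>)) \<in> borel_measurable Q" if "f \<in> B" for f
    using int[OF bdd_meas_mult[OF bdd_meas_diff[OF Bm[OF that] h] bdd_meas_diff[OF Bm[OF that] h]]] by simp
  have "(\<lambda>i. D (u (r i))) \<longlonglongrightarrow> D g"
    unfolding D_def
  proof (rule integral_dominated_convergence[where w = "\<lambda>_. (K + H) * (K + H)"])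
    show "AE \<omega> in Q. (\<lambda>i. (u (r i) \<omega> - h \<omega>) * (u (r i) \<omega> - h \<omega>)) \<longlonglongrightarrow> (g \<omega> - h \<omega>) * (g \<omega> - h \<omega>)"
      using g(2) by eventually_elim (intro tendsto_intros)
    show "AE \<omega> in Q. norm ((u (r i) \<omega> - h \<omega>) * (u (r i) \<omega> - h \<omega>)) \<le> (K + H) * (K + H)" for i
    proof (rule AE_I2)
      fix \<omega> assume "\<omega> \<in> space Q"
      then have "\<bar>u (r i) \<omega> - h \<omega>\<bar> \<le> K + H"
        using bound[OF u(1), of \<omega> "r i"] H(2)[of \<omega>] space by auto
      then show "norm ((u (r i) \<omega> - h \<omega>) * (u (r i) \<omega> - h \<omega>)) \<le> (K + H) * (K + H)"
        unfolding real_norm_def abs_mult by (intro mult_mono) auto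
    qed
  qed (use meas[OF g(1)] meas[OF u(1)] in auto)
  moreover have "(\<lambda>i. s + 1 / real (Suc i)) \<longlonglongrightarrow> s + 0"
    by (intro tendsto_intros LIMSEQ_Suc lim_1_over_n)
  moreover have "D (u (r i)) \<le> s + 1 / real (Suc i)" for i
  proof -
    have "1 / real (Suc (r i)) \<le> 1 / real (Suc i)"
      using strict_mono_imp_increasing[OF r(1), of i] by (auto intro!: divide_left_mono)
    then show ?thesis using u(2)[of "r i"] by linarith
  qed
  ultimately have "D g \<le> s" using LIMSEQ_le by fastforce
  define Z where "Z = (\<lambda>\<omega>. g \<omega> - h \<omega>)"
  have Z: "Z \<in> bdd_meas M" unfolding Z_def using Bm[OF g(1)] h by auto
  have ZZ: "D g = (\<integral>\<omega>. Z \<omega> * Z \<omega> \<partial>Q)" by (simp add: D_def Z_def)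
  have "0 < D g"
  proof (rule ccontr)
    assume "\<not> 0 < D g"
    then have "(\<integral>\<omega>. Z \<omega> * Z \<omega> \<partial>Q) = 0" using D_nonneg[of g] ZZ by linarith
    then have "AE \<omega> in Q. Z \<omega> * Z \<omega> = 0"
      using integral_nonneg_eq_0_iff_AE[OF int[OF bdd_meas_mult[OF Z Z]]] by simp
    then have "AE \<omega> in Q. h \<omega> = g \<omega>" by (auto simp: Z_def)
    then show False using notin[OF g(1)] by blast
  qed
  have "(\<integral>\<omega>. Z \<omega> * h \<omega> \<partial>Q) + D g \<le> (\<integral>\<omega>. Z \<omega> * f \<omega> \<partial>Q)" if f: "f \<in> B" for f
  proof -
    define w where "w = (\<lambda>\<omega>. f \<omega> - g \<omega>)"
    have w: "w \<in> bdd_meas M" unfolding w_def using Bm[OF f] Bm[OF g(1)] by auto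
    define a where "a = (\<integral>\<omega>. Z \<omega> * w \<omega> \<partial>Q)"
    define b where "b = (\<integral>\<omega>. w \<omega> * w \<omega> \<partial>Q)"
    have "0 \<le> b" by (simp add: b_def)
    \<comment> \<open>Points on the segment from \<open>g\<close> to \<open>f\<close> are no closer
      to \<open>h\<close> than \<open>g\<close>; the resulting quadratic in \<open>t\<close> is
      divided by \<open>t\<close>.\<close>
    have expand: "0 \<le> 2 * a + t * b" if "0 < t" "t \<le> 1" for t
    proof -
      have "s \<le> D (\<lambda>\<omega>. t * f \<omega> + (1 - t) * g \<omega>)" using that by (intro s_le convex f g) auto
      also have "\<dots> = (\<integral>\<omega>. Z \<omega> * Z \<omega> + 2 * t * (Z \<omega> * w \<omega>) + t * t * (w \<omega> * w \<omega>) \<partial>Q)"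
        unfolding D_def by (intro Bochner_Integration.integral_cong) (auto simp: Z_def w_def algebra_simps)
      also have "\<dots> = D g + 2 * t * a + t * t * b"
        using int[OF bdd_meas_mult[OF Z Z]] int[OF bdd_meas_mult[OF Z w]] int[OF bdd_meas_mult[OF w w]]
        by (simp add: ZZ a_def b_def)
      finally have "0 \<le> t * (2 * a + t * b)" using \<open>D g \<le> s\<close> by (simp add: algebra_simps)
      then show ?thesis using \<open>0 < t\<close> by (simp add: zero_le_mult_iff)
    qed
    have "0 \<le> a"
    proof (rule ccontr)
      assume "\<not> 0 \<le> a"
      \<comment> \<open>For this \<open>t\<close> one has \<open>t * b \<le> - a\<close>, hence
        \<open>2 * a + t * b \<le> a < 0\<close>. The denominator \<open>b + 1\<close> is positive
        even for \<open>b = 0\<close>.\<close>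
      define t where "t = min 1 (- a / (b + 1))"
      have "0 < - a / (b + 1)" using \<open>\<not> 0 \<le> a\<close> \<open>0 \<le> b\<close> by (intro divide_pos_pos) auto
      then have "0 < t" "t \<le> 1" by (auto simp: t_def)
      have "t * b \<le> - a / (b + 1) * b" using \<open>0 \<le> b\<close> by (intro mult_right_mono) (auto simp: t_def)
      also have "\<dots> \<le> - a" using \<open>\<not> 0 \<le> a\<close> \<open>0 \<le> b\<close> by (simp add: field_simps)
      finally show False using expand[OF \<open>0 < t\<close> \<open>t \<le> 1\<close>] \<open>\<not> 0 \<le> a\<close> by linarith
    qed
    have "(\<integral>\<omega>. Z \<omega> * f \<omega> \<partial>Q) = (\<integral>\<omega>. Z \<omega> * w \<omega> + Z \<omega> * Z \<omega> + Z \<omega> * h \<omega> \<partial>Q)"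
      by (intro Bochner_Integration.integral_cong) (auto simp: Z_def w_def algebra_simps)
    also have "\<dots> = a + D g + (\<integral>\<omega>. Z \<omega> * h \<omega> \<partial>Q)"
      using int[OF bdd_meas_mult[OF Z Z]] int[OF bdd_meas_mult[OF Z w]] int[OF bdd_meas_mult[OF Z h]]
      by (simp add: ZZ a_def)
    finally show ?thesis using \<open>0 \<le> a\<close> by simp
  qed
  then show ?thesis using Z \<open>0 < D g\<close> by blast
qed

subsection \<open>The space of bounded functions modulo quasi-sure equality\<close>

lemma rep_in_Linf:
  assumes "X \<in> Linf M PP"
  shows rep_bdd_meas: "rep X \<in> bdd_meas M" and qs_class_rep: "qs_class M PP (rep X) = X"
proof -
  have equiv: "equiv (bdd_meas M) (qs_rel M PP)"
  proof (rule equivI)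
    show "qs_rel M PP \<subseteq> bdd_meas M \<times> bdd_meas M" by (auto simp: qs_rel_def)
    show "refl_on (bdd_meas M) (qs_rel M PP)" by (auto simp: refl_on_def qs_rel_def qs_def)
    show "sym (qs_rel M PP)"
      by (auto simp: sym_def qs_rel_def qs_def elim!: ballE eventually_mono)
    show "trans (qs_rel M PP)"
    proof (rule transI)
      fix f g h assume "(f, g) \<in> qs_rel M PP" "(g, h) \<in> qs_rel M PP"
      then have fh: "f \<in> bdd_meas M" "h \<in> bdd_meas M"
        and fg: "\<And>P. P \<in> PP \<Longrightarrow> AE \<omega> in P. f \<omega> = g \<omega>" and gh: "\<And>P. P \<in> PP \<Longrightarrow> AE \<omega> in P. g \<omega> = h \<omega>"
        by (auto simp: qs_rel_def qs_def)
      have "AE \<omega> in P. f \<omega> = h \<omega>" if "P \<in> PP" for P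
        using fg[OF that] gh[OF that] by eventually_elim simp
      then show "(f, h) \<in> qs_rel M PP" using fh by (simp add: qs_rel_def qs_def)
    qed
  qed
  obtain f where f: "f \<in> bdd_meas M" "X = qs_rel M PP `` {f}"
    using assms by (auto simp: Linf_def quotient_def)
  then have "f \<in> X" by (auto simp: qs_rel_def qs_def)
  then have "rep X \<in> X" unfolding rep_def by (rule someI[of "\<lambda>f. f \<in> X"])
  then have rel: "(f, rep X) \<in> qs_rel M PP" using f by simp
  then show "rep X \<in> bdd_meas M" by (simp add: qs_rel_def)
  show "qs_class M PP (rep X) = X"
    unfolding qs_class_def using equiv_class_eq[OF equiv rel] f(2) by simp
qed

lemma qs_conj_imp:
  assumes "qs PP S" "qs PP T" "\<And>\<omega>. S \<omega> \<Longrightarrow> T \<omega> \<Longrightarrow> U \<omega>"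
  shows "qs PP U"
  unfolding qs_def
proof
  fix P assume "P \<in> PP"
  then have "AE \<omega> in P. S \<omega>" "AE \<omega> in P. T \<omega>" using assms by (auto simp: qs_def)
  then show "AE \<omega> in P. U \<omega>" by eventually_elim (rule assms(3))
qed

lemma qs_mono: "qs PP S \<Longrightarrow> (\<And>\<omega>. S \<omega> \<Longrightarrow> U \<omega>) \<Longrightarrow> qs PP U"
  using qs_conj_imp[of PP S S U] by blast

lemma qs_class_in_Linf: "f \<in> bdd_meas M \<Longrightarrow> qs_class M PP f \<in> Linf M PP"
  by (auto simp: Linf_def qs_class_def intro: quotientI)

lemma qs_class_eq_iff:
  assumes "f \<in> bdd_meas M" "g \<in> bdd_meas M"
  shows "qs_class M PP f = qs_class M PP g \<longleftrightarrow> qs PP (\<lambda>\<omega>. f \<omega> = g \<omega>)"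
proof
  assume "qs_class M PP f = qs_class M PP g"
  moreover have "g \<in> qs_class M PP g" using assms by (auto simp: qs_class_def qs_rel_def qs_def)
  ultimately have "g \<in> qs_class M PP f" by simp
  then show "qs PP (\<lambda>\<omega>. f \<omega> = g \<omega>)" by (simp add: qs_class_def qs_rel_def)
next
  assume fg: "qs PP (\<lambda>\<omega>. f \<omega> = g \<omega>)"
  have "qs PP (\<lambda>\<omega>. f \<omega> = h \<omega>) \<longleftrightarrow> qs PP (\<lambda>\<omega>. g \<omega> = h \<omega>)" for h
    using qs_conj_imp[OF fg, of "\<lambda>\<omega>. f \<omega> = h \<omega>" "\<lambda>\<omega>. g \<omega> = h \<omega>"]
      qs_conj_imp[OF fg, of "\<lambda>\<omega>. g \<omega> = h \<omega>" "\<lambda>\<omega>. f \<omega> = h \<omega>"] by auto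
  then show "qs_class M PP f = qs_class M PP g" using assms by (auto simp: qs_class_def qs_rel_def)
qed

lemma rep_qs_class:
  assumes "f \<in> bdd_meas M"
  shows "qs PP (\<lambda>\<omega>. rep (qs_class M PP f) \<omega> = f \<omega>)"
  using qs_class_eq_iff[of "rep (qs_class M PP f)" M f PP] rep_bdd_meas qs_class_rep
    qs_class_in_Linf[OF assms] assms by blast

lemma AE_jordan:
  assumes \<mu>: "\<mu> \<in> ca M" and A: "{\<omega>\<in>space M. \<not> S \<omega>} \<in> sets M"
    and null: "\<And>C. C \<in> sets M \<Longrightarrow> C \<subseteq> {\<omega>\<in>space M. \<not> S \<omega>} \<Longrightarrow> \<mu> C = 0"
  shows "AE \<omega> in jordan_pos M \<mu>. S \<omega>" "AE \<omega> in jordan_neg M \<mu>. S \<omega>"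
proof -
  have AE: "AE \<omega> in m. S \<omega>"
    if "finite_measure m" "sets m = sets M" "measure m {\<omega>\<in>space M. \<not> S \<omega>} = 0" for m
  proof -
    interpret finite_measure m by fact
    have "space m = space M" using that(2) by (rule sets_eq_imp_space_eq)
    then show ?thesis
      using that A by (intro AE_I[of _ _ "{\<omega>\<in>space M. \<not> S \<omega>}"]) (auto simp: emeasure_eq_measure)
  qed
  show "AE \<omega> in jordan_pos M \<mu>. S \<omega>" "AE \<omega> in jordan_neg M \<mu>. S \<omega>"
    using jordan_null[OF \<mu> A null] jordan(1-4)[OF \<mu>] by (auto intro!: AE)
qed

lemma signed_integral_cong_AE:
  assumes "f \<in> bdd_meas M" "g \<in> bdd_meas M" "\<mu> \<in> ca M"
    and "AE \<omega> in jordan_pos M \<mu>. f \<omega> = g \<omega>" "AE \<omega> in jordan_neg M \<mu>. f \<omega> = g \<omega>"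
  shows "signed_integral M \<mu> f = signed_integral M \<mu> g"
proof -
  have "(\<integral>\<omega>. f \<omega> \<partial>m) = (\<integral>\<omega>. g \<omega> \<partial>m)" if "sets m = sets M" "AE \<omega> in m. f \<omega> = g \<omega>" for m
    using assms(1,2) that measurable_cong_sets[OF that(1) refl, of "borel :: real measure"]
    by (intro integral_cong_AE) (auto simp: bdd_meas_def)
  then show ?thesis unfolding signed_integral_def using jordan(1,2)[OF assms(3)] assms(4,5) by metis
qed

section \<open>Quasi-sure statements and the measures in \<open>ca_c\<close>\<close>

locale uncertainty =
  fixes M :: "'a measure" and PP :: "'a measure set"
  assumes PP: "PP \<subseteq> prob_measures M" and PP_nonempty: "PP \<noteq> {}"
begin

abbreviation "E \<equiv> ca_c M PP"
abbreviation "L \<equiv> Linf M PP"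
abbreviation "cls \<equiv> qs_class M PP"

lemma prob_PP: "P \<in> PP \<Longrightarrow> prob_space P" and sets_PP: "P \<in> PP \<Longrightarrow> sets P = sets M"
  using PP by (auto simp: prob_measures_def)

lemma space_PP: "P \<in> PP \<Longrightarrow> space P = space M"
  using sets_eq_imp_space_eq[OF sets_PP] .

lemma capacity_zero_iff: "capacity PP A = 0 \<longleftrightarrow> (\<forall>P\<in>PP. measure P A = 0)"
proof
  assume zero: "capacity PP A = 0"
  have "bdd_above ((\<lambda>P. measure P A) ` PP)"
    using prob_space.prob_le_1[OF prob_PP] by (auto intro!: bdd_aboveI[of _ 1])
  then have "measure P A \<le> 0" if "P \<in> PP" for P
    using cSUP_upper[OF that, of "\<lambda>P. measure P A"] zero by (simp add: capacity_def)
  then show "\<forall>P\<in>PP. measure P A = 0" by (simp add: order_antisym)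
next
  assume "\<forall>P\<in>PP. measure P A = 0"
  then show "capacity PP A = 0" unfolding capacity_def using PP_nonempty by simp
qed

lemma qs_null:
  assumes "qs PP S" "C \<in> sets M" "C \<subseteq> {\<omega>\<in>space M. \<not> S \<omega>}"
  shows "capacity PP C = 0"
  unfolding capacity_zero_iff
proof
  fix P assume P: "P \<in> PP"
  interpret prob_space P by (rule prob_PP[OF P])
  have "AE \<omega> in P. S \<omega>" using assms(1) P by (simp add: qs_def)
  then have "AE \<omega> in P. \<omega> \<notin> C" by eventually_elim (use assms(3) in auto)
  then have "emeasure P C = 0"
    using AE_iff_measurable[of C P "\<lambda>\<omega>. \<omega> \<notin> C"] assms(2) P sets_PP[OF P] sets.sets_into_space[OF assms(2)]
    by (auto simp: space_PP[OF P])
  then show "measure P C = 0" by (simp add: measure_def)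
qed

lemma E_ca: "\<mu> \<in> E \<Longrightarrow> \<mu> \<in> ca M" by (simp add: ca_c_def)

lemma E_null: "\<mu> \<in> E \<Longrightarrow> A \<in> sets M \<Longrightarrow> capacity PP A = 0 \<Longrightarrow> \<mu> A = 0" by (simp add: ca_c_def)

lemma E_lincomb: "\<mu> \<in> E \<Longrightarrow> \<nu> \<in> E \<Longrightarrow> (\<lambda>A. a * \<mu> A + b * \<nu> A) \<in> E"
  by (auto simp: ca_c_def ca_lincomb)

lemma AE_jordan_qs:
  assumes \<mu>: "\<mu> \<in> E" and S: "qs PP S" "{\<omega>\<in>space M. \<not> S \<omega>} \<in> sets M"
  shows "AE \<omega> in jordan_pos M \<mu>. S \<omega>" "AE \<omega> in jordan_neg M \<mu>. S \<omega>"
  using AE_jordan[OF E_ca[OF \<mu>] S(2)] E_null[OF \<mu> _ qs_null[OF S(1)]] by auto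

lemma signed_integral_cong_qs:
  assumes \<mu>: "\<mu> \<in> E" and fg: "f \<in> bdd_meas M" "g \<in> bdd_meas M" and qs: "qs PP (\<lambda>\<omega>. f \<omega> = g \<omega>)"
  shows "signed_integral M \<mu> f = signed_integral M \<mu> g"
proof -
  have [measurable]: "f \<in> borel_measurable M" "g \<in> borel_measurable M"
    using fg by (auto simp: bdd_meas_def)
  have "{\<omega>\<in>space M. \<not> f \<omega> = g \<omega>} \<in> sets M" by measurable
  then show ?thesis by (intro signed_integral_cong_AE fg E_ca[OF \<mu>] AE_jordan_qs[OF \<mu> qs])
qed

lemma abs_signed_integral_le:
  assumes \<mu>: "\<mu> \<in> E" and f: "f \<in> bdd_meas M" and qs: "qs PP (\<lambda>\<omega>. \<bar>f \<omega>\<bar> \<le> K)"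
  shows "\<bar>signed_integral M \<mu> f\<bar> \<le> K * tv_norm M \<mu>"
proof -
  have [measurable]: "f \<in> borel_measurable M" using f by (auto simp: bdd_meas_def)
  have A: "{\<omega>\<in>space M. \<not> \<bar>f \<omega>\<bar> \<le> K} \<in> sets M" by measurable
  have le: "\<bar>\<integral>\<omega>. f \<omega> \<partial>m\<bar> \<le> K * measure m (space M)"
    if "finite_measure m" "sets m = sets M" "AE \<omega> in m. \<bar>f \<omega>\<bar> \<le> K" for m
  proof -
    interpret finite_measure m by fact
    have "\<bar>\<integral>\<omega>. f \<omega> \<partial>m\<bar> \<le> (\<integral>\<omega>. \<bar>f \<omega>\<bar> \<partial>m)" by (rule integral_abs_bound)
    also have "\<dots> \<le> (\<integral>\<omega>. K \<partial>m)"
      using that integrable_bdd_meas[OF that(1,2) f] by (intro integral_mono_AE) auto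
    finally show ?thesis using sets_eq_imp_space_eq[OF that(2)] by (simp add: mult.commute)
  qed
  note le[OF finite_jordan_pos[OF E_ca[OF \<mu>]] sets_jordan_pos[OF E_ca[OF \<mu>]] AE_jordan_qs(1)[OF \<mu> qs A]]
    le[OF finite_jordan_neg[OF E_ca[OF \<mu>]] sets_jordan_neg[OF E_ca[OF \<mu>]] AE_jordan_qs(2)[OF \<mu> qs A]]
  moreover have "K * tv_norm M \<mu> =
      K * measure (jordan_pos M \<mu>) (space M) + K * measure (jordan_neg M \<mu>) (space M)"
    unfolding tv_norm_def by (simp add: variation_jordan[OF E_ca[OF \<mu>]] distrib_left)
  ultimately show ?thesis unfolding signed_integral_def by linarith
qed

lemma density_in_E:
  assumes Q: "Q \<in> prob_measures M" "dominated M {Q} PP" and f: "f \<in> bdd_meas M"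
  shows "density_ca M Q f \<in> E"
proof -
  have Q': "prob_space Q" "sets Q = sets M" using Q by (auto simp: prob_measures_def)
  interpret prob_space Q by fact
  have "density_ca M Q f A = 0" if "A \<in> sets M" "capacity PP A = 0" for A
  proof -
    have "emeasure Q A = 0" using Q(2) that by (simp add: dominated_def emeasure_eq_measure)
    then have "AE \<omega> in Q. \<omega> \<notin> A" using that Q'(2) by (intro AE_not_in) auto
    then have "AE \<omega> in Q. f \<omega> * indicator A \<omega> = 0" by eventually_elim simp
    then have "(\<integral>\<omega>. f \<omega> * indicator A \<omega> \<partial>Q) = 0" by (rule integral_eq_zero_AE)
    then show ?thesis by (simp add: density_ca_def)
  qed
  then show ?thesis
    using density_ca_in_ca[OF finite_measure_axioms Q'(2) f] by (simp add: ca_c_def)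
qed

lemma dominated_PP: "P \<in> PP \<Longrightarrow> dominated M {P} PP"
  by (simp add: dominated_def capacity_zero_iff)

text \<open>Tested against the measure that has, under \<open>P\<close>, the indicator of the set
  where \<open>f\<close> exceeds \<open>K\<close> as density: the integral of \<open>f - K\<close>
  over that set is then at most 0, so the set is null. With \<open>abs_signed_integral_le\<close>
  this identifies the dual norm with the quasi-sure supremum norm.\<close>

lemma qs_le_of_signed_integral_le:
  assumes f: "f \<in> bdd_meas M"
    and le: "\<And>\<mu>. \<mu> \<in> E \<Longrightarrow> signed_integral M \<mu> f \<le> K * tv_norm M \<mu>"
  shows "qs PP (\<lambda>\<omega>. f \<omega> \<le> K)"
  unfolding qs_def
proof
  fix P assume P: "P \<in> PP"
  interpret prob_space P by (rule prob_PP[OF P])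
  have [measurable]: "f \<in> borel_measurable M" using f by (auto simp: bdd_meas_def)
  have sets: "sets P = sets M" by (rule sets_PP[OF P])
  define A where "A = {\<omega>\<in>space M. K < f \<omega>}"
  have A: "A \<in> sets M" unfolding A_def by measurable
  define \<mu> where "\<mu> = density_ca M P (indicator A)"
  note ind = bdd_meas_indicator[OF A]
  have \<mu>: "\<mu> \<in> E" unfolding \<mu>_def using P PP by (intro density_in_E dominated_PP ind) auto
  have "signed_integral M \<mu> f = (\<integral>\<omega>. indicator A \<omega> * f \<omega> \<partial>P)"
    unfolding \<mu>_def by (rule signed_integral_density_ca[OF finite_measure_axioms sets ind f])
  moreover have "tv_norm M \<mu> = \<mu> (space M)"
    by (rule tv_norm_of_nonneg[OF E_ca[OF \<mu>]]) (simp add: \<mu>_def density_ca_def)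
  moreover have "(\<integral>\<omega>. indicator A \<omega> * indicator (space M) \<omega> \<partial>P) = (\<integral>\<omega>. indicator A \<omega> \<partial>P :: real)"
    by (intro Bochner_Integration.integral_cong) (auto simp: space_PP[OF P] indicator_def)
  then have "\<mu> (space M) = (\<integral>\<omega>. indicator A \<omega> \<partial>P)"
    by (simp only: \<mu>_def density_ca_def sets.top if_True)
  ultimately have "(\<integral>\<omega>. indicator A \<omega> * f \<omega> \<partial>P) \<le> K * (\<integral>\<omega>. indicator A \<omega> \<partial>P)"
    using le[OF \<mu>] by simp
  moreover have int: "integrable P (\<lambda>\<omega>. indicator A \<omega> * f \<omega>)" "integrable P (indicator A :: 'a \<Rightarrow> real)"
    by (auto intro!: integrable_bdd_meas[OF finite_measure_axioms sets] bdd_meas_mult ind f)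
  ultimately have le0: "(\<integral>\<omega>. indicator A \<omega> * f \<omega> - K * indicator A \<omega> \<partial>P) \<le> 0"
    by simp
  have nonneg: "AE \<omega> in P. 0 \<le> indicator A \<omega> * f \<omega> - K * indicator A \<omega>"
    by (auto simp: A_def indicator_def)
  have "(\<integral>\<omega>. indicator A \<omega> * f \<omega> - K * indicator A \<omega> \<partial>P) = 0"
    using le0 integral_nonneg_AE[OF nonneg] by simp
  then have "AE \<omega> in P. indicator A \<omega> * f \<omega> - K * indicator A \<omega> = 0"
    using integral_nonneg_eq_0_iff_AE[OF _ nonneg] int by simp
  then show "AE \<omega> in P. f \<omega> \<le> K"
    using AE_space by eventually_elim (auto simp: A_def indicator_def space_PP[OF P] split: if_splits)
qed

lemma qs_abs_le_of_signed_integral_le: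
  assumes f: "f \<in> bdd_meas M"
    and le: "\<And>\<mu>. \<mu> \<in> E \<Longrightarrow> \<bar>signed_integral M \<mu> f\<bar> \<le> K * tv_norm M \<mu>"
  shows "qs PP (\<lambda>\<omega>. \<bar>f \<omega>\<bar> \<le> K)"
proof (rule qs_conj_imp)
  show "qs PP (\<lambda>\<omega>. f \<omega> \<le> K)"
    using le by (intro qs_le_of_signed_integral_le[OF f]) fastforce
  show "qs PP (\<lambda>\<omega>. - f \<omega> \<le> K)"
  proof (intro qs_le_of_signed_integral_le bdd_meas_uminus f)
    fix \<mu> assume "\<mu> \<in> E"
    then show "signed_integral M \<mu> (\<lambda>\<omega>. - f \<omega>) \<le> K * tv_norm M \<mu>"
      using le[of \<mu>] by (simp add: signed_integral_def)
  qed
qed auto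

lemma Linf_norm_le:
  assumes X: "X \<in> L" and K: "qs PP (\<lambda>\<omega>. \<bar>rep X \<omega>\<bar> \<le> K)"
  shows "Linf_norm PP X \<le> K"
  unfolding Linf_norm_def
proof (rule cInf_lower)
  have [measurable]: "rep X \<in> borel_measurable M" using rep_bdd_meas[OF X] by (simp add: bdd_meas_def)
  have meas: "{\<omega>\<in>space P. \<bar>rep X \<omega>\<bar> \<le> m} \<in> sets P" if "P \<in> PP" for P m
    unfolding space_PP[OF that] sets_PP[OF that] by measurable
  show "K \<in> {m. \<forall>P\<in>PP. measure P {\<omega>\<in>space P. \<bar>rep X \<omega>\<bar> \<le> m} = 1}"
    using K prob_space.prob_Collect_eq_1[OF prob_PP meas] by (simp add: qs_def)
  \<comment> \<open>For negative \<open>m\<close> the event is empty, which contradicts probability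
    1 under \<open>P\<close>; this bounds the set of admissible \<open>m\<close> from below.\<close>
  obtain P where P: "P \<in> PP" using PP_nonempty by blast
  show "bdd_below {m. \<forall>P\<in>PP. measure P {\<omega>\<in>space P. \<bar>rep X \<omega>\<bar> \<le> m} = 1}"
  proof (rule bdd_belowI[of _ 0], rule ccontr)
    fix m assume m: "m \<in> {m. \<forall>P\<in>PP. measure P {\<omega>\<in>space P. \<bar>rep X \<omega>\<bar> \<le> m} = 1}" "\<not> 0 \<le> m"
    then have "{\<omega>\<in>space P. \<bar>rep X \<omega>\<bar> \<le> m} = {}" by auto
    moreover have "measure P {\<omega>\<in>space P. \<bar>rep X \<omega>\<bar> \<le> m} = 1" using m P by blast
    ultimately have "measure P {} = 1" by (simp only:)
    then show False by simp
  qed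
qed

text \<open>Some admissible bound lies strictly below \<open>K\<close>, whether or not the infimum
  is attained.\<close>

lemma qs_abs_le_Linf_norm:
  assumes X: "X \<in> L" and K: "Linf_norm PP X < K"
  shows "qs PP (\<lambda>\<omega>. \<bar>rep X \<omega>\<bar> \<le> K)"
proof -
  define T where "T = {m. \<forall>P\<in>PP. measure P {\<omega>\<in>space P. \<bar>rep X \<omega>\<bar> \<le> m} = 1}"
  have [measurable]: "rep X \<in> borel_measurable M" using rep_bdd_meas[OF X] by (simp add: bdd_meas_def)
  have meas: "{\<omega>\<in>space P. \<bar>rep X \<omega>\<bar> \<le> m} \<in> sets P" if "P \<in> PP" for P m
    unfolding space_PP[OF that] sets_PP[OF that] by measurable
  have T: "m \<in> T \<longleftrightarrow> qs PP (\<lambda>\<omega>. \<bar>rep X \<omega>\<bar> \<le> m)" for m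
    using prob_space.prob_Collect_eq_1[OF prob_PP meas] by (simp add: qs_def T_def)
  obtain H where "\<forall>\<omega>\<in>space M. \<bar>rep X \<omega>\<bar> \<le> H" using rep_bdd_meas[OF X] by (auto simp: bdd_meas_def)
  then have "H \<in> T" unfolding T qs_def using space_PP by (auto intro!: AE_I2)
  then obtain m where "m \<in> T" "m < K" using cInf_lessD[of T K] K by (auto simp: Linf_norm_def T_def)
  then show ?thesis using T by (auto elim!: qs_mono)
qed

section \<open>Weak neighbourhoods\<close>

lemma topspace_weak_topology: "topspace (weak_topology M PP) = L"
proof -
  have "(\<lambda>A. 0) \<in> E" by (simp add: ca_c_def ca_def)
  then show ?thesis unfolding weak_topology_def topology_generated_by_topspace by blast
qed

lemma openin_halfspace:
  assumes "\<mu> \<in> E"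
  shows "openin (weak_topology M PP) {X \<in> L. pairing M \<mu> X < c}"
proof -
  have "{X \<in> L. pairing M \<mu> X \<in> {..<c}} \<in> {{X \<in> L. pairing M \<mu> X \<in> U} | \<mu> U. \<mu> \<in> E \<and> open U}"
    unfolding mem_Collect_eq using assms by (intro exI[of _ \<mu>] exI[of _ "{..<c}"]) simp
  from topology_generated_by_Basis[OF this] show ?thesis
    unfolding weak_topology_def by simp
qed

text \<open>Finiteness of \<open>F\<close> is what later allows a single probability to dominate all
  the measures involved.\<close>

lemma openin_weak_topologyD:
  assumes "openin (weak_topology M PP) U" and "X \<in> U"
  shows "\<exists>F e. finite F \<and> F \<subseteq> E \<and> 0 < e \<and>
    (\<forall>Y\<in>L. (\<forall>\<mu>\<in>F. \<bar>pairing M \<mu> Y - pairing M \<mu> X\<bar> < e) \<longrightarrow> Y \<in> U)"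
proof -
  have "generate_topology_on {{X \<in> L. pairing M \<mu> X \<in> U} | \<mu> U. \<mu> \<in> E \<and> open U} U"
    using assms(1) unfolding weak_topology_def openin_topology_generated_by_iff .
  then show ?thesis using assms(2)
  proof induction
    case Empty
    then show ?case by simp
  next
    case (Int a b)
    have "X \<in> a" "X \<in> b" using Int.prems by auto
    from Int.IH(1)[OF this(1)] Int.IH(2)[OF this(2)] obtain F e G d where
        "finite F" "F \<subseteq> E" "0 < e"
        "\<forall>Y\<in>L. (\<forall>\<mu>\<in>F. \<bar>pairing M \<mu> Y - pairing M \<mu> X\<bar> < e) \<longrightarrow> Y \<in> a"
        "finite G" "G \<subseteq> E" "0 < d"
        "\<forall>Y\<in>L. (\<forall>\<mu>\<in>G. \<bar>pairing M \<mu> Y - pairing M \<mu> X\<bar> < d) \<longrightarrow> Y \<in> b"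
      by (elim exE conjE) rule
    then show ?case by (intro exI[of _ "F \<union> G"] exI[of _ "min e d"]) auto
  next
    case (UN K)
    then show ?case by (meson UnionE UnionI)
  next
    case (Basis s)
    then obtain \<mu> V where s: "s = {X \<in> L. pairing M \<mu> X \<in> V}" "\<mu> \<in> E" "open V" by blast
    then obtain e where "0 < e" "\<forall>y. dist y (pairing M \<mu> X) < e \<longrightarrow> y \<in> V"
      using Basis.prems unfolding open_dist by auto
    then show ?case using s by (intro exI[of _ "{\<mu>}"] exI[of _ e]) (auto simp: dist_real_def)
  qed
qed

end

subsection \<open>Sensitive and Fatou closed sets\<close>

lemma closed_Collect_ball:
  "(\<And>i. i \<in> I \<Longrightarrow> closed {x. P i x}) \<Longrightarrow> closed {x. \<forall>i\<in>I. P i x}"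
proof -
  assume "\<And>i. i \<in> I \<Longrightarrow> closed {x. P i x}"
  then have "closed (\<Inter>i\<in>I. {x. P i x})" by blast
  moreover have "(\<Inter>i\<in>I. {x. P i x}) = {x. \<forall>i\<in>I. P i x}" by blast
  ultimately show ?thesis by simp
qed

lemma signed_integral_lincomb_right:
  assumes \<mu>: "\<mu> \<in> ca M" and fg: "f \<in> bdd_meas M" "g \<in> bdd_meas M"
  shows "signed_integral M \<mu> (\<lambda>\<omega>. a * f \<omega> + b * g \<omega>) = a * signed_integral M \<mu> f + b * signed_integral M \<mu> g"
proof -
  have "(\<integral>\<omega>. a * f \<omega> + b * g \<omega> \<partial>m) = a * (\<integral>\<omega>. f \<omega> \<partial>m) + b * (\<integral>\<omega>. g \<omega> \<partial>m)"
    if "finite_measure m" "sets m = sets M" for m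
    using integrable_bdd_meas[OF that fg(1)] integrable_bdd_meas[OF that fg(2)] by simp
  then show ?thesis using jordan(1-4)[OF \<mu>] by (simp add: signed_integral_def algebra_simps)
qed

section \<open>Functions as points of a compact dual ball\<close>

context uncertainty
begin

text \<open>The value 0 off \<open>E\<close> makes two functionals equal as soon as they agree on
  \<open>ca_c\<close>, so points of the product space carry no spurious information.\<close>

definition functional :: "('a \<Rightarrow> real) \<Rightarrow> ('a set \<Rightarrow> real) \<Rightarrow> real" where
  "functional f \<mu> = (if \<mu> \<in> E then signed_integral M \<mu> f else 0)"

definition dual_ball :: "real \<Rightarrow> (('a set \<Rightarrow> real) \<Rightarrow> real) set" where
  "dual_ball K = {\<phi>. (\<forall>\<mu>\<in>- E. \<phi> \<mu> = 0) \<and>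
     (\<forall>\<mu>\<in>E. \<forall>\<nu>\<in>E. \<forall>a b. \<phi> (\<lambda>A. a * \<mu> A + b * \<nu> A) = a * \<phi> \<mu> + b * \<phi> \<nu>) \<and>
     (\<forall>\<mu>\<in>E. \<bar>\<phi> \<mu>\<bar> \<le> K * tv_norm M \<mu>)}"

text \<open>Banach-Alaoglu: each defining condition involves finitely many coordinates and is closed
  in the product topology, and the norm bound places the ball inside a product of compact
  intervals.\<close>

lemma compact_dual_ball: "compact (dual_ball K)"
proof -
  define c where "c \<mu> = (if \<mu> \<in> E then K * tv_norm M \<mu> else 0)" for \<mu>
  have "compactin (product_topology (\<lambda>_. euclidean) UNIV) (PiE UNIV (\<lambda>\<mu>. {- c \<mu>..c \<mu>}))"
    unfolding compactin_PiE by simp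
  then have 1: "compact (PiE UNIV (\<lambda>\<mu>. {- c \<mu>..c \<mu>}))"
    by (simp add: euclidean_product_topology)
  have 2: "closed (dual_ball K)"
    unfolding dual_ball_def
    by (intro closed_Collect_conj closed_Collect_ball closed_Collect_all closed_Collect_eq
        closed_Collect_le continuous_intros continuous_on_product_coordinates)
  have "dual_ball K \<subseteq> PiE UNIV (\<lambda>\<mu>. {- c \<mu>..c \<mu>})"
    by (auto simp: dual_ball_def c_def abs_le_iff minus_le_iff)
  then have "PiE UNIV (\<lambda>\<mu>. {- c \<mu>..c \<mu>}) \<inter> dual_ball K = dual_ball K" by blast
  then show ?thesis using compact_Int_closed[OF 1 2] by simp
qed

lemma functional_lincomb:
  assumes "f \<in> bdd_meas M" "\<mu> \<in> E" "\<nu> \<in> E"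
  shows "functional f (\<lambda>A. a * \<mu> A + b * \<nu> A) = a * functional f \<mu> + b * functional f \<nu>"
  using assms E_lincomb signed_integral_lincomb[OF E_ca E_ca] by (simp add: functional_def)

lemma functional_lincomb_right:
  assumes "f \<in> bdd_meas M" "g \<in> bdd_meas M"
  shows "functional (\<lambda>\<omega>. a * f \<omega> + b * g \<omega>) \<mu> = a * functional f \<mu> + b * functional g \<mu>"
  using assms signed_integral_lincomb_right[OF E_ca] by (simp add: functional_def)

lemma functional_diff:
  assumes "f \<in> bdd_meas M" "g \<in> bdd_meas M"
  shows "functional (\<lambda>\<omega>. f \<omega> - g \<omega>) \<mu> = functional f \<mu> - functional g \<mu>"
  using functional_lincomb_right[OF assms, of 1 "-1"] by simp

lemma functional_bound:
  assumes "f \<in> bdd_meas M"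
  shows "(\<forall>\<mu>\<in>E. \<bar>functional f \<mu>\<bar> \<le> K * tv_norm M \<mu>) \<longleftrightarrow> qs PP (\<lambda>\<omega>. \<bar>f \<omega>\<bar> \<le> K)"
  using abs_signed_integral_le[OF _ assms] qs_abs_le_of_signed_integral_le[OF assms]
  by (auto simp: functional_def)

lemma functional_in_dual_ball:
  assumes "f \<in> bdd_meas M"
  shows "functional f \<in> dual_ball K \<longleftrightarrow> qs PP (\<lambda>\<omega>. \<bar>f \<omega>\<bar> \<le> K)"
  using functional_bound[OF assms, of K] functional_lincomb[OF assms]
  by (auto simp: dual_ball_def functional_def)

lemma functional_cong:
  assumes "f \<in> bdd_meas M" "g \<in> bdd_meas M" "qs PP (\<lambda>\<omega>. f \<omega> = g \<omega>)"
  shows "functional f = functional g"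
  using signed_integral_cong_qs[OF _ assms] by (auto simp: functional_def)

text \<open>The duality hypothesis acts here: every point of the ball, and so every limit point of
  functionals inside it, comes from a function.\<close>

lemma dual_ball_functional:
  assumes dual: "dual_ca_c_eq_Linf M PP" and \<phi>: "\<phi> \<in> dual_ball K"
  shows "\<exists>f\<in>bdd_meas M. \<phi> = functional f"
proof -
  have "\<phi> \<in> ca_c_dual M PP" using \<phi> by (auto simp: ca_c_dual_def dual_ball_def)
  then obtain X where X: "X \<in> L" "\<And>\<mu>. \<mu> \<in> E \<Longrightarrow> \<phi> \<mu> = pairing M \<mu> X"
    using dual by (auto simp: dual_ca_c_eq_Linf_def)
  then have "\<phi> = functional (rep X)"
    using \<phi> by (auto simp: functional_def pairing_def dual_ball_def)
  then show ?thesis using rep_bdd_meas[OF X(1)] by blast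
qed

end

text \<open>\<open>F\<close> will be the set of all representatives of members of the given set, so
  that functions can be modified pointwise. The Fatou hypothesis is accordingly reduced to bounds
  and convergence everywhere on the space.\<close>

locale fatou_sensitive = uncertainty +
  fixes F :: "('a \<Rightarrow> real) set" and QQ :: "'a measure set"
  assumes dual: "dual_ca_c_eq_Linf M PP"
    and F_bdd: "F \<subseteq> bdd_meas M"
    and F_mono: "\<And>f g. f \<in> F \<Longrightarrow> g \<in> bdd_meas M \<Longrightarrow> qs PP (\<lambda>\<omega>. f \<omega> \<le> g \<omega>) \<Longrightarrow> g \<in> F"
    and F_convex: "\<And>f g t. f \<in> F \<Longrightarrow> g \<in> F \<Longrightarrow> 0 \<le> t \<Longrightarrow> t \<le> 1 \<Longrightarrow> (\<lambda>\<omega>. t * f \<omega> + (1 - t) * g \<omega>) \<in> F"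
    and F_fatou: "\<And>f g K. (\<And>n::nat. f n \<in> F) \<Longrightarrow> (\<And>n \<omega>. \<omega> \<in> space M \<Longrightarrow> \<bar>f n \<omega>\<bar> \<le> K) \<Longrightarrow>
      g \<in> bdd_meas M \<Longrightarrow> (\<And>\<omega>. \<omega> \<in> space M \<Longrightarrow> (\<lambda>n. f n \<omega>) \<longlonglongrightarrow> g \<omega>) \<Longrightarrow> g \<in> F"
    and QQ: "QQ \<subseteq> prob_measures M" "dominated M QQ PP"
    and sensitive: "\<And>f. f \<in> bdd_meas M \<Longrightarrow> (\<And>Q. Q \<in> QQ \<Longrightarrow> \<exists>g\<in>F. AE \<omega> in Q. f \<omega> = g \<omega>) \<Longrightarrow> f \<in> F"
begin

lemma F_cong: "f \<in> F \<Longrightarrow> g \<in> bdd_meas M \<Longrightarrow> qs PP (\<lambda>\<omega>. f \<omega> = g \<omega>) \<Longrightarrow> g \<in> F"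
  by (rule F_mono) (auto elim: qs_mono)

definition bounded_part :: "real \<Rightarrow> ('a \<Rightarrow> real) set" where
  "bounded_part K = {f\<in>F. \<forall>\<omega>\<in>space M. \<bar>f \<omega>\<bar> \<le> K}"

text \<open>Truncation alters \<open>f\<close> only on a quasi-surely null set: the quasi-sure bound
  becomes a pointwise one and the functional stays the same.\<close>

lemma clamp:
  assumes "0 \<le> K" "f \<in> F" "qs PP (\<lambda>\<omega>. \<bar>f \<omega>\<bar> \<le> K)"
  obtains g where "g \<in> bounded_part K" "functional g = functional f"
proof -
  define g where "g = (\<lambda>\<omega>. max (min (f \<omega>) K) (- K))"
  have f: "f \<in> bdd_meas M" using assms F_bdd by blast
  have g: "g \<in> bdd_meas M" unfolding g_def by (intro bdd_meas_max f)
  have qs: "qs PP (\<lambda>\<omega>. f \<omega> = g \<omega>)" using assms(3) by (rule qs_mono) (auto simp: g_def)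
  have "\<bar>g \<omega>\<bar> \<le> K" for \<omega> using \<open>0 \<le> K\<close> by (auto simp: g_def)
  then have "g \<in> bounded_part K" using F_cong[OF \<open>f \<in> F\<close> g qs] by (simp add: bounded_part_def)
  then show thesis using that functional_cong[OF f g qs] by simp
qed

text \<open>
  Lifting to \<open>F\<close> a sequence that converges only \<open>Q\<close>-a.s.: by monotonicity the terms may be raised
  to \<open>K\<close> off the set of convergence.
\<close>

lemma bounded_part_closed_AE:
  assumes Q: "prob_space Q" "sets Q = sets M" and f: "\<And>n. f n \<in> bounded_part K"
    and conv: "AE \<omega> in Q. convergent (\<lambda>n. f n \<omega>)"
  shows "\<exists>g\<in>bounded_part K. AE \<omega> in Q. (\<lambda>n. f n \<omega>) \<longlonglongrightarrow> g \<omega>"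
proof -
  have fF: "f n \<in> F" and bd: "\<omega> \<in> space M \<Longrightarrow> \<bar>f n \<omega>\<bar> \<le> K" for n \<omega> using f[of n] by (auto simp: bounded_part_def)
  have [measurable]: "f n \<in> borel_measurable M" for n
    using fF[of n] F_bdd by (auto simp: bdd_meas_def)
  define C where "C = {\<omega>\<in>space M. Cauchy (\<lambda>n. f n \<omega>)}"
  have C[measurable]: "C \<in> sets M" unfolding C_def by measurable
  define f' where "f' n \<omega> = (if \<omega> \<in> C then f n \<omega> else K)" for n \<omega>
  define g where "g \<omega> = (if \<omega> \<in> C then lim (\<lambda>n. f n \<omega>) else K)" for \<omega>
  have f'_meas[measurable]: "f' n \<in> borel_measurable M" for n unfolding f'_def by measurable
  have f'_bd: "\<bar>f' n \<omega>\<bar> \<le> K" if "\<omega> \<in> space M" for n \<omega>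
    using bd[OF that, of n] by (auto simp: f'_def)
  have f'_lim: "(\<lambda>n. f' n \<omega>) \<longlonglongrightarrow> g \<omega>" for \<omega>
    by (auto simp: f'_def g_def C_def Cauchy_convergent_iff convergent_LIMSEQ_iff)
  have g_bd: "\<bar>g \<omega>\<bar> \<le> K" if "\<omega> \<in> space M" for \<omega>
    using f'_bd[OF that] by (intro LIMSEQ_le_const2[OF tendsto_rabs[OF f'_lim]]) auto
  have "g \<in> borel_measurable M" using f'_lim by (intro borel_measurable_LIMSEQ_real[of _ f' g]) auto
  then have g: "g \<in> bdd_meas M" using g_bd by (rule bdd_measI)
  have "f' n \<in> F" for n
  proof (rule F_mono[OF fF[of n]])
    show "f' n \<in> bdd_meas M" using f'_meas f'_bd by (rule bdd_measI)
    show "qs PP (\<lambda>\<omega>. f n \<omega> \<le> f' n \<omega>)"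
      unfolding qs_def using bd[of _ n] space_PP by (fastforce intro: AE_I2 simp: f'_def abs_le_iff)
  qed
  then have "g \<in> F" using f'_bd g f'_lim by (rule F_fatou)
  moreover have "AE \<omega> in Q. (\<lambda>n. f n \<omega>) \<longlonglongrightarrow> g \<omega>"
    using conv AE_space
  proof eventually_elim
    fix \<omega> assume "convergent (\<lambda>n. f n \<omega>)" "\<omega> \<in> space Q"
    then have "\<omega> \<in> C" using sets_eq_imp_space_eq[OF Q(2)] by (simp add: C_def Cauchy_convergent_iff)
    then show "(\<lambda>n. f n \<omega>) \<longlonglongrightarrow> g \<omega>" using f'_lim[of \<omega>] by (simp add: f'_def)
  qed
  ultimately show ?thesis using g_bd by (auto simp: bounded_part_def)
qed

text \<open>The image is a compact dual ball cut by all closed half-spaces, collected in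
  \<open>H\<close>, that contain the functionals of \<open>bounded_part K\<close>. A function in the
  ball but outside \<open>F\<close> agrees under some \<open>Q \<in> QQ\<close> with no member of
  \<open>F\<close>, and separation in L2 yields a half-space that it violates.\<close>

lemma compact_functional_bounded:
  assumes "0 \<le> K"
  shows "compact (functional ` {f\<in>F. qs PP (\<lambda>\<omega>. \<bar>f \<omega>\<bar> \<le> K)})"
proof -
  define H where "H = {(\<mu>, c). \<mu> \<in> E \<and> (\<forall>f\<in>bounded_part K. c \<le> functional f \<mu>)}"
  have bounded_part: "f \<in> F" "f \<in> bdd_meas M" "qs PP (\<lambda>\<omega>. \<bar>f \<omega>\<bar> \<le> K)" if "f \<in> bounded_part K" for f
    using that F_bdd space_PP by (auto simp: bounded_part_def qs_def intro!: AE_I2)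
  have "functional ` {f\<in>F. qs PP (\<lambda>\<omega>. \<bar>f \<omega>\<bar> \<le> K)} =
      dual_ball K \<inter> {\<phi>. \<forall>x\<in>H. snd x \<le> \<phi> (fst x)}" (is "?S = ?T")
  proof (rule antisym; rule subsetI)
    fix \<phi> assume "\<phi> \<in> ?S"
    then obtain f where f: "f \<in> F" "qs PP (\<lambda>\<omega>. \<bar>f \<omega>\<bar> \<le> K)" "\<phi> = functional f" by auto
    obtain g where "g \<in> bounded_part K" "functional g = functional f" by (rule clamp[OF assms f(1,2)])
    moreover have "\<phi> \<in> dual_ball K" using f F_bdd functional_in_dual_ball by auto
    ultimately show "\<phi> \<in> ?T" using f(3) by (auto simp: H_def)
  next
    fix \<phi> assume \<phi>: "\<phi> \<in> ?T"
    then obtain h where h: "h \<in> bdd_meas M" "\<phi> = functional h"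
      using dual_ball_functional[OF dual] by blast
    have qs: "qs PP (\<lambda>\<omega>. \<bar>h \<omega>\<bar> \<le> K)" using \<phi> h functional_in_dual_ball by auto
    have "\<exists>g\<in>F. AE \<omega> in Q. h \<omega> = g \<omega>" if Q: "Q \<in> QQ" for Q
    proof (rule ccontr)
      assume notin: "\<not> (\<exists>g\<in>F. AE \<omega> in Q. h \<omega> = g \<omega>)"
      have Q': "Q \<in> prob_measures M" "dominated M {Q} PP" using Q QQ by (auto simp: dominated_def)
      then have Q'': "prob_space Q" "sets Q = sets M" by (auto simp: prob_measures_def)
      interpret prob_space Q by fact
      have "\<exists>x\<in>H. \<phi> (fst x) < snd x"
      \<comment> \<open>With nothing to separate from, every threshold is admissible in
        \<open>H\<close>, and the zero measure with a raised one already excludes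
        \<open>\<phi>\<close>.\<close>
      proof (cases "bounded_part K = {}")
        case True
        have "(\<lambda>A. 0) \<in> E" by (simp add: ca_c_def ca_def)
        then have "(\<lambda>A. 0, \<phi> (\<lambda>A. 0) + 1) \<in> H" using True by (simp add: H_def)
        then show ?thesis by force
      next
        case False
        have "\<exists>Z\<in>bdd_meas M. \<exists>e>0. \<forall>f\<in>bounded_part K. (\<integral>\<omega>. Z \<omega> * h \<omega> \<partial>Q) + e \<le> (\<integral>\<omega>. Z \<omega> * f \<omega> \<partial>Q)"
        proof (rule L2_separation[OF Q'' _ False])
          show "bounded_part K \<subseteq> bdd_meas M" using bounded_part by blast
          show "\<bar>f \<omega>\<bar> \<le> K" if "f \<in> bounded_part K" "\<omega> \<in> space M" for f \<omega>
            using that by (simp add: bounded_part_def)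
          show "(\<lambda>\<omega>. t * f \<omega> + (1 - t) * g \<omega>) \<in> bounded_part K"
            if fg: "f \<in> bounded_part K" "g \<in> bounded_part K" and t: "0 \<le> t" "t \<le> 1" for f g t
          proof -
            have "\<bar>t * f \<omega> + (1 - t) * g \<omega>\<bar> \<le> K" if "\<omega> \<in> space M" for \<omega>
            proof -
              have "\<bar>t * f \<omega> + (1 - t) * g \<omega>\<bar> \<le> t * \<bar>f \<omega>\<bar> + (1 - t) * \<bar>g \<omega>\<bar>"
                using t by (intro order_trans[OF abs_triangle_ineq]) (simp add: abs_mult)
              also have "\<dots> \<le> t * K + (1 - t) * K"
                using fg t that by (intro add_mono mult_left_mono) (auto simp: bounded_part_def)
              finally show ?thesis by (simp add: algebra_simps)
            qed
            then show ?thesis using F_convex[OF bounded_part(1)[OF fg(1)] bounded_part(1)[OF fg(2)] t] by (simp add: bounded_part_def)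
          qed
          show "\<exists>g\<in>bounded_part K. AE \<omega> in Q. (\<lambda>n. f n \<omega>) \<longlonglongrightarrow> g \<omega>"
            if "\<And>n. f n \<in> bounded_part K" "AE \<omega> in Q. convergent (\<lambda>n. f n \<omega>)" for f
            using that by (rule bounded_part_closed_AE[OF Q''])
          show "h \<in> bdd_meas M" by fact
          show "\<not> (AE \<omega> in Q. h \<omega> = g \<omega>)" if "g \<in> bounded_part K" for g
            using notin bounded_part(1)[OF that] by blast
        qed
        then obtain Z e where Z: "Z \<in> bdd_meas M" "0 < e"
          "\<And>f. f \<in> bounded_part K \<Longrightarrow> (\<integral>\<omega>. Z \<omega> * h \<omega> \<partial>Q) + e \<le> (\<integral>\<omega>. Z \<omega> * f \<omega> \<partial>Q)" by blast
        define \<mu> where "\<mu> = density_ca M Q Z"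
        have \<mu>: "\<mu> \<in> E" unfolding \<mu>_def by (rule density_in_E[OF Q' Z(1)])
        have eq: "functional f \<mu> = (\<integral>\<omega>. Z \<omega> * f \<omega> \<partial>Q)" if "f \<in> bdd_meas M" for f
          using signed_integral_density_ca[OF finite_measure_axioms Q''(2) Z(1) that] \<mu>
          by (simp add: functional_def \<mu>_def)
        \<comment> \<open>The gap \<open>e\<close> makes this half-space valid on the bounded part
          and violated by \<open>h\<close>.\<close>
        have "(\<mu>, functional h \<mu> + e) \<in> H" using \<mu> Z(3) bounded_part(2) by (simp add: H_def eq h(1))
        then show ?thesis using h(2) \<open>0 < e\<close> by force
      qed
      then show False using \<phi> by force
    qed
    then have "h \<in> F" by (rule sensitive[OF h(1)])
    then show "\<phi> \<in> ?S" using h(2) qs by blast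
  qed
  moreover have "closed {\<phi>. \<forall>x\<in>H. snd x \<le> \<phi> (fst x)}"
    by (intro closed_Collect_ball closed_Collect_le continuous_intros continuous_on_product_coordinates)
  ultimately show ?thesis using compact_Int_closed[OF compact_dual_ball] by simp
qed

lemma separation_from_point:
  assumes h: "h \<in> bdd_meas M" "h \<notin> F"
  shows "\<exists>\<mu>\<in>E. \<forall>f\<in>F. functional h \<mu> + 1 \<le> functional f \<mu>"
proof -
  have Fm: "f \<in> bdd_meas M" if "f \<in> F" for f using that F_bdd by blast
  interpret dual_convex_set E "tv_norm M" "functional ` F" "functional h"
  proof
    show "(\<lambda>A. a * \<mu> A + b * \<nu> A) \<in> E" if "\<mu> \<in> E" "\<nu> \<in> E" for \<mu> \<nu> a b by (rule E_lincomb[OF that])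
    have "(\<lambda>A. 0) \<in> E" by (simp add: ca_c_def ca_def)
    then show "E \<noteq> {}" by blast
    show "tv_norm M (\<lambda>A. a * \<mu> A + b * \<nu> A) \<le> \<bar>a\<bar> * tv_norm M \<mu> + \<bar>b\<bar> * tv_norm M \<nu>"
      if "\<mu> \<in> E" "\<nu> \<in> E" for \<mu> \<nu> a b using that by (intro tv_norm_lincomb E_ca)
    show "0 \<le> tv_norm M \<mu>" if "\<mu> \<in> E" for \<mu> using that by (intro tv_norm_nonneg E_ca)
    show "\<exists>\<mu>\<in>E. (\<lambda>k. tv_norm M (\<lambda>A. x k A - \<mu> A)) \<longlonglongrightarrow> 0"
      if x: "\<And>k. x k \<in> E" and r: "\<And>k. tv_norm M (\<lambda>A. x (Suc k) A - x k A) \<le> r k" "summable r" for x r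
    proof -
      obtain \<mu> where \<mu>: "\<mu> \<in> ca M" "(\<lambda>k. tv_norm M (\<lambda>A. x k A - \<mu> A)) \<longlonglongrightarrow> 0" "\<And>A. (\<lambda>k. x k A) \<longlonglongrightarrow> \<mu> A"
        using ca_complete[OF E_ca[OF x] r] by blast
      have "\<mu> A = 0" if "A \<in> sets M" "capacity PP A = 0" for A
        using \<mu>(3)[of A] E_null[OF x that] by (simp add: LIMSEQ_const_iff)
      then show ?thesis using \<mu> by (auto simp: ca_c_def)
    qed
    show "\<phi> (\<lambda>A. a * \<mu> A + b * \<nu> A) = a * \<phi> \<mu> + b * \<phi> \<nu>"
      if "\<phi> \<in> insert (functional h) (functional ` F)" "\<mu> \<in> E" "\<nu> \<in> E" for \<phi> \<mu> \<nu> a b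
      using that h(1) Fm functional_lincomb by auto
    show "\<exists>K. \<forall>\<mu>\<in>E. \<bar>\<phi> \<mu> - functional h \<mu>\<bar> \<le> K * tv_norm M \<mu>" if "\<phi> \<in> functional ` F" for \<phi>
    proof -
      from that obtain f where f: "f \<in> F" "\<phi> = functional f" by blast
      have fh: "(\<lambda>\<omega>. f \<omega> - h \<omega>) \<in> bdd_meas M" using Fm[OF f(1)] h(1) by (rule bdd_meas_diff)
      obtain K where "\<forall>\<omega>\<in>space M. \<bar>f \<omega> - h \<omega>\<bar> \<le> K" using bdd_meas_bound[OF fh] by blast
      then have "qs PP (\<lambda>\<omega>. \<bar>f \<omega> - h \<omega>\<bar> \<le> K)" using space_PP by (auto simp: qs_def intro!: AE_I2)
      then show ?thesis
        using functional_bound[OF fh] f(2) functional_diff[OF Fm[OF f(1)] h(1)] by auto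
    qed
    show "(\<lambda>x. t * \<phi> x + (1 - t) * \<psi> x) \<in> functional ` F"
      if "\<phi> \<in> functional ` F" "\<psi> \<in> functional ` F" "0 \<le> t" "t \<le> 1" for \<phi> \<psi> t
    proof -
      from that obtain f g where fg: "f \<in> F" "g \<in> F" "\<phi> = functional f" "\<psi> = functional g" by blast
      have "(\<lambda>x. t * \<phi> x + (1 - t) * \<psi> x) = functional (\<lambda>\<omega>. t * f \<omega> + (1 - t) * g \<omega>)"
        using functional_lincomb_right[OF Fm[OF fg(1)] Fm[OF fg(2)]] fg by auto
      then show ?thesis using F_convex[OF fg(1,2) that(3,4)] by blast
    qed
    show "compact {\<phi> \<in> functional ` F. \<forall>\<mu>\<in>E. \<bar>\<phi> \<mu> - functional h \<mu>\<bar> \<le> K * tv_norm M \<mu>}" for K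
    proof -
      \<comment> \<open>Functionals within \<open>K\<close> of that of \<open>h\<close> come from
        functions bounded quasi-surely by \<open>\<bar>K\<bar> + H\<close>, so the ball around
        \<open>h\<close> is a closed part of a compact set. The absolute value covers negative
        \<open>K\<close>.\<close>
      obtain H where H: "0 \<le> H" "\<And>\<omega>. \<omega> \<in> space M \<Longrightarrow> \<bar>h \<omega>\<bar> \<le> H" using bdd_meas_bound[OF h(1)] by blast
      have hH: "qs PP (\<lambda>\<omega>. \<bar>h \<omega>\<bar> \<le> H)" using H space_PP by (auto simp: qs_def intro!: AE_I2)
      define C where "C = {\<phi>. \<forall>\<mu>\<in>E. \<bar>\<phi> \<mu> - functional h \<mu>\<bar> \<le> K * tv_norm M \<mu>}"
      have "closed C" unfolding C_def
        by (intro closed_Collect_ball closed_Collect_le continuous_intros continuous_on_product_coordinates)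
      have "qs PP (\<lambda>\<omega>. \<bar>f \<omega>\<bar> \<le> \<bar>K\<bar> + H)" if f: "f \<in> F" "functional f \<in> C" for f
      proof -
        have fh: "(\<lambda>\<omega>. f \<omega> - h \<omega>) \<in> bdd_meas M" using Fm[OF f(1)] h(1) by (rule bdd_meas_diff)
        have "qs PP (\<lambda>\<omega>. \<bar>f \<omega> - h \<omega>\<bar> \<le> K)"
          using functional_bound[OF fh, of K] f(2) functional_diff[OF Fm[OF f(1)] h(1)]
          by (simp add: C_def)
        then show ?thesis using hH by (rule qs_conj_imp) linarith
      qed
      then have "{\<phi> \<in> functional ` F. \<phi> \<in> C} =
          functional ` {f\<in>F. qs PP (\<lambda>\<omega>. \<bar>f \<omega>\<bar> \<le> \<bar>K\<bar> + H)} \<inter> C" by blast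
      then have "compact {\<phi> \<in> functional ` F. \<phi> \<in> C}"
        using compact_Int_closed[OF compact_functional_bounded \<open>closed C\<close>, of "\<bar>K\<bar> + H"] H(1) by simp
      then show ?thesis by (simp add: C_def)
    qed
    show "\<exists>\<mu>\<in>E. \<phi> \<mu> \<noteq> functional h \<mu>" if "\<phi> \<in> functional ` F" for \<phi>
    proof (rule ccontr)
      assume eq: "\<not> (\<exists>\<mu>\<in>E. \<phi> \<mu> \<noteq> functional h \<mu>)"
      from that obtain f where f: "f \<in> F" "\<phi> = functional f" by blast
      have fh: "(\<lambda>\<omega>. f \<omega> - h \<omega>) \<in> bdd_meas M" using Fm[OF f(1)] h(1) by (rule bdd_meas_diff)
      \<comment> \<open>Functionals that agree on \<open>ca_c\<close> are at distance 0, and the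
        norm identity turns this into quasi-sure equality.\<close>
      have "qs PP (\<lambda>\<omega>. \<bar>f \<omega> - h \<omega>\<bar> \<le> 0)"
        using functional_bound[OF fh, of 0] eq f(2) functional_diff[OF Fm[OF f(1)] h(1)] by simp
      then have "qs PP (\<lambda>\<omega>. f \<omega> = h \<omega>)" by (rule qs_mono) simp
      then show False using F_cong[OF f(1) h(1)] h(2) by blast
    qed
  qed
  show ?thesis using separation by (force simp: algebra_simps)
qed

end

subsection \<open>The equivalence\<close>

context uncertainty
begin

section \<open>From weak closedness to sensitivity and the Fatou property\<close>

lemma AE_dominated:
  assumes Q: "Q \<in> prob_measures M" "dominated M {Q} PP"
    and S: "qs PP S" "{\<omega>\<in>space M. \<not> S \<omega>} \<in> sets M"
  shows "AE \<omega> in Q. S \<omega>"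
proof -
  have Q': "prob_space Q" "sets Q = sets M" using Q by (auto simp: prob_measures_def)
  interpret prob_space Q by fact
  have "measure Q {\<omega>\<in>space M. \<not> S \<omega>} = 0"
    using Q(2) S(2) qs_null[OF S] by (simp add: dominated_def)
  then show ?thesis
    using S(2) Q'(2) sets_eq_imp_space_eq[OF Q'(2)]
    by (intro AE_I[of _ _ "{\<omega>\<in>space M. \<not> S \<omega>}"]) (auto simp: emeasure_eq_measure)
qed

text \<open>Each step adds the total variation of the new measure to \<open>Q\<close> and
  normalises. Starting from a member of \<open>PP\<close> keeps the mass positive even when all
  measures in \<open>F\<close> vanish.\<close>

lemma dominating_probability:
  assumes "finite F" "F \<subseteq> E"
  shows "\<exists>Q\<in>prob_measures M. dominated M {Q} PP \<and> (\<forall>\<mu>\<in>F. \<forall>A\<in>sets M. measure Q A = 0 \<longrightarrow>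
    measure (jordan_pos M \<mu>) A = 0 \<and> measure (jordan_neg M \<mu>) A = 0)"
  using assms
proof (induction F rule: finite_induct)
  case empty
  obtain P where "P \<in> PP" using PP_nonempty by blast
  then show ?case using PP dominated_PP by auto
next
  case (insert \<mu> F)
  then obtain Q where Q: "Q \<in> prob_measures M" "dominated M {Q} PP"
    "\<And>\<mu> A. \<mu> \<in> F \<Longrightarrow> A \<in> sets M \<Longrightarrow> measure Q A = 0 \<Longrightarrow>
      measure (jordan_pos M \<mu>) A = 0 \<and> measure (jordan_neg M \<mu>) A = 0" by auto
  have Q': "prob_space Q" "sets Q = sets M" using Q(1) by (auto simp: prob_measures_def)
  interpret prob_space Q by fact
  have \<mu>: "\<mu> \<in> E" "\<mu> \<in> ca M" using insert.prems E_ca by auto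
  let ?p = "measure (jordan_pos M \<mu>)" and ?n = "measure (jordan_neg M \<mu>)"
  define s where "s = 1 + (?p (space M) + ?n (space M))"
  have "0 < s" unfolding s_def by (intro add_pos_nonneg) auto
  define \<nu> where "\<nu> = (\<lambda>A. 1 / s * measure Q A + 1 / s * (1 * ?p A + 1 * ?n A))"
  have "\<nu> \<in> ca M"
    unfolding \<nu>_def
    by (intro ca_lincomb measure_in_ca jordan(1-4)[OF \<mu>(2)] Q'(2) finite_measure_axioms)
  moreover have "0 \<le> \<nu> A" for A unfolding \<nu>_def using \<open>0 < s\<close> by simp
  moreover define R where "R = measure_of (space M) (sets M) (\<lambda>A. ennreal (\<nu> A))"
  ultimately have R: "sets R = sets M" "finite_measure R" "\<And>A. A \<in> sets M \<Longrightarrow> measure R A = \<nu> A"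
    using measure_of_ca[of \<nu> M \<nu> R] by auto
  have "space R = space M" "space Q = space M"
    using sets_eq_imp_space_eq[OF R(1)] sets_eq_imp_space_eq[OF Q'(2)] .
  then have "measure Q (space M) = 1" using prob_space by simp
  moreover have \<nu>_eq: "\<nu> A = (measure Q A + (?p A + ?n A)) / s" for A
    by (simp add: \<nu>_def add_divide_distrib)
  ultimately have "\<nu> (space M) = s / s" unfolding \<nu>_eq s_def by (simp only:)
  then have "measure R (space R) = 1" using \<open>space R = space M\<close> R(3) \<open>0 < s\<close> by simp
  then have "R \<in> prob_measures M"
    using R(1) finite_measure.emeasure_eq_measure[OF R(2), of "space R"]
    by (simp add: prob_measures_def prob_spaceI)
  have R_zero: "measure R A = 0 \<longleftrightarrow> measure Q A = 0 \<and> ?p A = 0 \<and> ?n A = 0" if "A \<in> sets M" for A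
    using R(3)[OF that] \<open>0 < s\<close> by (simp add: \<nu>_eq add_nonneg_eq_0_iff)
  have "dominated M {R} PP"
    unfolding dominated_def
  proof (intro ballI impI)
    fix A R' assume A: "A \<in> sets M" "capacity PP A = 0" and "R' \<in> {R}"
    \<comment> \<open>\<open>jordan_null\<close> asks about every measurable subset, so null sets of
      the capacity are first shown to be hereditary.\<close>
    have "capacity PP C = 0" if "C \<in> sets M" "C \<subseteq> A" for C
      unfolding capacity_zero_iff
    proof
      fix P assume P: "P \<in> PP"
      then have "measure P C \<le> measure P A"
        using that A sets_PP[OF P] prob_space.finite_measure[OF prob_PP[OF P]]
        by (intro finite_measure.finite_measure_mono) auto
      then show "measure P C = 0" using A(2) P by (simp add: capacity_zero_iff order_antisym)
    qed
    then have "?p A = 0 \<and> ?n A = 0" using E_null[OF \<mu>(1)] by (intro jordan_null[OF \<mu>(2) A(1)]) auto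
    moreover have "measure Q A = 0" using Q(2) A by (simp add: dominated_def)
    ultimately show "measure R' A = 0" using R_zero[OF A(1)] \<open>R' \<in> {R}\<close> by simp
  qed
  then show ?case using \<open>R \<in> prob_measures M\<close> R_zero Q(3) by (intro bexI[of _ R]) auto
qed

lemma sensitive_if_closedin:
  assumes A: "A \<subseteq> L" and closed: "closedin (weak_topology M PP) A"
  shows "sensitive M PP A"
proof -
  \<comment> \<open>The largest admissible family, since the separating \<open>Q\<close> depends on
    \<open>X\<close>.\<close>
  define QQ where "QQ = {Q\<in>prob_measures M. dominated M {Q} PP}"
  have "X \<in> A" if X: "X \<in> L" "X \<in> (\<Inter>Q\<in>QQ. j_map M Q -` (j_map M Q ` A))" for X
  proof (rule ccontr)
    assume "X \<notin> A"
    have "openin (weak_topology M PP) (L - A)" "X \<in> L - A"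
      using closed X(1) \<open>X \<notin> A\<close> by (auto simp: closedin_def topspace_weak_topology)
    from openin_weak_topologyD[OF this] obtain F e where F: "finite F" "F \<subseteq> E" "0 < e"
      "\<forall>Y\<in>L. (\<forall>\<mu>\<in>F. \<bar>pairing M \<mu> Y - pairing M \<mu> X\<bar> < e) \<longrightarrow> Y \<in> L - A"
      by (elim exE conjE) rule
    obtain Q where Q: "Q \<in> QQ" "\<And>\<mu> N. \<mu> \<in> F \<Longrightarrow> N \<in> sets M \<Longrightarrow> measure Q N = 0 \<Longrightarrow>
        measure (jordan_pos M \<mu>) N = 0 \<and> measure (jordan_neg M \<mu>) N = 0"
      using dominating_probability[OF F(1,2)] unfolding QQ_def by blast
    have Q': "prob_space Q" "sets Q = sets M" using Q(1) by (auto simp: QQ_def prob_measures_def)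
    interpret prob_space Q by fact
    obtain Y where Y: "Y \<in> A" "j_map M Q X = j_map M Q Y" using X(2) Q(1) by blast
    have bdd: "rep X \<in> bdd_meas M" "rep Y \<in> bdd_meas M" using rep_bdd_meas X(1) Y(1) A by blast+
    have [measurable]: "rep X \<in> borel_measurable M" "rep Y \<in> borel_measurable M"
      using bdd by (auto simp: bdd_meas_def)
    define N where "N = {\<omega>\<in>space M. \<not> rep X \<omega> = rep Y \<omega>}"
    have N: "N \<in> sets M" unfolding N_def by measurable
    have "AE \<omega> in Q. rep X \<omega> = rep Y \<omega>"
      using Y(2) qs_class_eq_iff[OF bdd, of "{Q}"] by (simp add: j_map_def qs_def)
    then have "measure Q N = 0"
      using N Q'(2) sets_eq_imp_space_eq[OF Q'(2)] AE_iff_measurable[of N Q "\<lambda>\<omega>. rep X \<omega> = rep Y \<omega>"]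
      by (simp add: N_def measure_def)
    \<comment> \<open>Equality under \<open>Q\<close> makes the pairings equal, not merely close, so
      \<open>Y\<close> lies in every neighbourhood of \<open>X\<close> given by
      \<open>F\<close>.\<close>
    have "pairing M \<mu> X = pairing M \<mu> Y" if \<mu>: "\<mu> \<in> F" for \<mu>
    proof -
      have \<mu>_ca: "\<mu> \<in> ca M" using \<mu> F(2) E_ca by blast
      have "\<mu> C = 0" if C: "C \<in> sets M" "C \<subseteq> N" for C
      proof -
        have "measure Q C \<le> measure Q N" using N C Q'(2) by (intro finite_measure_mono) auto
        then have "measure Q C = 0" using \<open>measure Q N = 0\<close> by (simp add: order_antisym)
        then show ?thesis using Q(2)[OF \<mu> C(1)] jordan_diff[OF \<mu>_ca, of C] by simp
      qed
      then show ?thesis unfolding pairing_def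
        using N unfolding N_def by (intro signed_integral_cong_AE bdd \<mu>_ca AE_jordan[OF \<mu>_ca]) auto
    qed
    then have "Y \<in> L - A" using F(3) Y(1) A F(4) by auto
    then show False using Y(1) by blast
  qed
  then have "A = L \<inter> (\<Inter>Q\<in>QQ. j_map M Q -` (j_map M Q ` A))" using A by blast
  moreover have "QQ \<subseteq> prob_measures M" "dominated M QQ PP" by (auto simp: QQ_def dominated_def)
  ultimately show ?thesis unfolding sensitive_def by blast
qed

lemma pairing_tendsto:
  assumes X: "\<And>n. X n \<in> L" and K: "\<And>n. Linf_norm PP (X n) \<le> K" and Y: "Y \<in> L"
    and lim: "qs PP (\<lambda>\<omega>. (\<lambda>n. rep (X n) \<omega>) \<longlonglongrightarrow> rep Y \<omega>)" and \<mu>: "\<mu> \<in> E"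
  shows "(\<lambda>n. pairing M \<mu> (X n)) \<longlonglongrightarrow> pairing M \<mu> Y"
proof -
  have [measurable]: "rep (X n) \<in> borel_measurable M" "rep Y \<in> borel_measurable M" for n
    using rep_bdd_meas[OF X] rep_bdd_meas[OF Y] by (auto simp: bdd_meas_def)
  \<comment> \<open>Convergence is expressed through \<open>Cauchy\<close> and \<open>lim\<close>,
    for which measurability can be derived.\<close>
  have lim_iff: "x \<longlonglongrightarrow> l \<longleftrightarrow> Cauchy x \<and> lim x = l" for x :: "nat \<Rightarrow> real" and l
    by (metis LIMSEQ_imp_Cauchy limI Cauchy_convergent_iff convergent_LIMSEQ_iff)
  have N: "{\<omega>\<in>space M. \<not> (\<lambda>n. rep (X n) \<omega>) \<longlonglongrightarrow> rep Y \<omega>} \<in> sets M"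
    unfolding lim_iff by measurable
  \<comment> \<open>\<open>K + 1\<close> lies strictly above the norm, as
    \<open>qs_abs_le_Linf_norm\<close> demands.\<close>
  have bd: "qs PP (\<lambda>\<omega>. \<bar>rep (X n) \<omega>\<bar> \<le> K + 1)" for n
    using K[of n] by (intro qs_abs_le_Linf_norm[OF X]) linarith
  have bdN: "{\<omega>\<in>space M. \<not> \<bar>rep (X n) \<omega>\<bar> \<le> K + 1} \<in> sets M" for n by measurable
  have tends: "(\<lambda>n. \<integral>\<omega>. rep (X n) \<omega> \<partial>m) \<longlonglongrightarrow> (\<integral>\<omega>. rep Y \<omega> \<partial>m)"
    if m: "finite_measure m" "sets m = sets M" "AE \<omega> in m. (\<lambda>n. rep (X n) \<omega>) \<longlonglongrightarrow> rep Y \<omega>"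
      "\<And>n. AE \<omega> in m. \<bar>rep (X n) \<omega>\<bar> \<le> K + 1" for m
  proof (rule integral_dominated_convergence[where w = "\<lambda>_. K + 1"])
    show "integrable m (\<lambda>_. K + 1)" using m(1) by (rule finite_measure.integrable_const)
    show "AE \<omega> in m. norm (rep (X n) \<omega>) \<le> K + 1" for n using m(4)[of n] by simp
  qed (use m measurable_cong_sets[OF m(2) refl, of "borel :: real measure"] in auto)
  show ?thesis
    unfolding pairing_def signed_integral_def
    by (intro tendsto_diff tends jordan(1-4)[OF E_ca[OF \<mu>]] AE_jordan_qs[OF \<mu> lim N]
        AE_jordan_qs[OF \<mu> bd bdN])
qed

lemma fatou_closed_if_closedin:
  assumes A: "A \<subseteq> L" and closed: "closedin (weak_topology M PP) A"
  shows "fatou_closed M PP A"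
  unfolding fatou_closed_def
proof (intro allI impI, elim exE)
  fix X :: "nat \<Rightarrow> ('a \<Rightarrow> real) set" and Y K
  assume X: "\<forall>n. X n \<in> A" and K: "\<forall>n. Linf_norm PP (X n) \<le> K" and Y: "Y \<in> L"
    and lim: "qs PP (\<lambda>\<omega>. (\<lambda>n. rep (X n) \<omega>) \<longlonglongrightarrow> rep Y \<omega>)"
  show "Y \<in> A"
  proof (rule ccontr)
    assume "Y \<notin> A"
    have "openin (weak_topology M PP) (L - A)" "Y \<in> L - A"
      using closed Y \<open>Y \<notin> A\<close> by (auto simp: closedin_def topspace_weak_topology)
    from openin_weak_topologyD[OF this] obtain F e where F: "finite F" "F \<subseteq> E" "0 < e"
      "\<forall>Z\<in>L. (\<forall>\<mu>\<in>F. \<bar>pairing M \<mu> Z - pairing M \<mu> Y\<bar> < e) \<longrightarrow> Z \<in> L - A"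
      by (elim exE conjE) rule
    have XL: "X n \<in> L" for n using X A by blast
    have "\<forall>\<^sub>F n in sequentially. \<forall>\<mu>\<in>F. \<bar>pairing M \<mu> (X n) - pairing M \<mu> Y\<bar> < e"
    proof (rule eventually_ball_finite[OF F(1)], rule ballI)
      fix \<mu> assume "\<mu> \<in> F"
      then have "(\<lambda>n. pairing M \<mu> (X n)) \<longlonglongrightarrow> pairing M \<mu> Y"
        using K F(2) by (intro pairing_tendsto[OF XL _ Y lim]) auto
      from tendstoD[OF this F(3)]
      show "\<forall>\<^sub>F n in sequentially. \<bar>pairing M \<mu> (X n) - pairing M \<mu> Y\<bar> < e"
        by (simp add: dist_real_def)
    qed
    then obtain n where "\<forall>\<mu>\<in>F. \<bar>pairing M \<mu> (X n) - pairing M \<mu> Y\<bar> < e"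
      using eventually_happens'[OF sequentially_bot] by blast
    then have "X n \<in> L - A" using F(4) XL by blast
    then show False using X by blast
  qed
qed

section \<open>From sensitivity and the Fatou property to weak closedness\<close>

lemma Linf_add_cls:
  assumes "f \<in> bdd_meas M" "g \<in> bdd_meas M"
  shows "Linf_add M PP (cls f) (cls g) = cls (\<lambda>\<omega>. f \<omega> + g \<omega>)"
  unfolding Linf_add_def
proof (subst qs_class_eq_iff)
  show "qs PP (\<lambda>\<omega>. rep (cls f) \<omega> + rep (cls g) \<omega> = f \<omega> + g \<omega>)"
    using rep_qs_class[OF assms(1), of PP] rep_qs_class[OF assms(2), of PP] by (rule qs_conj_imp) simp
  show "(\<lambda>\<omega>. rep (cls f) \<omega> + rep (cls g) \<omega>) \<in> bdd_meas M"
    by (intro bdd_meas_add rep_bdd_meas[OF qs_class_in_Linf] assms)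
  show "(\<lambda>\<omega>. f \<omega> + g \<omega>) \<in> bdd_meas M" by (rule bdd_meas_add[OF assms])
qed

lemma Linf_scale_cls:
  assumes "f \<in> bdd_meas M"
  shows "Linf_scale M PP t (cls f) = cls (\<lambda>\<omega>. t * f \<omega>)"
  unfolding Linf_scale_def
proof (subst qs_class_eq_iff)
  show "qs PP (\<lambda>\<omega>. t * rep (cls f) \<omega> = t * f \<omega>)"
    using rep_qs_class[OF assms, of PP] by (rule qs_mono) simp
  show "(\<lambda>\<omega>. t * rep (cls f) \<omega>) \<in> bdd_meas M"
    by (intro bdd_meas_mult bdd_meas_const rep_bdd_meas[OF qs_class_in_Linf] assms)
  show "(\<lambda>\<omega>. t * f \<omega>) \<in> bdd_meas M" by (intro bdd_meas_mult bdd_meas_const assms)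
qed

lemma closedin_if_sensitive_fatou_closed:
  assumes dual: "dual_ca_c_eq_Linf M PP" and A: "A \<subseteq> L"
    and convex: "Linf_convex M PP A" and monotone: "Linf_monotone M PP A"
    and sensitive: "sensitive M PP A" and fatou: "fatou_closed M PP A"
  shows "closedin (weak_topology M PP) A"
proof -
  obtain QQ where QQ: "QQ \<subseteq> prob_measures M" "dominated M QQ PP"
    and A_eq: "A = L \<inter> (\<Inter>Q\<in>QQ. j_map M Q -` (j_map M Q ` A))"
    using sensitive by (auto simp: sensitive_def)
  define F where "F = {f\<in>bdd_meas M. cls f \<in> A}"
  interpret fatou_sensitive M PP F QQ
  proof
    show "dual_ca_c_eq_Linf M PP" "QQ \<subseteq> prob_measures M" "dominated M QQ PP" by fact+
    show "F \<subseteq> bdd_meas M" by (auto simp: F_def)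
    show "g \<in> F" if f: "f \<in> F" and g: "g \<in> bdd_meas M" and le: "qs PP (\<lambda>\<omega>. f \<omega> \<le> g \<omega>)" for f g
    proof -
      have f': "f \<in> bdd_meas M" "cls f \<in> A" using f by (auto simp: F_def)
      \<comment> \<open>Writing \<open>g\<close> as \<open>f + w\<close> with a quasi-surely
        nonnegative \<open>w\<close> brings the inequality under monotonicity by addition of
        positive classes.\<close>
      define w where "w = (\<lambda>\<omega>. g \<omega> - f \<omega>)"
      have w: "w \<in> bdd_meas M" unfolding w_def using g f'(1) by (rule bdd_meas_diff)
      have "qs PP (\<lambda>\<omega>. 0 \<le> rep (cls w) \<omega>)"
        using le rep_qs_class[OF w, of PP] by (rule qs_conj_imp) (simp add: w_def)
      then have "qs PP (\<lambda>\<omega>. rep (Linf_zero M PP) \<omega> \<le> rep (cls w) \<omega>)"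
        unfolding Linf_zero_def using rep_qs_class[OF bdd_meas_const[of 0 M], of PP]
        by (rule qs_conj_imp) simp
      then have "cls w \<in> Linf_pos M PP"
        using qs_class_in_Linf[OF w] by (simp add: Linf_pos_def Linf_le_def)
      then have "Linf_add M PP (cls f) (cls w) \<in> A"
        using monotone f'(2) unfolding Linf_monotone_def by blast
      also have "Linf_add M PP (cls f) (cls w) = cls g"
        by (simp add: Linf_add_cls[OF f'(1) w]) (simp add: w_def)
      finally show ?thesis using g by (simp add: F_def)
    qed
    show "(\<lambda>\<omega>. t * f \<omega> + (1 - t) * g \<omega>) \<in> F" if "f \<in> F" "g \<in> F" and t: "0 \<le> t" "t \<le> 1" for f g t
    proof -
      have fg: "f \<in> bdd_meas M" "cls f \<in> A" "g \<in> bdd_meas M" "cls g \<in> A" using that by (auto simp: F_def)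
      have tf: "(\<lambda>\<omega>. t * f \<omega>) \<in> bdd_meas M" "(\<lambda>\<omega>. (1 - t) * g \<omega>) \<in> bdd_meas M"
        using fg by auto
      have "Linf_add M PP (Linf_scale M PP t (cls f)) (Linf_scale M PP (1 - t) (cls g)) \<in> A"
        using convex fg t unfolding Linf_convex_def by blast
      then show ?thesis
        using tf by (simp add: Linf_scale_cls fg Linf_add_cls F_def bdd_meas_add)
    qed
    show "g \<in> F"
      if f: "\<And>n::nat. f n \<in> F" and K: "\<And>n \<omega>. \<omega> \<in> space M \<Longrightarrow> \<bar>f n \<omega>\<bar> \<le> K" and g: "g \<in> bdd_meas M"
        and lim: "\<And>\<omega>. \<omega> \<in> space M \<Longrightarrow> (\<lambda>n. f n \<omega>) \<longlonglongrightarrow> g \<omega>" for f g K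
    proof -
      have f': "f n \<in> bdd_meas M" "cls (f n) \<in> A" for n using f[of n] by (auto simp: F_def)
      have "Linf_norm PP (cls (f n)) \<le> K" for n
      proof (rule Linf_norm_le[OF qs_class_in_Linf[OF f'(1)]])
        have "qs PP (\<lambda>\<omega>. \<bar>f n \<omega>\<bar> \<le> K)" using K space_PP by (auto simp: qs_def intro!: AE_I2)
        then show "qs PP (\<lambda>\<omega>. \<bar>rep (cls (f n)) \<omega>\<bar> \<le> K)"
          using rep_qs_class[OF f'(1), of PP n] by (rule qs_conj_imp) simp
      qed
      moreover have "qs PP (\<lambda>\<omega>. (\<lambda>n. rep (cls (f n)) \<omega>) \<longlonglongrightarrow> rep (cls g) \<omega>)"
        unfolding qs_def
      proof
        fix P assume P: "P \<in> PP"
        \<comment> \<open>Chosen representatives may differ from \<open>f n\<close> on a null set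
          for each \<open>n\<close>; countably many of these are joined.\<close>
        have "AE \<omega> in P. \<forall>n. rep (cls (f n)) \<omega> = f n \<omega>"
          unfolding AE_all_countable using rep_qs_class[OF f'(1)] P by (auto simp: qs_def)
        moreover have "AE \<omega> in P. rep (cls g) \<omega> = g \<omega>"
          using rep_qs_class[OF g] P by (auto simp: qs_def)
        ultimately show "AE \<omega> in P. (\<lambda>n. rep (cls (f n)) \<omega>) \<longlonglongrightarrow> rep (cls g) \<omega>"
          using AE_space by eventually_elim (simp add: lim space_PP[OF P])
      qed
      ultimately have "cls g \<in> A"
        using fatou[unfolded fatou_closed_def, rule_format, of "\<lambda>n. cls (f n)" "cls g"]
          f'(2) qs_class_in_Linf[OF g] by blast
      then show ?thesis using g by (simp add: F_def)
    qed
    show "f \<in> F" if f: "f \<in> bdd_meas M" and ex: "\<And>Q. Q \<in> QQ \<Longrightarrow> \<exists>g\<in>F. AE \<omega> in Q. f \<omega> = g \<omega>" for f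
    proof -
      have j: "j_map M Q (cls f) \<in> j_map M Q ` A" if Q: "Q \<in> QQ" for Q
      proof -
        obtain g where g: "g \<in> bdd_meas M" "cls g \<in> A" "AE \<omega> in Q. f \<omega> = g \<omega>"
          using ex[OF Q] by (auto simp: F_def)
        have Q': "Q \<in> prob_measures M" "dominated M {Q} PP" using Q QQ by (auto simp: dominated_def)
        \<comment> \<open>\<open>j_map\<close> works with the chosen representative, which agrees
          with \<open>k\<close> quasi-surely; domination carries this over to
          \<open>Q\<close>.\<close>
        have eq: "AE \<omega> in Q. rep (cls k) \<omega> = k \<omega>" if k: "k \<in> bdd_meas M" for k
        proof (rule AE_dominated[OF Q' rep_qs_class[OF k]])
          have [measurable]: "k \<in> borel_measurable M" "rep (cls k) \<in> borel_measurable M"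
            using k rep_bdd_meas[OF qs_class_in_Linf[OF k]] by (auto simp: bdd_meas_def)
          show "{\<omega>\<in>space M. \<not> rep (cls k) \<omega> = k \<omega>} \<in> sets M" by measurable
        qed
        have "AE \<omega> in Q. rep (cls f) \<omega> = rep (cls g) \<omega>"
          using eq[OF f] eq[OF g(1)] g(3) by eventually_elim simp
        then have "j_map M Q (cls f) = j_map M Q (cls g)"
          unfolding j_map_def
          using qs_class_eq_iff[OF rep_bdd_meas[OF qs_class_in_Linf[OF f]] rep_bdd_meas[OF qs_class_in_Linf[OF g(1)]], of "{Q}"]
          by (simp add: qs_def)
        then show ?thesis using g(2) by blast
      qed
      have "cls f \<in> L \<inter> (\<Inter>Q\<in>QQ. j_map M Q -` (j_map M Q ` A))"
        by (intro IntI INT_I vimageI2 qs_class_in_Linf[OF f] j)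
      then have "cls f \<in> A" using equalityD2[OF A_eq] by (rule rev_subsetD)
      then show ?thesis using f by (simp add: F_def)
    qed
  qed
  have "\<exists>V. openin (weak_topology M PP) V \<and> X \<in> V \<and> V \<subseteq> L - A" if X: "X \<in> L - A" for X
  proof -
    have "rep X \<notin> F" "rep X \<in> bdd_meas M"
      using X qs_class_rep[of X M PP] rep_bdd_meas[of X M PP] by (auto simp: F_def)
    then obtain \<mu> where \<mu>: "\<mu> \<in> E" "\<And>f. f \<in> F \<Longrightarrow> functional (rep X) \<mu> + 1 \<le> functional f \<mu>"
      using separation_from_point by blast
    \<comment> \<open>\<open>X\<close> lies strictly inside this half-space, while the separation
      puts every member of \<open>A\<close> on or beyond its boundary.\<close>
    define V where "V = {Y \<in> L. pairing M \<mu> Y < pairing M \<mu> X + 1}"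
    have "Y \<notin> A" if "Y \<in> V" for Y
    proof
      assume "Y \<in> A"
      then have "rep Y \<in> F" using A qs_class_rep[of Y M PP] rep_bdd_meas[of Y M PP] by (auto simp: F_def)
      from \<mu>(2)[OF this] show False using that \<mu>(1) by (simp add: V_def functional_def pairing_def)
    qed
    moreover have "openin (weak_topology M PP) V" unfolding V_def by (rule openin_halfspace[OF \<mu>(1)])
    moreover have "X \<in> V" using X by (simp add: V_def)
    ultimately show ?thesis by (intro exI[of _ V]) (auto simp: V_def)
  qed
  then have "openin (weak_topology M PP) (L - A)" by (subst openin_subopen) blast
  then show ?thesis using A by (simp add: closedin_def topspace_weak_topology)
qed

end

theorem theorem3p9:
  fixes M :: "'a measure" and PP :: "'a measure set" and \<A> :: "('a \<Rightarrow> real) set set"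
  assumes "PP \<subseteq> prob_measures M" and "PP \<noteq> {}"
    and "dual_ca_c_eq_Linf M PP"
    and "\<A> \<subseteq> Linf M PP"
    and "Linf_convex M PP \<A>"
    and "Linf_monotone M PP \<A>"
  shows "closedin (weak_topology M PP) \<A> \<longleftrightarrow> sensitive M PP \<A> \<and> fatou_closed M PP \<A>"
proof -
  interpret uncertainty M PP using assms(1,2) by unfold_locales
  show ?thesis
    using sensitive_if_closedin[OF assms(4)] fatou_closed_if_closedin[OF assms(4)]
      closedin_if_sensitive_fatou_closed[OF assms(3-6)] by blast
qed

end
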